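(* Let $c\in\mathbb{C}$, $c\neq0$, let $f$ be a nonconstant meromorphic function on $\mathbb{C}$ and let $P$ be a polynomial. Then $f$ is a solution of $$f^3(z)+f^3(z+c)=e^{P(z)}$$ if and only if $P(z)=\alpha z+\beta$ with two constants $\alpha,\beta$ and $f$ satisfies one of the following: (a) $f(z)=d\,e^{\frac{\alpha z+\beta}{3}}$, where $d$ is a nonzero constant with $d^3(1+e^{\alpha c})=1$; (b) $$f(z)=e^{\frac{\alpha z+\beta}{3}}\,\frac{\frac12\left\{1+\frac{\wp'(h(z))}{\sqrt3}\right\}}{\wp(h(z))},$$ where $e^{\alpha c}=1$ and $h$ is a nonconstant entire function satisfying one of the following equations: (1) $h(z+c)=Ah(z)+\theta_1+\tau_1$ with some $\tau_1\in\mathbb{L}$; (2) $h(z+c)=Ah(z)+\theta_2+\tau_2$ with some $\tau_2\in\mathbb{L}$; (3) $h(z+c)=Ah(z)+\tau_3$ with some $\tau_3\in\mathbb{L}$; where $A$ is a constant with $A^3=-1$ and $A\tau\in\mathbb{L}$ for every period $\tau$ of $\wp$.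
   Context: Meromorphic and entire functions are on the whole complex plane $\mathbb{C}$, and $f^3(z)$ means $(f(z))^3$. $\wp$ denotes the Weierstrass elliptic function $$\wp(z)=\frac1{z^2}+\sum_{\mu,\nu\in\mathbb{Z};\,\mu^2+\nu^2\neq0}\left\{\frac1{(z+\mu\omega_1+\nu\omega_2)^2}-\frac1{(\mu\omega_1+\nu\omega_2)^2}\right\}$$ with periods $\omega_1,\omega_2$ ($\operatorname{Im}(\omega_1/\omega_2)\neq0$) chosen so that $(\wp')^2=4\wp^3-1$. Its period lattice is $\mathbb{L}=\{\mu\omega_1+\nu\omega_2:\mu,\nu\in\mathbb{Z}\}$. In the period parallelogram $D$ with vertices $0,\omega_1,\omega_2,\omega_1+\omega_2$, $\wp$ has exactly two distinct zeros $\theta_1,\theta_2$, labelled so that $\wp'(\theta_1)=-i$ and $\wp'(\theta_2)=i$. *)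

theory Defs
  imports "HOL-Complex_Analysis.Complex_Analysis"
begin

definition period_lattice :: "complex \<Rightarrow> complex \<Rightarrow> complex set" where
  "period_lattice \<omega>\<^sub>1 \<omega>\<^sub>2 = {of_int \<mu> * \<omega>\<^sub>1 + of_int \<nu> * \<omega>\<^sub>2 | \<mu> \<nu>. True}"

(* Half-open, so that it contains exactly one point of each class modulo the lattice. *)
definition period_parallelogram :: "complex \<Rightarrow> complex \<Rightarrow> complex set" where
  "period_parallelogram \<omega>\<^sub>1 \<omega>\<^sub>2 =
     {of_real s * \<omega>\<^sub>1 + of_real t * \<omega>\<^sub>2 | s t. s \<in> {0..<1} \<and> t \<in> {0..<1}}"

(* The value at a lattice point is meaningless: in particular 1 / 0 = 0 makes this function
   vanish at 0, where the mathematical function has a pole. Statements about its values,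
   zeros or derivative therefore have to exclude the lattice. *)
definition weierstrass_p :: "complex \<Rightarrow> complex \<Rightarrow> complex \<Rightarrow> complex" where
  "weierstrass_p \<omega>\<^sub>1 \<omega>\<^sub>2 z = 1 / z ^ 2 +
     (\<Sum>\<^sub>\<infinity>(\<mu>, \<nu>)\<in>{(\<mu> :: int, \<nu> :: int). \<mu> ^ 2 + \<nu> ^ 2 \<noteq> 0}.
        1 / (z + of_int \<mu> * \<omega>\<^sub>1 + of_int \<nu> * \<omega>\<^sub>2) ^ 2
          - 1 / (of_int \<mu> * \<omega>\<^sub>1 + of_int \<nu> * \<omega>\<^sub>2) ^ 2)"

end

theory Submission
  imports Defs
begin

text \<open>
  Divided by \<open>exp P\<close>, the equation says that \<open>F(z) = f(z) exp (- P(z) / 3)\<close> and \<open>G(z) = f(z + c) exp (- P(z) / 3)\<close> satisfy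
  \<open>F\<^sup>3 + G\<^sup>3 = 1\<close>. If \<open>F\<close> is constant, then so is \<open>exp (P(z + c) - P(z))\<close>; hence \<open>P\<close> is linear and \<open>f\<close> is an exponential
  (\<open>exponential_solution\<close>).

  Otherwise \<open>(F, G)\<close> maps the plane into the Fermat cubic \<open>u\<^sup>3 + v\<^sup>3 = 1\<close>. This is an elliptic curve, parametrised by
  \<open>U = (1 + \<wp>' / sqrt 3) / (2 \<wp>)\<close> and \<open>V = (1 - \<wp>' / sqrt 3) / (2 \<wp>)\<close>, with \<open>U' = sqrt 3 V\<^sup>2\<close>. The map lifts to an entire function
  \<open>h\<close> with \<open>F = U \<circ> h\<close> and \<open>G = V \<circ> h\<close> (\<open>fermat_lift\<close>): the holomorphic differential \<open>du / v\<^sup>2\<close> of the curve pulls back to an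
  entire differential on the plane, and \<open>h\<close> is a primitive of it.

  Since \<open>V(w) = U(- w)\<close>, comparing \<open>F(z + c)\<close> with \<open>G(z)\<close> gives \<open>U(h(z + c)) = exp (t(z)) U(- h(z))\<close> with the polynomial
  \<open>t(z) = (P(z) - P(z + c)) / 3\<close>. The heart of the proof is that \<open>exp t\<close> is a constant cube root of unity
  (\<open>shift_factor_trivial\<close>). Suppose that \<open>U \<circ> h1 = exp t \<cdot> U \<circ> h2\<close>. At a zero of \<open>U \<circ> h1\<close> the quotient
  \<open>|h1'| / |h2'|\<close> is \<open>|exp t|\<close>, at a pole it is \<open>1 / |exp t|\<close>, and at a zero of \<open>V \<circ> h1\<close> the distance of \<open>exp (- 3 t)\<close> from
  \<open>1\<close> is controlled by \<open>|t'| / |h2'|\<close>. A maximality argument in the manner of Bloch yields discs on which both derivatives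
  are nearly constant and on which the larger one makes its primitive run through all classes modulo the lattice, so that all
  three kinds of points occur (\<open>nearly_linear\<close>). There \<open>|exp t|\<close> is bounded from both sides, and \<open>exp (3 t)\<close> is close to
  \<open>1\<close>, of order \<open>3/2\<close> in \<open>|t'| / |h1'|\<close>, at two points between which a nonconstant \<open>t\<close> varies by a multiple of
  \<open>|t'| / |h1'|\<close>. This is a contradiction once the derivatives are large compared with \<open>t'\<close>, which can be arranged unless
  \<open>h\<close> is a polynomial. For polynomial \<open>h\<close> the zeros of \<open>U(h(z + c))\<close> are relatively dense, \<open>|exp t|\<close> is bounded on
  them, and \<open>t\<close> varies slowly, so that \<open>t\<close> is again constant (\<open>proportional_polynomial\<close>).

  So \<open>P\<close> is linear, \<open>exp (\<alpha> c) = 1\<close>, and \<open>h(z + c)\<close> and \<open>- h(z)\<close> lift the same map up to a symmetry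
  \<open>(u, v) \<mapsto> (\<eta> u, \<eta>' v)\<close>, \<open>\<eta>\<^sup>3 = \<eta>'\<^sup>3 = 1\<close>. Comparing differentials, \<open>h(z + c) = A h(z) + B\<close> with \<open>A = - \<eta> \<eta>'\<close>
  (\<open>lifts_affine\<close>). By Picard's theorem \<open>h\<close> meets the lattice, where \<open>V \<circ> h\<close> has a pole; hence \<open>B\<close> is a pole of
  \<open>U\<close>, that is, \<open>0\<close>, \<open>\<theta>\<^sub>1\<close> or \<open>\<theta>\<^sub>2\<close> modulo the lattice. Conversely, lifting the symmetries themselves
  (\<open>fermat_symmetry\<close>) shows that the lattice is stable under the cube roots of unity and that translation by \<open>\<theta>\<^sub>1\<close> or
  \<open>\<theta>\<^sub>2\<close> multiplies \<open>U\<close> by a cube root of unity. Therefore \<open>U(w)\<^sup>3 + U(A w + B)\<^sup>3 = 1\<close> for all admissible \<open>A\<close> and \<open>B\<close>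
  (\<open>fermat_affine\<close>), which is the equation for \<open>f\<close>.
\<close>

section \<open>The period lattice\<close>

lemma summable_on_int_powr:
  assumes "s > 1"
  shows "(\<lambda>n::int. (1 + \<bar>of_int n\<bar>) powr (-s) :: real) summable_on UNIV"
proof -
  let ?g = "\<lambda>n::int. (1 + \<bar>of_int n\<bar>) powr (-s) :: real"
  have "summable (\<lambda>n. real (Suc n) powr (-s))"
    using assms summable_real_powr_iff[of "-s"] by (subst summable_Suc_iff) auto
  hence "(\<lambda>n. real (Suc n) powr (-s)) summable_on UNIV"
    by (subst summable_on_UNIV_nonneg_real_iff) auto
  hence nat: "(\<lambda>n. ?g (int n)) summable_on UNIV" "(\<lambda>n. ?g (- int n)) summable_on UNIV"
    by (simp_all add: add.commute)
  have 1: "?g summable_on range int"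
    using nat(1) by (subst summable_on_reindex) (auto simp: o_def inj_on_def)
  have 2: "?g summable_on range (\<lambda>n. - int n)"
    using nat(2) by (subst summable_on_reindex) (auto simp: o_def inj_on_def)
  have "?g summable_on (range int \<union> (range (\<lambda>n. - int n) - range int))"
    by (intro summable_on_Un_disjoint 1 summable_on_subset_banach[OF 2]) auto
  also have "range int \<union> (range (\<lambda>n. - int n) - range int) = UNIV"
  proof -
    have "x \<in> range int \<union> range (\<lambda>n. - int n)" for x
      by (cases x rule: int_cases2) auto
    thus ?thesis by auto
  qed
  finally show ?thesis .
qed

text \<open>Weierstrass' M-test for unordered sums: the tails are dominated by those of \<open>M\<close>.\<close>
lemma uniform_limit_infsum:
  fixes f :: "'i \<Rightarrow> 'a \<Rightarrow> 'b :: banach"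
  assumes M: "M summable_on I"
    and le: "\<And>i z. i \<in> I \<Longrightarrow> z \<in> S \<Longrightarrow> norm (f i z) \<le> M i"
  shows "uniform_limit S (\<lambda>X z. \<Sum>i\<in>X. f i z) (\<lambda>z. \<Sum>\<^sub>\<infinity>i\<in>I. f i z) (finite_subsets_at_top I)"
proof (rule uniform_limitI)
  fix e :: real assume "e > 0"
  have "(sum M \<longlongrightarrow> infsum M I) (finite_subsets_at_top I)"
    using M by (simp add: infsum_tendsto)
  hence "\<forall>\<^sub>F X in finite_subsets_at_top I. dist (sum M X) (infsum M I) < e"
    using \<open>e > 0\<close> tendstoD by blast
  moreover have "\<forall>\<^sub>F X in finite_subsets_at_top I. finite X \<and> X \<subseteq> I"
    by (rule eventually_finite_subsets_at_top_weakI) auto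
  ultimately show "\<forall>\<^sub>F X in finite_subsets_at_top I.
      \<forall>z\<in>S. dist (\<Sum>i\<in>X. f i z) (\<Sum>\<^sub>\<infinity>i\<in>I. f i z) < e"
  proof eventually_elim
    case (elim X)
    show ?case
    proof
      fix z assume z: "z \<in> S"
      have abs: "(\<lambda>i. norm (f i z)) summable_on I"
        by (rule summable_on_comparison_test[OF M]) (use le z in auto)
      have sf: "(\<lambda>i. f i z) summable_on I"
        using abs by (rule abs_summable_summable)
      have "(\<Sum>\<^sub>\<infinity>i\<in>I. f i z) - (\<Sum>i\<in>X. f i z) = (\<Sum>\<^sub>\<infinity>i\<in>I-X. f i z)"
        using elim sf by (subst infsum_Diff) auto
      also have "norm \<dots> \<le> infsum M (I - X)"
      proof (rule norm_infsum_le)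
        show "((\<lambda>i. f i z) has_sum (\<Sum>\<^sub>\<infinity>i\<in>I - X. f i z)) (I - X)"
          using summable_on_subset_banach[OF sf, of "I - X"] by (auto simp: has_sum_infsum)
        show "(M has_sum infsum M (I - X)) (I - X)"
          using summable_on_subset_banach[OF M, of "I - X"] by (auto simp: has_sum_infsum)
      qed (use le z in auto)
      also have "\<dots> = infsum M I - sum M X"
        using elim M by (subst infsum_Diff) auto
      also have "\<dots> < e"
        using elim by (auto simp: dist_real_def)
      finally show "dist (\<Sum>i\<in>X. f i z) (\<Sum>\<^sub>\<infinity>i\<in>I. f i z) < e"
        by (simp add: dist_norm norm_minus_commute)
    qed
  qed
qed

locale period_pair =
  fixes \<omega>\<^sub>1 \<omega>\<^sub>2 :: complex
  assumes Im_quotient_nonzero: "Im (\<omega>\<^sub>1 / \<omega>\<^sub>2) \<noteq> 0"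
begin

abbreviation L :: "complex set" where "L \<equiv> period_lattice \<omega>\<^sub>1 \<omega>\<^sub>2"
abbreviation wp :: "complex \<Rightarrow> complex" where "wp \<equiv> weierstrass_p \<omega>\<^sub>1 \<omega>\<^sub>2"

definition lat :: "int \<times> int \<Rightarrow> complex" where
  "lat p = of_int (fst p) * \<omega>\<^sub>1 + of_int (snd p) * \<omega>\<^sub>2"

lemma lat_add: "lat (p + q) = lat p + lat q"
  by (simp add: lat_def algebra_simps)

lemma lat_uminus: "lat (- p) = - lat p"
  by (simp add: lat_def algebra_simps)

lemma lat_0 [simp]: "lat (0, 0) = 0" "lat 0 = 0"
  by (simp_all add: lat_def)

lemma L_eq_range: "L = range lat"
proof -
  have "L = (\<lambda>(\<mu>, \<nu>). of_int \<mu> * \<omega>\<^sub>1 + of_int \<nu> * \<omega>\<^sub>2) ` UNIV"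
    unfolding period_lattice_def by auto
  thus ?thesis by (simp add: lat_def case_prod_unfold)
qed

lemma lattice_0 [simp, intro]: "0 \<in> L"
  using L_eq_range lat_0(1) by (metis rangeI)

lemma lattice_add [intro]: "x \<in> L \<Longrightarrow> y \<in> L \<Longrightarrow> x + y \<in> L"
  unfolding L_eq_range by (auto simp flip: lat_add)

lemma lattice_uminus [intro]: "x \<in> L \<Longrightarrow> - x \<in> L"
  unfolding L_eq_range by (auto simp flip: lat_uminus)

lemma lattice_diff [intro]: "x \<in> L \<Longrightarrow> y \<in> L \<Longrightarrow> x - y \<in> L"
  using lattice_add[of x "-y"] lattice_uminus[of y] by auto

lemma lattice_shift_iff: "y \<in> L \<Longrightarrow> x + y \<in> L \<longleftrightarrow> x \<in> L" "y \<in> L \<Longrightarrow> y + x \<in> L \<longleftrightarrow> x \<in> L"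
  using lattice_add lattice_diff[of "x + y" y] by (auto simp: add.commute)

lemma lattice_uminus_iff [simp]: "- x \<in> L \<longleftrightarrow> x \<in> L"
  using lattice_uminus[of x] lattice_uminus[of "-x"] by auto

lemma omega_in_lattice [simp, intro]: "\<omega>\<^sub>1 \<in> L" "\<omega>\<^sub>2 \<in> L"
proof -
  have "lat (1, 0) \<in> L" "lat (0, 1) \<in> L"
    unfolding L_eq_range by blast+
  thus "\<omega>\<^sub>1 \<in> L" "\<omega>\<^sub>2 \<in> L"
    by (simp_all add: lat_def)
qed

lemma omega2_nonzero: "\<omega>\<^sub>2 \<noteq> 0" and omega1_nonzero: "\<omega>\<^sub>1 \<noteq> 0"
  using Im_quotient_nonzero by auto

text \<open>The periods are linearly independent over the reals; \<open>Im (\<omega>\<^sub>1 / \<omega>\<^sub>2)\<close> measures by how much.\<close>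
lemma norm_combination_ge:
  obtains \<delta> where "\<delta> > 0"
    "\<And>s t::real. \<delta> * (\<bar>s\<bar> + \<bar>t\<bar>) \<le> norm (of_real s * \<omega>\<^sub>1 + of_real t * \<omega>\<^sub>2)"
proof -
  define x where "x = \<omega>\<^sub>1 / \<omega>\<^sub>2"
  define K where "K = 1 + (1 + norm x) / \<bar>Im x\<bar>"
  have Im: "\<bar>Im x\<bar> > 0" using Im_quotient_nonzero by (simp add: x_def)
  hence K: "K > 0" by (simp add: K_def add_pos_pos add_pos_nonneg)
  have "norm \<omega>\<^sub>2 / K * (\<bar>s\<bar> + \<bar>t\<bar>) \<le> norm (of_real s * \<omega>\<^sub>1 + of_real t * \<omega>\<^sub>2)" for s t :: real
  proof -
    define y where "y = of_real s * x + of_real t"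
    have "\<bar>s\<bar> * \<bar>Im x\<bar> = \<bar>Im y\<bar>" by (simp add: y_def abs_mult)
    also have "\<dots> \<le> norm y" by (rule abs_Im_le_cmod)
    finally have s: "\<bar>s\<bar> \<le> norm y / \<bar>Im x\<bar>" using Im by (simp add: field_simps)
    have "\<bar>t\<bar> = norm (y - of_real s * x)" by (simp add: y_def)
    also have "\<dots> \<le> norm y + \<bar>s\<bar> * norm x"
      by (metis norm_triangle_ineq4 norm_mult norm_of_real)
    also have "\<dots> \<le> norm y + norm y / \<bar>Im x\<bar> * norm x"
      using s by (intro add_mono mult_right_mono) auto
    finally have "\<bar>s\<bar> + \<bar>t\<bar> \<le> K * norm y"
      using s by (simp add: K_def algebra_simps add_divide_distrib)
    moreover have "of_real s * \<omega>\<^sub>1 + of_real t * \<omega>\<^sub>2 = \<omega>\<^sub>2 * y"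
      using omega2_nonzero by (simp add: y_def x_def field_simps)
    ultimately show ?thesis
      using K mult_left_mono[of "\<bar>s\<bar> + \<bar>t\<bar>" "K * norm y" "norm \<omega>\<^sub>2"]
      by (simp add: norm_mult field_simps)
  qed
  moreover have "norm \<omega>\<^sub>2 / K > 0" using K omega2_nonzero by simp
  ultimately show ?thesis by (rule that[rotated])
qed

lemma real_coordinates:
  obtains s t :: real where "z = of_real s * \<omega>\<^sub>1 + of_real t * \<omega>\<^sub>2"
proof -
  define x where "x = \<omega>\<^sub>1 / \<omega>\<^sub>2"
  define s where "s = Im (z / \<omega>\<^sub>2) / Im x"
  define t where "t = Re (z / \<omega>\<^sub>2) - s * Re x"
  have "z / \<omega>\<^sub>2 = of_real s * x + of_real t"
    using Im_quotient_nonzero unfolding x_def[symmetric]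
    by (simp add: complex_eq_iff s_def t_def del: Im_divide Re_divide)
  hence "z = of_real s * \<omega>\<^sub>1 + of_real t * \<omega>\<^sub>2"
    using omega2_nonzero by (simp add: x_def field_simps)
  thus ?thesis by (rule that)
qed

lemma norm_lat_ge:
  obtains \<delta> where "\<delta> > 0"
    "\<And>p. \<delta> * (\<bar>of_int (fst p)\<bar> + \<bar>of_int (snd p)\<bar>) \<le> norm (lat p)"
proof -
  obtain \<delta> where \<delta>: "\<delta> > 0"
    "\<And>s t::real. \<delta> * (\<bar>s\<bar> + \<bar>t\<bar>) \<le> norm (of_real s * \<omega>\<^sub>1 + of_real t * \<omega>\<^sub>2)"
    using norm_combination_ge by blast
  show ?thesis
  proof (rule that[OF \<delta>(1)])
    fix p show "\<delta> * (\<bar>of_int (fst p)\<bar> + \<bar>of_int (snd p)\<bar>) \<le> norm (lat p)"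
      using \<delta>(2)[of "of_int (fst p)" "of_int (snd p)"] by (simp add: lat_def)
  qed
qed

lemma lat_eq_0_iff: "lat p = 0 \<longleftrightarrow> p = 0"
proof -
  obtain \<delta> where \<delta>: "\<delta> > 0" "\<delta> * (\<bar>of_int (fst p)\<bar> + \<bar>of_int (snd p)\<bar>) \<le> norm (lat p)"
    using norm_lat_ge by metis
  have "p = 0" if "lat p = 0"
  proof -
    have "\<bar>of_int (fst p)\<bar> + \<bar>of_int (snd p)\<bar> \<le> (0::real)"
      using \<delta> that by (simp add: mult_le_0_iff)
    thus ?thesis by (auto simp: prod_eq_iff)
  qed
  thus ?thesis by auto
qed

lemma finite_lat_norm_less: "finite {p. norm (lat p) < R}"
proof -
  obtain \<delta> where \<delta>: "\<delta> > 0"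
    "\<And>p. \<delta> * (\<bar>of_int (fst p)\<bar> + \<bar>of_int (snd p)\<bar>) \<le> norm (lat p)"
    using norm_lat_ge by blast
  define N where "N = \<lceil>R / \<delta>\<rceil>"
  have "{p. norm (lat p) < R} \<subseteq> {-N..N} \<times> {-N..N}"
  proof
    fix p assume "p \<in> {p. norm (lat p) < R}"
    hence "\<delta> * (\<bar>of_int (fst p)\<bar> + \<bar>of_int (snd p)\<bar>) < R"
      using \<delta>(2)[of p] by auto
    hence "\<bar>of_int (fst p)\<bar> + \<bar>of_int (snd p)\<bar> < R / \<delta>"
      using \<delta>(1) by (simp add: field_simps)
    hence "\<bar>of_int (fst p)\<bar> + \<bar>of_int (snd p)\<bar> < real_of_int N"
      unfolding N_def by linarith
    hence "\<bar>fst p\<bar> + \<bar>snd p\<bar> < N"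
      by (metis of_int_abs of_int_add of_int_less_iff)
    thus "p \<in> {-N..N} \<times> {-N..N}"
      by (cases p) auto
  qed
  thus ?thesis by (rule finite_subset) auto
qed

lemma lattice_cball_finite: "finite (L \<inter> cball 0 R)"
proof (rule finite_subset)
  show "L \<inter> cball 0 R \<subseteq> lat ` {p. norm (lat p) < R + 1}"
    by (auto simp: L_eq_range)
qed (intro finite_imageI finite_lat_norm_less)

lemma not_islimpt_lattice: "\<not> z islimpt L"
proof
  assume "z islimpt L"
  hence "z islimpt (L \<inter> ball z 1)"
    by (rule islimpt_Int_eventually) (rule eventually_at_in_open', auto)
  moreover have "ball z 1 \<subseteq> cball 0 (norm z + 1)"
  proof
    fix y assume "y \<in> ball z 1"
    thus "y \<in> cball 0 (norm z + 1)"
      using norm_triangle_ineq2[of y z] by (simp add: dist_norm norm_minus_commute)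
  qed
  hence "finite (L \<inter> ball z 1)"
    using lattice_cball_finite[of "norm z + 1"] by (meson Int_mono finite_subset order_refl)
  ultimately show False
    using islimpt_finite by blast
qed

lemma eventually_not_lattice: "eventually (\<lambda>w. w \<notin> L) (at z)"
  using not_islimpt_lattice[of z] by (auto simp: islimpt_iff_eventually)

lemma closed_lattice: "closed L"
  using not_islimpt_lattice closed_limpt by blast

lemma open_compl_lattice: "open (- L)"
  using closed_lattice by auto

lemma connected_compl_lattice: "connected (- L)"
proof (rule path_connected_imp_connected, rule path_connected_complement_countable)
  show "countable L" unfolding L_eq_range by auto
qed auto

end

section \<open>The Weierstrass function and its periodicity\<close>

context period_pair
begin

definition wp_term :: "int \<times> int \<Rightarrow> complex \<Rightarrow> complex" where
  "wp_term p z = 1 / (z + lat p) ^ 2 - 1 / lat p ^ 2"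

lemma wp_eq: "wp z = 1 / z ^ 2 + (\<Sum>\<^sub>\<infinity>p\<in>-{0}. wp_term p z)"
proof -
  have set: "{(\<mu> :: int, \<nu> :: int). \<mu> ^ 2 + \<nu> ^ 2 \<noteq> 0} = -{0}"
    by (auto simp: zero_prod_def)
  show ?thesis
    unfolding weierstrass_p_def set
    by (simp add: wp_term_def lat_def case_prod_unfold add.assoc)
qed

text \<open>
  The double series is dominated by a product of two simple ones, since \<open>(|m| + |n|)\<^sup>3\<close> is at least a multiple of
  \<open>(1 + |m|)\<^sup>3\<^sup>/\<^sup>2 (1 + |n|)\<^sup>3\<^sup>/\<^sup>2\<close>.
\<close>
lemma summable_lat_cubed: "(\<lambda>p. 1 / norm (lat p) ^ 3) summable_on -{0}"
proof -
  obtain \<delta> where \<delta>: "\<delta> > 0"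
    "\<And>p. \<delta> * (\<bar>of_int (fst p)\<bar> + \<bar>of_int (snd p)\<bar>) \<le> norm (lat p)"
    using norm_lat_ge by blast
  define g where "g n = (1 + \<bar>of_int n\<bar> :: real) powr (-(3/2))" for n :: int
  have g: "g summable_on UNIV"
    unfolding g_def by (rule summable_on_int_powr) auto
  have "(\<lambda>(m, n). g m * g n) summable_on UNIV \<times> UNIV"
  proof (rule summable_on_SigmaI)
    show "((\<lambda>n. case (m, n) of (m, n) \<Rightarrow> g m * g n) has_sum g m * infsum g UNIV) UNIV" for m
      using has_sum_cmult_right[OF has_sum_infsum[OF g], of "g m"] by simp
    show "(\<lambda>m. g m * infsum g UNIV) summable_on UNIV"
      by (rule summable_on_cmult_left[OF g])
  qed (auto simp: g_def)
  hence G: "(\<lambda>p. 8 / \<delta> ^ 3 * (g (fst p) * g (snd p))) summable_on -{0}"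
    by (intro summable_on_cmult_right)
       (auto simp: case_prod_unfold intro: summable_on_subset_banach)
  show ?thesis
  proof (rule summable_on_comparison_test[OF G])
    fix p :: "int \<times> int" assume p: "p \<in> -{0}"
    define a b where "a = \<bar>of_int (fst p) :: real\<bar>" and "b = \<bar>of_int (snd p) :: real\<bar>"
    have ab: "a + b \<ge> 1" "a \<ge> 0" "b \<ge> 0"
      using p by (auto simp: a_def b_def prod_eq_iff simp flip: of_int_abs of_int_add) 
    have "((1 + a) * (1 + b)) powr (3/2) \<le> ((2 * (a + b)) ^ 2) powr (3/2)"
      using ab by (intro powr_mono2) (auto simp: power2_eq_square intro!: mult_mono)
    also have "\<dots> = (2 * (a + b)) powr 3"
      using ab by (simp add: powr_powr flip: powr_numeral)
    also have "\<dots> = 8 * (a + b) ^ 3"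
      using ab by (simp add: powr_numeral) (simp add: power3_eq_cube algebra_simps)
    finally have *: "(1 + a) powr (3/2) * (1 + b) powr (3/2) \<le> 8 * (a + b) ^ 3"
      using ab by (simp add: powr_mult)
    have pos: "0 < \<delta> * (a + b)" using \<delta>(1) ab by simp
    have le: "\<delta> * (a + b) \<le> norm (lat p)" using \<delta>(2)[of p] by (simp add: a_def b_def)
    have "(\<delta> * (a + b)) ^ 3 \<le> norm (lat p) ^ 3" using pos le by (intro power_mono) auto
    moreover have "0 < (\<delta> * (a + b)) ^ 3" using pos by (rule zero_less_power)
    ultimately have "1 / norm (lat p) ^ 3 \<le> 1 / (\<delta> * (a + b)) ^ 3"
      by (intro divide_left_mono mult_pos_pos) linarith+
    also have "\<dots> \<le> 8 / \<delta> ^ 3 * (g (fst p) * g (snd p))"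
    proof -
      define x where "x = (1 + a) powr (3/2) * (1 + b) powr (3/2)"
      have x: "x > 0" "x \<le> 8 * (a + b) ^ 3" using * ab by (auto simp: x_def)
      have "1 / (a + b) ^ 3 \<le> 8 / x"
        using x ab by (simp add: field_simps)
      hence "1 / \<delta> ^ 3 * (1 / (a + b) ^ 3) \<le> 1 / \<delta> ^ 3 * (8 / x)"
        using \<delta>(1) by (intro mult_left_mono) auto
      moreover have "g (fst p) * g (snd p) = 1 / x"
        by (simp add: g_def x_def a_def b_def powr_minus divide_simps)
      ultimately show ?thesis by (simp add: power_mult_distrib)
    qed
    finally show "1 / norm (lat p) ^ 3 \<le> 8 / \<delta> ^ 3 * (g (fst p) * g (snd p))" .
  qed auto
qed

lemma wp_term_bound:
  assumes R: "R > 0" and z: "norm z \<le> R" and p: "2 * R \<le> norm (lat p)"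
  shows "norm (wp_term p z) \<le> 10 * R / norm (lat p) ^ 3"
proof -
  define w where "w = lat p"
  have w: "norm w \<ge> 2 * R" "norm w > 0" "w \<noteq> 0" using p R by (auto simp: w_def)
  have zw: "norm (z + w) \<ge> norm w / 2"
    using norm_diff_ineq[of w z] z w by (simp add: add.commute)
  hence zw0: "z + w \<noteq> 0" using w by auto
  have "wp_term p z = - z * (z + 2 * w) / ((z + w) ^ 2 * w ^ 2)"
    using zw0 w(3) by (simp add: wp_term_def w_def[symmetric] divide_simps) (simp add: power2_eq_square algebra_simps)
  also have "norm \<dots> = norm z * norm (z + 2 * w) / (norm (z + w) ^ 2 * norm w ^ 2)"
    by (simp add: norm_mult norm_divide norm_power)
  also have "\<dots> \<le> R * (5 / 2 * norm w) / ((norm w / 2) ^ 2 * norm w ^ 2)"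
  proof (intro frac_le mult_mono power_mono)
    have "norm (z + 2 * w) \<le> norm z + 2 * norm w"
      by (metis norm_triangle_ineq norm_mult norm_numeral)
    thus "norm (z + 2 * w) \<le> 5 / 2 * norm w" using z w by linarith
  qed (use R z w zw in auto)
  also have "\<dots> = 10 * R / norm w ^ 3"
    using w by (simp add: field_simps power2_eq_square power3_eq_cube)
  finally show ?thesis by (simp add: w_def)
qed

lemma inverse_square_has_derivative:
  "y \<noteq> 0 \<Longrightarrow> ((\<lambda>y. 1 / y ^ 2) has_field_derivative - 2 / y ^ 3) (at (y::complex))"
  by (auto intro!: derivative_eq_intros simp: field_simps power2_eq_square power3_eq_cube)

lemma wp_term_has_derivative:
  assumes "z + lat p \<noteq> 0"
  shows "(wp_term p has_field_derivative - 2 / (z + lat p) ^ 3) (at z)"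
proof -
  have "((\<lambda>y. 1 / y ^ 2) has_field_derivative - 2 / (z + lat p) ^ 3) (at (z + lat p))"
    by (rule inverse_square_has_derivative[OF assms])
  from DERIV_diff[OF DERIV_chain2[OF this DERIV_add[OF DERIV_ident DERIV_const]] DERIV_const]
  have "((\<lambda>z. 1 / (z + lat p) ^ 2 - 1 / lat p ^ 2) has_field_derivative - 2 / (z + lat p) ^ 3) (at z)"
    by simp
  thus ?thesis unfolding wp_term_def[abs_def] .
qed

text \<open>
  By the M-test the terms with \<open>|lat p| \<ge> 2 R\<close> may be summed and differentiated termwise on the disc of radius \<open>R\<close>,
  so that only the finitely many terms outside \<open>I\<close> can have poles there.
\<close>
lemma wp_split:
  assumes R: "R > 0"
  obtains I S S' where "finite (- {0} - I)" "I \<subseteq> - {0}" 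
    "\<And>p. p \<in> I \<Longrightarrow> 2 * R \<le> norm (lat p)"
    "\<And>z. norm z < R \<Longrightarrow> (S has_field_derivative S' z) (at z)"
    "\<And>z. norm z < R \<Longrightarrow> ((\<lambda>p. - 2 / (z + lat p) ^ 3) has_sum S' z) I"
    "\<And>z. norm z < R \<Longrightarrow> wp z = 1 / z ^ 2 + (\<Sum>p\<in>-{0}-I. wp_term p z) + S z"
proof -
  define I where "I = {p. p \<noteq> 0 \<and> 2 * R \<le> norm (lat p)}"
  define S where "S z = (\<Sum>\<^sub>\<infinity>p\<in>I. wp_term p z)" for z
  have sm: "(\<lambda>p. 10 * R / norm (lat p) ^ 3) summable_on I"
    using summable_on_cmult_right[OF summable_lat_cubed, of "10 * R"]
    by (auto intro: summable_on_subset_banach simp: I_def)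
  have bound: "norm (wp_term p z) \<le> 10 * R / norm (lat p) ^ 3" if "p \<in> I" "z \<in> cball 0 R" for p z
    using wp_term_bound[of R z p] that R by (auto simp: I_def)
  have ne: "z + lat p \<noteq> 0" if "p \<in> I" "z \<in> cball 0 R" for p z
  proof
    assume "z + lat p = 0"
    hence "norm (lat p) = norm z" by (metis add_eq_0_iff norm_minus_cancel)
    thus False using that R by (auto simp: I_def)
  qed
  have ulim: "uniform_limit (cball 0 R) (\<lambda>X z. \<Sum>p\<in>X. wp_term p z) S (finite_subsets_at_top I)"
    unfolding S_def by (rule uniform_limit_infsum[OF sm bound])
  have der: "((\<lambda>z. \<Sum>p\<in>X. wp_term p z) has_field_derivative (\<Sum>p\<in>X. - 2 / (w + lat p) ^ 3)) (at w)"
    if "X \<subseteq> I" "w \<in> cball 0 R" for X w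
    by (rule DERIV_sum, rule wp_term_has_derivative) (use that ne in auto)
  have ev: "\<forall>\<^sub>F X in finite_subsets_at_top I.
      continuous_on (cball 0 R) (\<lambda>z. \<Sum>p\<in>X. wp_term p z) \<and>
      (\<forall>w\<in>ball 0 R. ((\<lambda>z. \<Sum>p\<in>X. wp_term p z) has_field_derivative
                     (\<Sum>p\<in>X. - 2 / (w + lat p) ^ 3)) (at w))"
  proof (rule eventually_finite_subsets_at_top_weakI)
    fix X assume X: "finite X" "X \<subseteq> I"
    show "continuous_on (cball 0 R) (\<lambda>z. \<Sum>p\<in>X. wp_term p z) \<and>
      (\<forall>w\<in>ball 0 R. ((\<lambda>z. \<Sum>p\<in>X. wp_term p z) has_field_derivative
                     (\<Sum>p\<in>X. - 2 / (w + lat p) ^ 3)) (at w))"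
      using der[OF X(2)] by (auto intro!: continuous_at_imp_continuous_on DERIV_isCont)
  qed
  obtain S' where S': "\<And>w. w \<in> ball 0 R \<Longrightarrow> (S has_field_derivative S' w) (at w) \<and>
      ((\<lambda>X. \<Sum>p\<in>X. - 2 / (w + lat p) ^ 3) \<longlongrightarrow> S' w) (finite_subsets_at_top I)"
    using has_complex_derivative_uniform_limit[OF ev ulim _ R] by auto
  show ?thesis
  proof (rule that)
    show "finite (- {0} - I)"
      by (rule finite_subset[OF _ finite_lat_norm_less[of "2 * R"]]) (auto simp: I_def)
    show "((\<lambda>p. - 2 / (z + lat p) ^ 3) has_sum S' z) I" if "norm z < R" for z
      using S'[of z] that by (simp add: has_sum_def)
    show "wp z = 1 / z ^ 2 + (\<Sum>p\<in>-{0}-I. wp_term p z) + S z" if "norm z < R" for z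
    proof -
      have fin: "finite (- {0} - I)"
        by (rule finite_subset[OF _ finite_lat_norm_less[of "2 * R"]]) (auto simp: I_def)
      have "(\<lambda>p. norm (wp_term p z)) summable_on I"
        by (rule summable_on_comparison_test[OF sm]) (use bound that in auto)
      hence "(\<lambda>p. wp_term p z) summable_on I" by (rule abs_summable_summable)
      hence "(\<Sum>\<^sub>\<infinity>p\<in>(-{0}-I) \<union> I. wp_term p z) = (\<Sum>\<^sub>\<infinity>p\<in>-{0}-I. wp_term p z) + S z"
        unfolding S_def using fin by (intro infsum_Un_disjoint) auto
      moreover have "(-{0}-I) \<union> I = -{0}" by (auto simp: I_def)
      ultimately show ?thesis using fin by (simp add: wp_eq)
    qed
  qed (use S' in \<open>auto simp: I_def\<close>)
qed

lemma wp_has_derivative_series: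
  assumes z: "z \<notin> L"
  shows "(wp has_field_derivative deriv wp z) (at z)"
    and "((\<lambda>p. - 2 / (z + lat p) ^ 3) has_sum deriv wp z) UNIV"
proof -
  define R where "R = norm z + 1"
  have R: "R > 0" "norm z < R" by (auto simp: R_def add_nonneg_pos)
  obtain I S S' where IS: "finite (- {0} - I)" "I \<subseteq> - {0}" 
    "\<And>p. p \<in> I \<Longrightarrow> 2 * R \<le> norm (lat p)"
    "\<And>z. norm z < R \<Longrightarrow> (S has_field_derivative S' z) (at z)"
    "\<And>z. norm z < R \<Longrightarrow> ((\<lambda>p. - 2 / (z + lat p) ^ 3) has_sum S' z) I"
    "\<And>z. norm z < R \<Longrightarrow> wp z = 1 / z ^ 2 + (\<Sum>p\<in>-{0}-I. wp_term p z) + S z"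
    using wp_split[OF R(1)] by metis
  have ne: "z + lat p \<noteq> 0" for p
  proof
    assume "z + lat p = 0"
    hence "z = lat (- p)" by (simp add: lat_uminus add_eq_0_iff)
    thus False using z by (auto simp: L_eq_range)
  qed
  have z0: "z \<noteq> 0" using z by auto
  have d: "((\<lambda>z. 1 / z ^ 2 + (\<Sum>p\<in>-{0}-I. wp_term p z) + S z) has_field_derivative
      (- 2 / z ^ 3 + (\<Sum>p\<in>-{0}-I. - 2 / (z + lat p) ^ 3) + S' z)) (at z)"
  proof (intro DERIV_add DERIV_sum wp_term_has_derivative ne IS(4) R)
    show "((\<lambda>z. 1 / z ^ 2) has_field_derivative - 2 / z ^ 3) (at z)"
      by (rule inverse_square_has_derivative[OF z0])
  qed
  have "(wp has_field_derivative (- 2 / z ^ 3 + (\<Sum>p\<in>-{0}-I. - 2 / (z + lat p) ^ 3) + S' z)) (at z)"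
  proof (rule has_field_derivative_transform_within_open[OF d])
    show "open (ball 0 R)" "z \<in> ball 0 R" using R by auto
  qed (use IS(6) in auto)
  moreover from this have eq: "deriv wp z = - 2 / z ^ 3 + (\<Sum>p\<in>-{0}-I. - 2 / (z + lat p) ^ 3) + S' z"
    by (rule DERIV_imp_deriv)
  ultimately show "(wp has_field_derivative deriv wp z) (at z)" by simp
  have "((\<lambda>p. - 2 / (z + lat p) ^ 3) has_sum
      ((\<Sum>p\<in>{0} \<union> (-{0}-I). - 2 / (z + lat p) ^ 3) + S' z)) (({0} \<union> (-{0}-I)) \<union> I)"
    by (intro has_sum_Un_disjoint has_sum_finite IS(5) R) (use IS(1,2) in auto)
  moreover have "({0} \<union> (-{0}-I)) \<union> I = UNIV" using IS(2) by auto
  moreover have "(\<Sum>p\<in>{0} \<union> (-{0}-I). - 2 / (z + lat p) ^ 3) = - 2 / z ^ 3 + (\<Sum>p\<in>-{0}-I. - 2 / (z + lat p) ^ 3)"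
    using IS(1) by (subst sum.union_disjoint) auto
  ultimately show "((\<lambda>p. - 2 / (z + lat p) ^ 3) has_sum deriv wp z) UNIV"
    by (simp add: eq)
qed

lemma wp_holomorphic: "wp holomorphic_on - L"
  using wp_has_derivative_series(1) open_compl_lattice
  by (auto simp: holomorphic_on_open)

lemma wp_analytic: "z \<notin> L \<Longrightarrow> wp analytic_on {z}"
  using wp_holomorphic open_compl_lattice by (auto simp: analytic_at)

lemma wp_principal_part:
  obtains r where "r analytic_on {0}" "\<forall>\<^sub>F z in at 0. wp z = 1 / z ^ 2 + r z"
proof -
  obtain I S S' where IS: "finite (- {0} - I)" "I \<subseteq> - {0}" 
    "\<And>p. p \<in> I \<Longrightarrow> 2 * 1 \<le> norm (lat p)"
    "\<And>z. norm z < 1 \<Longrightarrow> (S has_field_derivative S' z) (at z)"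
    "\<And>z. norm z < 1 \<Longrightarrow> wp z = 1 / z ^ 2 + (\<Sum>p\<in>-{0}-I. wp_term p z) + S z"
    using wp_split[of 1] by (metis zero_less_one)
  show ?thesis
  proof (rule that)
    have "S holomorphic_on ball 0 1"
      unfolding holomorphic_on_open[OF open_ball] using IS(4) by fastforce
    hence "S analytic_on {0}" by (auto simp: analytic_at intro: exI[of _ "ball 0 1"])
    moreover have "wp_term p analytic_on {0}" if "p \<noteq> 0" for p
      unfolding wp_term_def[abs_def] using that by (intro analytic_intros) (auto simp: lat_eq_0_iff)
    ultimately show "(\<lambda>z. (\<Sum>p\<in>-{0}-I. wp_term p z) + S z) analytic_on {0}"
      by (intro analytic_intros) auto
    have "\<forall>\<^sub>F z in at 0. z \<in> ball (0::complex) 1"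
      by (rule eventually_at_in_open') auto
    thus "\<forall>\<^sub>F z in at 0. wp z = 1 / z ^ 2 + ((\<Sum>p\<in>-{0}-I. wp_term p z) + S z)"
      by eventually_elim (use IS(5) in \<open>auto simp: add.assoc\<close>)
  qed
qed

lemma wp_even: "wp (- z) = wp z"
proof -
  have "(\<Sum>\<^sub>\<infinity>p\<in>-{0}. wp_term p (- z)) = (\<Sum>\<^sub>\<infinity>p\<in>-{0}. wp_term p z)"
  proof (rule infsum_reindex_bij_betw[symmetric, THEN trans])
    show "bij_betw uminus (-{0}) (-{0} :: (int \<times> int) set)"
      by (rule bij_betwI[of _ _ _ uminus]) auto
    have "(lat p - z)\<^sup>2 = (z - lat p)\<^sup>2" for p by (rule power2_commute)
    thus "(\<Sum>\<^sub>\<infinity>p\<in>-{0}. wp_term (- p) (- z)) = (\<Sum>\<^sub>\<infinity>p\<in>-{0}. wp_term p z)"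
      by (intro infsum_cong) (simp add: wp_term_def lat_uminus power2_eq_square algebra_simps)
  qed
  thus ?thesis by (simp add: wp_eq)
qed

lemma deriv_wp_odd: 
  assumes "z \<notin> L" shows "deriv wp (- z) = - deriv wp z"
proof -
  have "((\<lambda>w. wp (- w)) has_field_derivative deriv wp (- z) * (- 1)) (at z)"
    by (rule DERIV_chain2[OF wp_has_derivative_series(1)])
       (use assms in \<open>auto intro!: derivative_eq_intros\<close>)
  hence "(wp has_field_derivative - deriv wp (- z)) (at z)"
    by (simp add: wp_even)
  from DERIV_imp_deriv[OF this] show ?thesis by simp
qed

text \<open>Unlike the series for \<open>\<wp>\<close>, that for \<open>\<wp>'\<close> is visibly periodic: translation by a period permutes its terms.\<close>
lemma deriv_wp_periodic:
  assumes "z \<notin> L" "\<omega> \<in> L"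
  shows "deriv wp (z + \<omega>) = deriv wp z"
proof -
  obtain q where q: "\<omega> = lat q" using assms unfolding L_eq_range by blast
  have "((\<lambda>p. - 2 / (z + \<omega> + lat p) ^ 3) has_sum deriv wp (z + \<omega>)) UNIV"
    by (rule wp_has_derivative_series) (use assms lattice_shift_iff in auto)
  hence "((\<lambda>p. - 2 / (z + lat (q + p)) ^ 3) has_sum deriv wp (z + \<omega>)) UNIV"
    by (simp add: lat_add q add.assoc)
  moreover have "bij (\<lambda>p. q + p)" by (rule bij_plus)
  ultimately have "((\<lambda>p. - 2 / (z + lat p) ^ 3) has_sum deriv wp (z + \<omega>)) UNIV"
    by (subst (asm) has_sum_reindex_bij_betw)
  thus ?thesis
    using wp_has_derivative_series(2)[OF assms(1)] has_sum_unique by blast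
qed

lemma half_omega_notin:
  "\<omega>\<^sub>1 / 2 \<notin> L" "\<omega>\<^sub>2 / 2 \<notin> L"
proof -
  have aux: False if "of_real s * \<omega>\<^sub>1 + of_real t * \<omega>\<^sub>2 = 0" "(s, t) \<noteq> (0, 0)" for s t :: real
  proof -
    obtain \<delta> where "\<delta> > 0" "\<delta> * (\<bar>s\<bar> + \<bar>t\<bar>) \<le> norm (of_real s * \<omega>\<^sub>1 + of_real t * \<omega>\<^sub>2)"
      using norm_combination_ge by metis
    hence "\<bar>s\<bar> + \<bar>t\<bar> \<le> 0" using that(1) by (simp add: mult_le_0_iff)
    hence "s = 0 \<and> t = 0" by linarith
    thus False using that(2) by simp
  qed
  have half: "of_int m \<noteq> (1 / 2 :: real)" for m
  proof
    assume "of_int m = (1 / 2 :: real)"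
    hence "real_of_int (2 * m) = real_of_int 1" by simp
    hence "2 * m = 1" by (simp only: of_int_eq_iff)
    thus False by presburger
  qed
  show "\<omega>\<^sub>1 / 2 \<notin> L"
  proof
    assume "\<omega>\<^sub>1 / 2 \<in> L"
    then obtain p where "\<omega>\<^sub>1 / 2 = lat p" unfolding L_eq_range by blast
    hence "of_real (of_int (fst p) - 1 / 2) * \<omega>\<^sub>1 + of_real (of_int (snd p)) * \<omega>\<^sub>2 = 0"
      by (simp add: lat_def algebra_simps)
    from aux[OF this] half[of "fst p"] show False by auto
  qed
  show "\<omega>\<^sub>2 / 2 \<notin> L"
  proof
    assume "\<omega>\<^sub>2 / 2 \<in> L"
    then obtain p where "\<omega>\<^sub>2 / 2 = lat p" unfolding L_eq_range by blast
    hence "of_real (of_int (fst p)) * \<omega>\<^sub>1 + of_real (of_int (snd p) - 1 / 2) * \<omega>\<^sub>2 = 0"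
      by (simp add: lat_def algebra_simps)
    from aux[OF this] half[of "snd p"] show False by auto
  qed
qed

text \<open>
  Since \<open>\<wp>'\<close> is periodic, \<open>\<wp>(z + \<omega>) - \<wp>(z)\<close> is constant; as \<open>\<wp>\<close> is even, the constant vanishes, as
  one sees at \<open>z = - \<omega> / 2\<close>.
\<close>
lemma wp_periodic_basic:
  assumes "\<omega> \<in> L" "\<omega> / 2 \<notin> L" "z \<notin> L"
  shows "wp (z + \<omega>) = wp z"
proof -
  have "(\<lambda>x. wp (x + \<omega>) - wp x) constant_on -L"
  proof (rule DERIV_zero_connected_constant_on[OF connected_compl_lattice open_compl_lattice finite.emptyI])
    have d: "((\<lambda>x. wp (x + \<omega>) - wp x) has_field_derivative (deriv wp (x + \<omega>) * 1 - deriv wp x)) (at x)"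
      if "x \<notin> L" for x
      by (intro DERIV_diff DERIV_chain2[OF wp_has_derivative_series(1)] wp_has_derivative_series(1))
         (use that assms lattice_shift_iff in \<open>auto intro!: derivative_eq_intros\<close>)
    show "\<forall>x\<in>-L - {}. ((\<lambda>x. wp (x + \<omega>) - wp x) has_field_derivative 0) (at x)"
      using d deriv_wp_periodic[OF _ assms(1)] by fastforce
    show "continuous_on (- L) (\<lambda>x. wp (x + \<omega>) - wp x)"
      using d by (auto intro!: continuous_at_imp_continuous_on DERIV_isCont)
  qed
  then obtain c where c: "\<And>x. x \<notin> L \<Longrightarrow> wp (x + \<omega>) - wp x = c"
    by (auto simp: constant_on_def)
  \<comment> \<open>Both points are outside the lattice and opposite to each other.\<close>
  have "c = wp (- (\<omega> / 2) + \<omega>) - wp (- (\<omega> / 2))"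
    using c[of "-(\<omega>/2)"] assms(2) by (metis lattice_uminus_iff)
  also have "- (\<omega> / 2) + \<omega> = \<omega> / 2" by simp
  finally have "c = 0" by (simp add: wp_even)
  thus ?thesis using c[OF assms(3)] by simp
qed

text \<open>The two basic periods have halves outside the lattice, and they generate it.\<close>
lemma wp_periodic:
  assumes "z \<notin> L" "\<omega> \<in> L"
  shows "wp (z + \<omega>) = wp z"
proof -
  have step: "wp (z + of_int m * \<omega>) = wp z" if w: "z \<notin> L" "\<omega> \<in> L" "\<omega> / 2 \<notin> L" for z m \<omega>
  proof (induction m rule: int_induct[where k = 0])
    case base thus ?case by simp
  next
    have mult: "of_int k * \<omega> \<in> L" for k
    proof -
      obtain p where "\<omega> = lat p" using w unfolding L_eq_range by blast
      hence "of_int k * \<omega> = lat (k * fst p, k * snd p)" by (simp add: lat_def algebra_simps)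
      thus ?thesis by (auto simp: L_eq_range)
    qed
    {
      case (step1 i)
      have "wp (z + of_int i * \<omega> + \<omega>) = wp (z + of_int i * \<omega>)"
        by (rule wp_periodic_basic) (use w mult lattice_shift_iff in auto)
      with step1 show ?case by (simp add: algebra_simps)
    next
      case (step2 i)
      have "wp (z + of_int (i - 1) * \<omega> + \<omega>) = wp (z + of_int (i - 1) * \<omega>)"
        by (rule wp_periodic_basic) (use w mult[of "i - 1"] lattice_shift_iff in \<open>auto simp del: of_int_diff\<close>)
      with step2 show ?case by (simp add: algebra_simps)
    }
  qed
  obtain p where p: "\<omega> = lat p" using assms unfolding L_eq_range by blast
  have "of_int (fst p) * \<omega>\<^sub>1 = lat (fst p, 0)" by (simp add: lat_def)
  hence "of_int (fst p) * \<omega>\<^sub>1 \<in> L" by (auto simp: L_eq_range)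
  hence "z + of_int (fst p) * \<omega>\<^sub>1 \<notin> L" using assms lattice_shift_iff by auto
  hence "wp (z + of_int (fst p) * \<omega>\<^sub>1 + of_int (snd p) * \<omega>\<^sub>2) = wp z"
    using step half_omega_notin assms(1) by simp
  thus ?thesis by (simp add: p lat_def add.assoc)
qed

lemma wp_pole_0: "filterlim wp at_infinity (at 0)"
proof -
  obtain r where r: "r analytic_on {0}" "\<forall>\<^sub>F z in at 0. wp z = 1 / z ^ 2 + r z"
    using wp_principal_part by blast
  have "r \<midarrow>0\<rightarrow> r 0"
    using r(1) by (intro isContD analytic_at_imp_isCont)
  moreover have "filterlim (\<lambda>z::complex. inverse (z ^ 2)) at_infinity (at 0)"
    by (intro filterlim_compose[OF filterlim_inverse_at_infinity] filterlim_atI)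
       (auto intro!: tendsto_eq_intros eventually_neq_at_within)
  ultimately have "filterlim (\<lambda>z. r z + inverse (z ^ 2)) at_infinity (at 0)"
    by (rule tendsto_add_filterlim_at_infinity)
  also have "?this \<longleftrightarrow> ?thesis"
    by (rule filterlim_cong[OF refl refl]) (use r(2) in eventually_elim, auto simp: field_simps)
  finally show ?thesis .
qed

lemma wp_pole:
  assumes "\<omega> \<in> L" shows "filterlim wp at_infinity (at \<omega>)"
proof -
  have "filterlim (\<lambda>z. wp (z + \<omega>)) at_infinity (at 0)"
  proof -
    have "\<forall>\<^sub>F z in at 0. wp (z + \<omega>) = wp z"
      using eventually_not_lattice[of 0] by eventually_elim (use wp_periodic assms in auto)
    thus ?thesis using wp_pole_0 by (simp add: filterlim_cong)
  qed
  thus ?thesis by (subst at_to_0) (simp add: filterlim_filtermap)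
qed

end

section \<open>The cubic satisfied by the Weierstrass function\<close>

lemma analytic_at_if_isCont:
  assumes "\<forall>\<^sub>F w in at z. f analytic_on {w}" "isCont f z"
  shows "f analytic_on {z}"
proof (rule meromorphic_at_isCont_imp_analytic)
  obtain e where e: "e > 0" "\<And>w. w \<noteq> z \<Longrightarrow> dist w z < e \<Longrightarrow> f analytic_on {w}"
    using assms(1) by (auto simp: eventually_at)
  have "f analytic_on ball z e - {z}"
    by (subst analytic_on_analytic_at) (use e in \<open>auto simp: dist_commute\<close>)
  hence "isolated_singularity_at f z"
    using e(1) by (auto simp: isolated_singularity_at_def)
  moreover have "not_essential f z"
    using assms(2) by (auto simp: not_essential_def isCont_def)
  ultimately show "f meromorphic_on {z}"
    by (simp add: meromorphic_at_iff)
qed fact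

lemma eventually_analytic_nhds:
  assumes "f analytic_on {z}" shows "\<forall>\<^sub>F w in nhds z. f analytic_on {w}"
proof -
  obtain S where S: "open S" "z \<in> S" "f holomorphic_on S"
    using assms by (auto simp: analytic_at)
  have "\<forall>\<^sub>F w in nhds z. w \<in> S" using S by (intro eventually_nhds_in_open)
  thus ?thesis by eventually_elim (use S holomorphic_on_imp_analytic_at in blast)
qed

context period_pair
begin

lemma exists_lattice_near:
  obtains \<omega> where "\<omega> \<in> L" "norm (z - \<omega>) \<le> norm \<omega>\<^sub>1 + norm \<omega>\<^sub>2"
proof -
  obtain s t :: real where z: "z = of_real s * \<omega>\<^sub>1 + of_real t * \<omega>\<^sub>2"
    by (rule real_coordinates)
  define \<omega> where "\<omega> = lat (\<lfloor>s\<rfloor>, \<lfloor>t\<rfloor>)"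
  have "z - \<omega> = of_real (frac s) * \<omega>\<^sub>1 + of_real (frac t) * \<omega>\<^sub>2"
    by (simp add: z \<omega>_def lat_def frac_def algebra_simps)
  also have "norm \<dots> \<le> norm (of_real (frac s) * \<omega>\<^sub>1) + norm (of_real (frac t) * \<omega>\<^sub>2)"
    by (rule norm_triangle_ineq)
  also have "\<dots> = frac s * norm \<omega>\<^sub>1 + frac t * norm \<omega>\<^sub>2"
    by (simp add: norm_mult)
  also have "\<dots> \<le> 1 * norm \<omega>\<^sub>1 + 1 * norm \<omega>\<^sub>2"
    by (intro add_mono mult_right_mono) (auto intro: less_imp_le frac_lt_1)
  finally have "norm (z - \<omega>) \<le> norm \<omega>\<^sub>1 + norm \<omega>\<^sub>2" by simp
  moreover have "\<omega> \<in> L" by (auto simp: \<omega>_def L_eq_range)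
  ultimately show ?thesis by (rule that[rotated])
qed

text \<open>
  If \<open>\<wp>\<close> omitted the value \<open>x\<close>, the periodic function \<open>1 / (\<wp> - x)\<close> would extend to a bounded entire
  function with a zero at the origin.
\<close>
lemma wp_surj:
  obtains w where "w \<notin> L" "wp w = x"
proof (rule ccontr)
  assume contra: "\<not> thesis"
  hence ne: "wp w \<noteq> x" if "w \<notin> L" for w using \<open>w \<notin> L\<close> \<open>\<And>w. w \<notin> L \<Longrightarrow> wp w = x \<Longrightarrow> thesis\<close> by blast
  define g where "g w = (if w \<in> L then 0 else inverse (wp w - x))" for w
  have an: "g analytic_on {w}" if "w \<notin> L" for w
  proof -
    have "(\<lambda>w. inverse (wp w - x)) analytic_on {w}"
      using that ne by (intro analytic_intros wp_analytic) auto
    moreover have "\<forall>\<^sub>F v in nhds w. v \<in> -L"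
      using that open_compl_lattice by (intro eventually_nhds_in_open) auto
    hence "\<forall>\<^sub>F v in nhds w. inverse (wp v - x) = g v"
      by eventually_elim (auto simp: g_def)
    ultimately show ?thesis by (subst analytic_at_cong[symmetric]) auto
  qed
  have an': "g analytic_on {w}" for w
  proof (cases "w \<in> L")
    case True
    have "filterlim (\<lambda>v. - x + wp v) at_infinity (at w)"
      by (rule tendsto_add_filterlim_at_infinity[OF tendsto_const wp_pole[OF True]])
    hence "((\<lambda>v. inverse (- x + wp v)) \<longlongrightarrow> 0) (at w)"
      by (rule filterlim_compose[OF tendsto_inverse_0])
    also have "?this \<longleftrightarrow> (g \<longlongrightarrow> 0) (at w)"
      by (rule filterlim_cong[OF refl refl])
         (use eventually_not_lattice[of w] in eventually_elim, auto simp: g_def)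
    finally have "isCont g w" using True by (simp add: isCont_def g_def)
    moreover have "\<forall>\<^sub>F v in at w. g analytic_on {v}"
      using eventually_not_lattice[of w] by eventually_elim (rule an)
    ultimately show ?thesis by (intro analytic_at_if_isCont)
  qed (use an in auto)
  hence hol: "g holomorphic_on UNIV"
    by (meson analytic_imp_holomorphic analytic_on_analytic_at)
  have "g constant_on UNIV"
  proof (rule Liouville_theorem[OF hol])
    have "compact (g ` cball 0 (norm \<omega>\<^sub>1 + norm \<omega>\<^sub>2))"
      by (intro compact_continuous_image holomorphic_on_imp_continuous_on
                holomorphic_on_subset[OF hol]) auto
    moreover have "range g \<subseteq> g ` cball 0 (norm \<omega>\<^sub>1 + norm \<omega>\<^sub>2)"
    proof
      fix y assume "y \<in> range g"
      then obtain z where y: "y = g z" by auto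
      obtain \<omega> where \<omega>: "\<omega> \<in> L" "norm (z - \<omega>) \<le> norm \<omega>\<^sub>1 + norm \<omega>\<^sub>2"
        by (rule exists_lattice_near)
      have "g (z - \<omega> + \<omega>) = g (z - \<omega>)"
        using \<omega>(1) wp_periodic[of "z - \<omega>" \<omega>] lattice_shift_iff(1)[of \<omega> "z - \<omega>"] by (auto simp: g_def)
      thus "y \<in> g ` cball 0 (norm \<omega>\<^sub>1 + norm \<omega>\<^sub>2)"
        using \<omega> y by (auto intro!: image_eqI[of _ _ "z - \<omega>"])
    qed
    ultimately show "bounded (range g)"
      using bounded_subset compact_imp_bounded by blast
  qed
  hence "g (\<omega>\<^sub>1 / 2) = g 0" by (metis UNIV_I constant_on_def)
  thus False using half_omega_notin ne by (auto simp: g_def)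
qed

lemma deriv_wp_holomorphic: "deriv wp holomorphic_on - L"
  by (intro holomorphic_deriv wp_holomorphic open_compl_lattice)

lemma deriv_wp_analytic: "z \<notin> L \<Longrightarrow> deriv wp analytic_on {z}"
  using deriv_wp_holomorphic open_compl_lattice by (auto simp: analytic_at)

end

locale wp_cubic = period_pair +
  assumes ode: "\<And>z. z \<notin> L \<Longrightarrow> deriv wp z ^ 2 = 4 * wp z ^ 3 - 1"
begin

lemma deriv_wp_eventually_nonzero:
  assumes "z \<notin> L" shows "\<forall>\<^sub>F w in at z. deriv wp w \<noteq> 0"
proof -
  obtain a where a: "a \<notin> L" "wp a = 0" by (rule wp_surj)
  have "deriv wp a \<noteq> 0" using ode[OF a(1)] a(2) by auto
  thus ?thesis
    using non_zero_neighbour_alt[OF deriv_wp_holomorphic open_compl_lattice connected_compl_lattice, of z a]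
      a(1) assms by (auto elim: eventually_mono)
qed

text \<open>Differentiating the equation for \<open>\<wp>'\<close> gives \<open>2 \<wp>' \<wp>'' = 12 \<wp>\<^sup>2 \<wp>'\<close>; the zeros of \<open>\<wp>'\<close> are isolated.\<close>
lemma deriv2_wp:
  assumes z: "z \<notin> L"
  shows "(deriv wp has_field_derivative 6 * wp z ^ 2) (at z)"
proof -
  have d: "(deriv wp has_field_derivative deriv (deriv wp) w) (at w)" if "w \<notin> L" for w
    using deriv_wp_analytic[OF that] by (simp add: analytic_on_imp_differentiable_at DERIV_deriv_iff_field_differentiable)
  have eq: "deriv (deriv wp) w = 6 * wp w ^ 2" if w: "w \<notin> L" "deriv wp w \<noteq> 0" for w
  proof -
    have "((\<lambda>w. deriv wp w ^ 2) has_field_derivative 2 * deriv wp w * deriv (deriv wp) w) (at w)"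
      using d[OF w(1)] by (auto intro!: derivative_eq_intros)
    moreover have "((\<lambda>w. 4 * wp w ^ 3 - 1) has_field_derivative 12 * wp w ^ 2 * deriv wp w) (at w)"
      using wp_has_derivative_series(1)[OF w(1)] by (auto intro!: derivative_eq_intros)
    hence "((\<lambda>w. deriv wp w ^ 2) has_field_derivative 12 * wp w ^ 2 * deriv wp w) (at w)"
      by (rule has_field_derivative_transform_within_open[OF _ open_compl_lattice])
         (use w ode in auto)
    ultimately have "2 * deriv wp w * deriv (deriv wp) w = 12 * wp w ^ 2 * deriv wp w"
      by (rule DERIV_unique)
    thus ?thesis using w(2) by simp
  qed
  have "\<forall>\<^sub>F w in at z. w \<in> - L"
    using z open_compl_lattice by (intro eventually_at_in_open') auto
  hence ev: "\<forall>\<^sub>F w in at z. deriv (deriv wp) w = 6 * wp w ^ 2"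
    using deriv_wp_eventually_nonzero[OF z] by eventually_elim (use eq in auto)
  have "deriv (deriv wp) \<midarrow>z\<rightarrow> deriv (deriv wp) z"
    by (intro isContD analytic_at_imp_isCont analytic_deriv deriv_wp_analytic z)
  moreover have "(\<lambda>w. 6 * wp w ^ 2) \<midarrow>z\<rightarrow> 6 * wp z ^ 2"
    by (intro isContD analytic_at_imp_isCont analytic_intros wp_analytic z)
  hence "deriv (deriv wp) \<midarrow>z\<rightarrow> 6 * wp z ^ 2"
    using ev by (simp add: filterlim_cong)
  ultimately have "deriv (deriv wp) z = 6 * wp z ^ 2" by (rule LIM_unique)
  with d[OF z] show ?thesis by simp
qed

lemma curve_point:
  assumes "y ^ 2 = 4 * x ^ 3 - 1"
  obtains w where "w \<notin> L" "wp w = x" "deriv wp w = y"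
proof -
  obtain w where w: "w \<notin> L" "wp w = x" by (rule wp_surj)
  have "deriv wp w ^ 2 = y ^ 2" using ode[OF w(1)] w(2) assms by simp
  hence "deriv wp w = y \<or> deriv wp w = - y" by (simp add: power2_eq_iff)
  thus ?thesis
  proof
    assume "deriv wp w = - y"
    thus ?thesis using that[of "- w"] w by (simp add: wp_even deriv_wp_odd)
  qed (use that w in auto)
qed

text \<open>
  Let \<open>\<psi> = \<wp>\<inverse> \<circ> X\<close> for the local inverse of \<open>\<wp>\<close> at \<open>h z0\<close>. Then \<open>\<wp>' \<circ> \<psi> = \<plusminus> Y\<close> by the equation of the curve, with the
  sign \<open>+\<close> by continuity, so that \<open>\<psi>\<close> is a primitive of \<open>X' / Y\<close>, just like \<open>h\<close>.
\<close>
lemma local_lift: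
  assumes X: "X analytic_on {z0}" and h: "h analytic_on {z0}" and Y: "isCont Y z0"
    and curve: "\<forall>\<^sub>F z in nhds z0. Y z ^ 2 = 4 * X z ^ 3 - 1"
    and diff: "\<forall>\<^sub>F z in nhds z0. deriv h z * Y z = deriv X z"
    and z0: "Y z0 \<noteq> 0" "h z0 \<notin> L" "wp (h z0) = X z0" "deriv wp (h z0) = Y z0"
  shows "\<forall>\<^sub>F z in nhds z0. wp (h z) = X z \<and> deriv wp (h z) = Y z"
proof -
  define w0 where "w0 = h z0"
  have w0: "w0 \<in> - L" "deriv wp w0 \<noteq> 0" using z0 by (auto simp: w0_def)
  obtain r where r: "r > 0" "ball w0 r \<subseteq> - L" "open (wp ` ball w0 r)" "inj_on wp (ball w0 r)"
    using has_complex_derivative_locally_invertible[OF wp_holomorphic w0(1) open_compl_lattice w0(2)]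
    by metis
  obtain g where g: "g holomorphic_on (wp ` ball w0 r)" "\<And>z. z \<in> ball w0 r \<Longrightarrow> g (wp z) = z"
    using holomorphic_has_inverse[OF holomorphic_on_subset[OF wp_holomorphic r(2)] open_ball r(4)]
    by metis
  have cX: "isCont X z0" using X by (rule analytic_at_imp_isCont)
  have X0: "X z0 \<in> wp ` ball w0 r" using r(1) z0 by (auto simp: w0_def intro!: image_eqI[of _ _ w0])
  have "g analytic_on {X z0}"
    using g(1) r(3) X0 by (auto simp: analytic_at)
  define \<psi> where "\<psi> = g \<circ> X"
  have \<psi>_an: "\<psi> analytic_on {z0}"
    unfolding \<psi>_def using X \<open>g analytic_on {X z0}\<close> by (intro analytic_on_compose) auto
  have \<psi>0: "\<psi> z0 = w0" using g(2)[of w0] r(1) z0 by (simp add: \<psi>_def w0_def)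
  have evX: "\<forall>\<^sub>F z in nhds z0. X z \<in> wp ` ball w0 r"
    unfolding eventually_nhds_conv_at
    using topological_tendstoD[OF cX[unfolded isCont_def] r(3) X0] X0 by blast
  hence ev\<psi>: "\<forall>\<^sub>F z in nhds z0. wp (\<psi> z) = X z \<and> \<psi> z \<notin> L"
  proof eventually_elim
    case (elim z)
    then obtain v where v: "v \<in> ball w0 r" "X z = wp v" by blast
    hence "\<psi> z = v" using g(2) by (simp add: \<psi>_def)
    thus ?case using v r(2) by auto
  qed
  have "isCont \<psi> z0" using \<psi>_an by (rule analytic_at_imp_isCont)
  moreover have "isCont (deriv wp) (\<psi> z0)"
    unfolding \<psi>0 using w0(1) by (intro analytic_at_imp_isCont deriv_wp_analytic) auto
  ultimately have "isCont (\<lambda>z. deriv wp (\<psi> z)) z0"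
    by (rule isCont_o2)
  hence "isCont (\<lambda>z. deriv wp (\<psi> z) + Y z) z0"
    using Y by (rule isCont_add)
  moreover have "deriv wp (\<psi> z0) + Y z0 \<noteq> 0"
    using z0 \<psi>0 by (simp add: w0_def)
  ultimately have "\<forall>\<^sub>F z in at z0. deriv wp (\<psi> z) + Y z \<noteq> 0"
    by (simp add: isCont_def tendsto_imp_eventually_ne)
  hence "\<forall>\<^sub>F z in nhds z0. deriv wp (\<psi> z) + Y z \<noteq> 0"
    using \<open>deriv wp (\<psi> z0) + Y z0 \<noteq> 0\<close> by (simp add: eventually_nhds_conv_at)
  hence evY: "\<forall>\<^sub>F z in nhds z0. wp (\<psi> z) = X z \<and> deriv wp (\<psi> z) = Y z \<and> \<psi> z \<notin> L"
    using curve ev\<psi>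
  proof eventually_elim
    case (elim z)
    have "deriv wp (\<psi> z) ^ 2 = Y z ^ 2" using elim ode[of "\<psi> z"] by auto
    hence "(deriv wp (\<psi> z) - Y z) * (deriv wp (\<psi> z) + Y z) = 0"
      by (simp add: algebra_simps power2_eq_square)
    thus ?case using elim by auto
  qed
  have "\<forall>\<^sub>F z in nhds z0. Y z \<noteq> 0"
    using Y z0(1) by (simp add: isCont_def tendsto_imp_eventually_ne eventually_nhds_conv_at)
  moreover have "\<forall>\<^sub>F z in nhds z0. \<psi> analytic_on {z}" "\<forall>\<^sub>F z in nhds z0. h analytic_on {z}"
    using \<psi>_an h by (auto intro: eventually_analytic_nhds)
  moreover have "\<forall>\<^sub>F z in nhds z0. \<forall>\<^sub>F v in nhds z. wp (\<psi> v) = X v"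
    using ev\<psi> unfolding eventually_eventually by eventually_elim simp
  ultimately have "\<forall>\<^sub>F z in nhds z0. ((\<lambda>z. \<psi> z - h z) has_field_derivative 0) (at z)"
    using evY diff
  proof eventually_elim
    case (elim z)
    have d: "(\<psi> has_field_derivative deriv \<psi> z) (at z)" "(h has_field_derivative deriv h z) (at z)"
      using elim by (auto simp: analytic_on_imp_differentiable_at DERIV_deriv_iff_field_differentiable)
    have "((\<lambda>z. wp (\<psi> z)) has_field_derivative deriv wp (\<psi> z) * deriv \<psi> z) (at z)"
      using elim by (intro DERIV_chain2[OF wp_has_derivative_series(1) d(1)]) auto
    hence "(X has_field_derivative deriv wp (\<psi> z) * deriv \<psi> z) (at z)"
      using elim by (subst (asm) DERIV_cong_ev[OF refl _ refl]) auto
    hence "deriv h z * Y z = deriv wp (\<psi> z) * deriv \<psi> z"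
      using elim DERIV_imp_deriv by metis
    hence "deriv \<psi> z = deriv h z" using elim by auto
    thus ?case using DERIV_diff[OF d] by simp
  qed
  then obtain e where e: "e > 0"
    "\<And>z. dist z z0 < e \<Longrightarrow> ((\<lambda>z. \<psi> z - h z) has_field_derivative 0) (at z)"
    unfolding eventually_nhds_metric by blast
  have "(\<lambda>z. \<psi> z - h z) constant_on ball z0 e"
    by (rule has_field_derivative_0_imp_constant_on) (use e(2) in \<open>auto simp: dist_commute\<close>)
  then obtain c where c: "\<And>z. z \<in> ball z0 e \<Longrightarrow> \<psi> z - h z = c"
    unfolding constant_on_def by blast
  have "c = 0" using c[of z0] e(1) \<psi>0 by (simp add: w0_def)
  hence const: "\<psi> z = h z" if "z \<in> ball z0 e" for z using c[OF that] by simp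
  have "\<forall>\<^sub>F z in nhds z0. z \<in> ball z0 e"
    using e(1) by (intro eventually_nhds_in_open) auto
  thus ?thesis using evY by eventually_elim (use const in auto)
qed

end

section \<open>Parametrising the Fermat cubic\<close>

lemma eventually_cosparse_UNIV_iff:
  "(\<forall>\<^sub>\<approx>z. P z) \<longleftrightarrow> (\<forall>z. eventually P (at z))"
  by (simp add: eventually_cosparse_open_eq)

lemma eventually_at_imp_eventually_at_nhds:
  fixes z :: "'a :: t1_space"
  assumes "eventually P (at z)"
  shows "\<forall>\<^sub>F w in at z. eventually P (nhds w)"
proof -
  obtain S where S: "open S" "z \<in> S" "\<And>w. w \<in> S \<Longrightarrow> w \<noteq> z \<Longrightarrow> P w"
    using assms by (auto simp: eventually_at_topological)
  have "\<forall>\<^sub>F w in at z. w \<in> S - {z}"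
    using S by (intro eventually_at_in_open) auto
  thus ?thesis
  proof eventually_elim
    case (elim w)
    have "\<forall>\<^sub>F v in nhds w. v \<in> S - {z}"
      using elim S(1) by (intro eventually_nhds_in_open) auto
    thus ?case by eventually_elim (use S in auto)
  qed
qed

lemma cosparse_UNIV_eventually_nhds:
  "\<forall>\<^sub>\<approx>z::'a::t1_space. P z \<Longrightarrow> \<forall>\<^sub>\<approx>z. eventually P (nhds z)"
  unfolding eventually_cosparse_UNIV_iff using eventually_at_imp_eventually_at_nhds by blast

lemma entire_not_eventually_constant:
  assumes "h holomorphic_on UNIV" "\<not> h constant_on UNIV"
  shows "\<forall>\<^sub>F w in at z. h w \<noteq> c"
proof -
  obtain b where "h b \<noteq> c" using assms(2) by (auto simp: constant_on_def)
  have "(\<lambda>z. h z - c) holomorphic_on UNIV" by (intro holomorphic_intros assms)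
  from non_zero_neighbour_alt[OF this open_UNIV connected_UNIV, of z b] \<open>h b \<noteq> c\<close>
  show ?thesis by auto
qed

lemma entire_isCont: "h holomorphic_on UNIV \<Longrightarrow> isCont h z"
  using holomorphic_on_imp_continuous_on continuous_on_eq_continuous_at[OF open_UNIV] by blast

lemma entire_filterlim_at:
  assumes "h holomorphic_on UNIV" "\<not> h constant_on UNIV"
  shows "filterlim h (at (h z)) (at z)"
  using entire_isCont[OF assms(1)] entire_not_eventually_constant[OF assms]
  by (intro filterlim_atI) (auto simp: isCont_def)

lemma cosparse_compose_entire:
  assumes "h holomorphic_on UNIV" "\<not> h constant_on UNIV" "\<forall>\<^sub>\<approx>w. P w"
  shows "\<forall>\<^sub>\<approx>z. P (h z)"
  using assms(3) filterlim_iff[THEN iffD1, OF entire_filterlim_at[OF assms(1,2)]]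
  unfolding eventually_cosparse_UNIV_iff by blast

lemma meromorphic_eq_cosparse:
  assumes "f meromorphic_on UNIV" "g meromorphic_on UNIV" "\<forall>\<^sub>F z in at z0. f z = g z"
  shows "\<forall>\<^sub>\<approx>z. f z = g z"
proof -
  have "(\<lambda>z. f z - g z) meromorphic_on UNIV"
    by (intro meromorphic_intros assms)
  from meromorphic_imp_constant_or_avoid[OF this, of 0]
  consider "\<forall>\<^sub>\<approx>z. f z = g z" | "\<forall>\<^sub>\<approx>z. f z \<noteq> g z" by auto
  thus ?thesis
  proof cases
    case 2
    hence "\<forall>\<^sub>F z in at z0. f z \<noteq> g z" by (simp add: eventually_cosparse_UNIV_iff)
    hence "\<forall>\<^sub>F z in at z0. False" using assms(3) by eventually_elim auto
    thus ?thesis by simp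
  qed
qed

lemma meromorphic_power_constant:
  assumes "f meromorphic_on UNIV" "\<forall>\<^sub>\<approx>z. f z ^ n = c" "n > 0"
  obtains d where "\<forall>\<^sub>\<approx>z. f z = d"
proof (rule ccontr)
  assume no: "\<not> thesis"
  have "\<forall>\<^sub>\<approx>z. f z \<noteq> d" for d
    using meromorphic_imp_constant_or_avoid[OF assms(1), of d] that no by auto
  hence "\<forall>\<^sub>\<approx>z. \<forall>d\<in>{x. x ^ n = c}. f z \<noteq> d"
    by (intro eventually_ball_finite finite_nth_roots assms) auto
  hence "\<forall>\<^sub>\<approx>z::complex. False"
    using assms(2) by eventually_elim auto
  thus False by simp
qed

abbreviation (input) sqrt3 :: complex where "sqrt3 \<equiv> of_real (sqrt 3)"

lemma sqrt3_square: "sqrt3 * sqrt3 = 3" "sqrt3 ^ 2 = 3"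
  by (metis abs_numeral of_real_mult of_real_numeral real_sqrt_mult_self)
     (metis of_real_numeral of_real_power real_sqrt_pow2 zero_le_numeral)

lemma mult_divide_cancel: "s \<noteq> 0 \<Longrightarrow> s * a / b / s = a / (b :: 'a :: field)"
  by simp

context wp_cubic
begin

text \<open>
  The coordinates \<open>u = U\<close>, \<open>v = V\<close> on the Fermat cubic come from \<open>x = 1 / (u + v)\<close> and \<open>y = sqrt 3 (u - v) / (u + v)\<close>
  on the Weierstrass cubic \<open>y\<^sup>2 = 4 x\<^sup>3 - 1\<close>.
\<close>
definition U :: "complex \<Rightarrow> complex" where
  "U w = (1 + deriv wp w / sqrt3) / (2 * wp w)"

definition V :: "complex \<Rightarrow> complex" where
  "V w = (1 - deriv wp w / sqrt3) / (2 * wp w)"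

text \<open>The common poles of \<open>U\<close> and \<open>V\<close>.\<close>
definition Poles :: "complex set" where
  "Poles = L \<union> {w. wp w = 0}"

lemma notin_Poles_iff: "w \<notin> Poles \<longleftrightarrow> w \<notin> L \<and> wp w \<noteq> 0"
  by (auto simp: Poles_def)

lemma lattice_subset_Poles: "w \<in> L \<Longrightarrow> w \<in> Poles"
  by (auto simp: Poles_def)

lemma Poles_shift: "t \<in> L \<Longrightarrow> w + t \<in> Poles \<longleftrightarrow> w \<in> Poles"
  using wp_periodic[of w t] lattice_shift_iff[of t w] by (auto simp: Poles_def)

lemma Poles_uminus [simp]: "- w \<in> Poles \<longleftrightarrow> w \<in> Poles"
  by (auto simp: Poles_def wp_even)

lemma eventually_not_Poles: "\<forall>\<^sub>F w in at z. w \<notin> Poles"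
proof -
  have "\<forall>\<^sub>F w in at z. wp w \<noteq> 0"
  proof (cases "z \<in> L")
    case True
    hence "filterlim wp at_infinity (at z)" by (rule wp_pole)
    thus ?thesis
      by (auto simp: filterlim_at_infinity[OF order_refl] dest!: spec[of _ 1] elim!: eventually_mono)
  next
    case False
    obtain a where "a \<notin> L" "wp a = 1" by (rule wp_surj)
    thus ?thesis
      using non_zero_neighbour_alt[OF wp_holomorphic open_compl_lattice connected_compl_lattice, of z a]
        False by (auto elim: eventually_mono)
  qed
  thus ?thesis using eventually_not_lattice[of z]
    by eventually_elim (auto simp: Poles_def)
qed

lemma cosparse_not_Poles: "\<forall>\<^sub>\<approx>w. w \<notin> Poles"
  by (simp add: eventually_cosparse_UNIV_iff eventually_not_Poles)

lemma U_plus_V: "w \<notin> Poles \<Longrightarrow> U w + V w = 1 / wp w"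
  by (simp add: U_def V_def notin_Poles_iff field_simps)

lemma U_minus_V: "w \<notin> Poles \<Longrightarrow> U w - V w = deriv wp w / (sqrt3 * wp w)"
  by (simp add: U_def V_def notin_Poles_iff field_simps)

lemma fermat_identity:
  fixes x y :: complex
  assumes "y ^ 2 = 4 * x ^ 3 - 1" "x \<noteq> 0"
  shows "((1 + y / sqrt3) / (2 * x)) ^ 3 + ((1 - y / sqrt3) / (2 * x)) ^ 3 = 1"
proof -
  define u where "u = y / sqrt3"
  have "u ^ 2 = y ^ 2 / 3" by (simp add: u_def power_divide sqrt3_square)
  hence u: "u * u = (4 * x ^ 3 - 1) / 3" using assms by (simp add: power2_eq_square)
  have "(1 + u) ^ 3 + (1 - u) ^ 3 = 2 + 6 * (u * u)"
    by (simp add: power3_eq_cube algebra_simps)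
  also have "\<dots> = 8 * x ^ 3" by (simp add: u field_simps)
  finally show ?thesis
    using assms(2) unfolding u_def[symmetric]
    by (simp add: power_divide power_mult_distrib flip: add_divide_distrib)
qed

lemma fermat: "w \<notin> Poles \<Longrightarrow> U w ^ 3 + V w ^ 3 = 1"
  unfolding U_def V_def by (rule fermat_identity) (auto simp: notin_Poles_iff ode)

lemma U_has_derivative:
  assumes "w \<notin> Poles"
  shows "(U has_field_derivative sqrt3 * V w ^ 2) (at w)"
proof -
  define x y where "x = wp w" and "y = deriv wp w"
  have w: "w \<notin> L" "x \<noteq> 0" using assms by (auto simp: notin_Poles_iff x_def)
  have y: "y * y = 4 * (x * x * x) - 1" using ode[OF w(1)] 
    by (simp add: x_def y_def power2_eq_square power3_eq_cube)
  have dx: "(wp has_field_derivative y) (at w)"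
    using wp_has_derivative_series(1)[OF w(1)] by (simp add: y_def)
  have dy: "(deriv wp has_field_derivative 6 * x ^ 2) (at w)"
    using deriv2_wp[OF w(1)] by (simp add: x_def)
  define s where "s = sqrt3"
  have s: "s * s = 3" "s \<noteq> 0" using sqrt3_square by (auto simp: s_def)
  have "((\<lambda>w. (1 + deriv wp w / s) / (2 * wp w)) has_field_derivative
          ((6 * x ^ 2 / s) * (2 * x) - (1 + y / s) * (2 * y)) / (2 * x * (2 * x))) (at w)"
    using dx dy w(2) s(2) by (auto intro!: derivative_eq_intros simp: x_def[symmetric] y_def[symmetric])
  also have "((6 * x ^ 2 / s) * (2 * x) - (1 + y / s) * (2 * y)) / (2 * x * (2 * x)) = s * ((1 - y / s) / (2 * x)) ^ 2"
  proof -
    have "(6 * x ^ 2 / s) * (2 * x) - (1 + y / s) * (2 * y) = (12 * (x * x * x) - 2 * s * y - 2 * (y * y)) / s"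
      using s(2) by (simp add: field_simps power2_eq_square)
    also have "12 * (x * x * x) - 2 * s * y - 2 * (y * y) = 3 - 2 * s * y + y * y"
      unfolding y by simp
    also have "\<dots> = (s - y) * (s - y)" using s(1) by (simp add: algebra_simps)
    finally have "((6 * x ^ 2 / s) * (2 * x) - (1 + y / s) * (2 * y)) / (2 * x * (2 * x)) = (s - y) * (s - y) / s / (2 * x * (2 * x))" by simp
    also have "\<dots> = s * ((1 - y / s) / (2 * x)) ^ 2"
      using s(2) w(2) by (simp add: power2_eq_square divide_simps)
    finally show ?thesis .
  qed
  finally show "(U has_field_derivative sqrt3 * V w ^ 2) (at w)"
    unfolding U_def[abs_def] V_def s_def x_def y_def .
qed

lemma U_analytic: "w \<notin> Poles \<Longrightarrow> U analytic_on {w}"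
  unfolding U_def[abs_def]
  by (intro analytic_intros wp_analytic deriv_wp_analytic) (auto simp: notin_Poles_iff)

lemma wp_meromorphic: "wp meromorphic_on UNIV"
proof -
  have "wp meromorphic_on {z}" for z
  proof (cases "z \<in> L")
    case True
    have "\<forall>\<^sub>F w in at z. wp analytic_on {w}"
      using eventually_not_lattice[of z] by eventually_elim (rule wp_analytic)
    then obtain e where e: "e > 0" "\<And>w. w \<noteq> z \<Longrightarrow> dist w z < e \<Longrightarrow> wp analytic_on {w}"
      by (auto simp: eventually_at)
    have "wp analytic_on ball z e - {z}"
      by (subst analytic_on_analytic_at) (use e in \<open>auto simp: dist_commute\<close>)
    hence "isolated_singularity_at wp z"
      using e(1) by (auto simp: isolated_singularity_at_def)
    moreover have "not_essential wp z"
      using wp_pole[OF True] by (auto simp: not_essential_def is_pole_def)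
    ultimately show ?thesis by (simp add: meromorphic_at_iff)
  qed (use wp_analytic analytic_on_imp_meromorphic_on in blast)
  thus ?thesis using meromorphic_on_meromorphic_at by blast
qed

lemma U_meromorphic: "U meromorphic_on UNIV" and V_meromorphic: "V meromorphic_on UNIV"
  unfolding U_def[abs_def] V_def[abs_def] by (intro meromorphic_intros wp_meromorphic)+

lemma U_uminus: "w \<notin> L \<Longrightarrow> U (- w) = V w"
  by (simp add: U_def V_def wp_even deriv_wp_odd)

lemma U_periodic: "w \<notin> L \<Longrightarrow> t \<in> L \<Longrightarrow> U (w + t) = U w"
  and V_periodic: "w \<notin> L \<Longrightarrow> t \<in> L \<Longrightarrow> V (w + t) = V w"
  by (simp_all add: U_def V_def wp_periodic deriv_wp_periodic)

lemma V_power: "w \<notin> Poles \<Longrightarrow> V w ^ 3 = 1 - U w ^ 3"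
  using fermat[of w] by (simp add: algebra_simps)

text \<open>
  At a lattice point \<open>U + V = 1 / \<wp>\<close> tends to \<open>0\<close> while \<open>(U - V)\<^sup>2 = (4 \<wp>\<^sup>3 - 1) / (3 \<wp>\<^sup>2)\<close> tends to infinity;
  at a zero of \<open>\<wp>\<close>, where \<open>\<wp>' = \<plusminus>\<i>\<close>, the numerator of \<open>U\<close> does not vanish.
\<close>
lemma U_pole:
  assumes "w \<in> Poles" shows "filterlim U at_infinity (at w)"
proof (cases "w \<in> L")
  case True
  have wp: "filterlim wp at_infinity (at w)" by (rule wp_pole[OF True])
  have inv: "((\<lambda>z. inverse (wp z)) \<longlongrightarrow> 0) (at w)"
    by (rule filterlim_compose[OF tendsto_inverse_0 wp])
  have "((\<lambda>z. - (inverse (wp z) ^ 2 / 3)) \<longlongrightarrow> - (0 ^ 2 / 3)) (at w)"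
    by (intro tendsto_intros inv) auto
  hence "filterlim (\<lambda>z. - (inverse (wp z) ^ 2 / 3) + 4 / 3 * wp z) at_infinity (at w)"
    by (rule tendsto_add_filterlim_at_infinity)
       (rule tendsto_mult_filterlim_at_infinity[OF tendsto_const _ wp], simp)
  moreover have "\<forall>\<^sub>F z in at w. - (inverse (wp z) ^ 2 / 3) + 4 / 3 * wp z = (U z - V z) ^ 2"
    using eventually_not_Poles[of w]
  proof eventually_elim
    case (elim z)
    hence z: "z \<notin> L" "wp z \<noteq> 0" by (auto simp: notin_Poles_iff)
    have eq: "(U z - V z) ^ 2 = deriv wp z ^ 2 / (3 * wp z ^ 2)"
      using elim by (simp add: U_minus_V power_divide power_mult_distrib sqrt3_square)
    show ?case unfolding eq ode[OF z(1)] using z(2) 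
      by (simp add: field_simps power2_eq_square power3_eq_cube)
  qed
  ultimately have sq: "filterlim (\<lambda>z. (U z - V z) ^ 2) at_infinity (at w)"
    by (rule filterlim_cong[THEN iffD1, OF refl refl, rotated])
  have "filterlim (\<lambda>z. U z - V z) at_infinity (at w)"
    unfolding filterlim_at_infinity[OF order_refl]
  proof (intro allI impI)
    fix r :: real assume r: "r > 0"
    hence "\<forall>\<^sub>F z in at w. r ^ 2 \<le> norm ((U z - V z) ^ 2)"
      using sq unfolding filterlim_at_infinity[OF order_refl] by simp
    thus "\<forall>\<^sub>F z in at w. r \<le> norm (U z - V z)"
      by eventually_elim (metis norm_power norm_ge_zero power2_le_imp_le)
  qed
  hence "filterlim (\<lambda>z. inverse (wp z) + (U z - V z)) at_infinity (at w)"
    by (rule tendsto_add_filterlim_at_infinity[OF inv])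
  hence "filterlim (\<lambda>z. 1 / 2 * (inverse (wp z) + (U z - V z))) at_infinity (at w)"
    by (intro tendsto_mult_filterlim_at_infinity[OF tendsto_const]) auto
  also have "?this \<longleftrightarrow> ?thesis"
  proof (rule filterlim_cong[OF refl refl])
    show "\<forall>\<^sub>F z in at w. 1 / 2 * (inverse (wp z) + (U z - V z)) = U z"
      using eventually_not_Poles[of w]
    proof eventually_elim
      case (elim z)
      have "inverse (wp z) = U z + V z" using U_plus_V[OF elim] by (simp add: inverse_eq_divide)
      thus ?case by simp
    qed
  qed
  finally show ?thesis .
next
  case False
  with assms have w: "wp w = 0" by (auto simp: Poles_def)
  have "((\<lambda>z. 1 + deriv wp z / sqrt3) \<longlongrightarrow> 1 + deriv wp w / sqrt3) (at w)"
    by (intro isContD analytic_at_imp_isCont analytic_intros deriv_wp_analytic False) auto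
  moreover have "1 + deriv wp w / sqrt3 \<noteq> 0"
  proof
    assume "1 + deriv wp w / sqrt3 = 0"
    hence "deriv wp w = - sqrt3" by (simp add: field_simps add_eq_0_iff)
    hence "deriv wp w ^ 2 = 3" by (simp add: sqrt3_square)
    thus False using ode[OF False] w by simp
  qed
  moreover have "filterlim (\<lambda>z. 2 * wp z) (at 0) (at w)"
  proof (rule filterlim_atI)
    have "((\<lambda>z. 2 * wp z) \<longlongrightarrow> 2 * wp w) (at w)"
      by (intro isContD analytic_at_imp_isCont analytic_intros wp_analytic False)
    thus "((\<lambda>z. 2 * wp z) \<longlongrightarrow> 0) (at w)" by (simp add: w)
    show "\<forall>\<^sub>F z in at w. 2 * wp z \<noteq> 0"
      using eventually_not_Poles[of w] by eventually_elim (auto simp: notin_Poles_iff)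
  qed
  ultimately show ?thesis unfolding U_def[abs_def]
    by (intro filterlim_divide_at_infinity)
qed

lemma fermat_surj:
  assumes "p ^ 3 + q ^ 3 = 1"
  obtains w where "w \<notin> Poles" "U w = p" "V w = q"
    "wp w = 1 / (p + q)" "deriv wp w = sqrt3 * (p - q) / (p + q)"
proof -
  define x y where "x = 1 / (p + q)" and "y = sqrt3 * (p - q) / (p + q)"
  have *: "(p + q) * (p ^ 2 - p * q + q ^ 2) = 1"
    using assms by (simp add: algebra_simps power2_eq_square power3_eq_cube)
  hence pq: "p + q \<noteq> 0" by auto
  have "y ^ 2 * (p + q) ^ 3 = (y * (p + q)) ^ 2 * (p + q)"
    by (simp add: power2_eq_square power3_eq_cube algebra_simps)
  also have "y * (p + q) = sqrt3 * (p - q)" using pq by (simp add: y_def)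
  also have "(sqrt3 * (p - q)) ^ 2 * (p + q) = 3 * (p - q) ^ 2 * (p + q)"
    by (simp only: power_mult_distrib sqrt3_square)
  also have "\<dots> = 4 * ((p + q) * (p ^ 2 - p * q + q ^ 2)) - (p + q) ^ 3"
    by (simp add: algebra_simps power2_eq_square power3_eq_cube)
  also have "\<dots> = (4 * x ^ 3 - 1) * (p + q) ^ 3"
    unfolding * using pq by (simp add: x_def power_divide left_diff_distrib)
  finally have "y ^ 2 = 4 * x ^ 3 - 1" using pq by simp
  then obtain w where w: "w \<notin> L" "wp w = x" "deriv wp w = y" by (rule curve_point)
  show ?thesis
  proof (rule that)
    show "w \<notin> Poles" using w pq by (auto simp: notin_Poles_iff x_def)
    have y: "y / sqrt3 = (p - q) / (p + q)" unfolding y_def by (rule mult_divide_cancel) simp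
    show "U w = p" "V w = q"
      unfolding U_def V_def w y x_def using pq by (simp_all add: divide_simps)
  qed (use w in \<open>auto simp: x_def y_def\<close>)
qed

end

section \<open>Lifting meromorphic maps into the Fermat cubic\<close>

text \<open>This is the equality of the two forms \<open>du / v\<^sup>2\<close> and \<open>- dv / u\<^sup>2\<close> of the holomorphic differential.\<close>
lemma fermat_differential:
  assumes F: "F analytic_on {z}" and G: "G analytic_on {z}"
    and eq: "\<forall>\<^sub>F w in nhds z. F w ^ 3 + G w ^ 3 = 1"
  shows "F z ^ 2 * deriv F z = - (G z ^ 2 * deriv G z)"
proof -
  have d: "(F has_field_derivative deriv F z) (at z)" "(G has_field_derivative deriv G z) (at z)"
    using F G by (auto simp: analytic_on_imp_differentiable_at DERIV_deriv_iff_field_differentiable)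
  have "((\<lambda>w. F w ^ 3 + G w ^ 3) has_field_derivative
         3 * F z ^ 2 * deriv F z + 3 * G z ^ 2 * deriv G z) (at z)"
    using d by (auto intro!: derivative_eq_intros)
  moreover have "((\<lambda>w. F w ^ 3 + G w ^ 3) has_field_derivative 0) (at z)"
    using DERIV_const DERIV_cong_ev[OF refl eq refl] by blast
  ultimately have "3 * F z ^ 2 * deriv F z + 3 * G z ^ 2 * deriv G z = 0"
    by (rule DERIV_unique)
  hence "3 * (F z ^ 2 * deriv F z + G z ^ 2 * deriv G z) = 0"
    unfolding distrib_left mult.assoc .
  hence "F z ^ 2 * deriv F z + G z ^ 2 * deriv G z = 0"
    by (simp only: mult_eq_0_iff) simp
  thus ?thesis by (simp add: eq_neg_iff_add_eq_0)
qed

lemma is_pole_power: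
  fixes f :: "complex \<Rightarrow> complex"
  shows "is_pole f z \<Longrightarrow> n > 0 \<Longrightarrow> is_pole (\<lambda>w. f w ^ n) z"
  unfolding is_pole_def by (rule Limits.filterlim_power_at_infinity)

lemma fermat_finite:
  fixes F G :: "complex \<Rightarrow> complex"
  assumes F: "isCont F z" and G: "is_pole G z"
    and eq: "\<forall>\<^sub>F w in at z. F w ^ 3 + G w ^ 3 = 1"
  shows False
proof -
  have lim: "((\<lambda>w. 1 - F w ^ 3) \<longlongrightarrow> 1 - F z ^ 3) (at z)"
    using F unfolding isCont_def by (intro tendsto_intros)
  have "is_pole (\<lambda>w. G w ^ 3) z" using is_pole_power[OF G, of 3] by simp
  moreover have "\<forall>\<^sub>F w in at z. G w ^ 3 = 1 - F w ^ 3"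
    using eq by eventually_elim (simp add: algebra_simps)
  ultimately have "is_pole (\<lambda>w. 1 - F w ^ 3) z"
    by (rule is_pole_transform[OF _ _ refl])
  with lim show False
    unfolding is_pole_def using not_tendsto_and_filterlim_at_infinity[OF at_neq_bot] by blast
qed

text \<open>
  Where \<open>G = 0\<close>, the second form \<open>- dG / F\<^sup>2\<close> of the differential shows that it is finite; at a common pole, the
  coordinates \<open>1 / F\<close> and \<open>G / F\<close> do, in which it is \<open>- d(1/F) / (G/F)\<^sup>2\<close>, with \<open>(G/F)\<^sup>3\<close> tending to \<open>- 1\<close>.
\<close>
lemma fermat_differential_limit:
  assumes F: "F nicely_meromorphic_on UNIV" and G: "G nicely_meromorphic_on UNIV"
    and eq: "\<forall>\<^sub>\<approx>z. F z ^ 3 + G z ^ 3 = 1" and F0: "\<forall>\<^sub>\<approx>z. F z \<noteq> 0" and G0: "\<forall>\<^sub>\<approx>z. G z \<noteq> 0"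
  shows "\<exists>c. ((\<lambda>w. deriv F w / G w ^ 2) \<longlongrightarrow> c) (at z)"
proof -
  have eqz: "\<forall>\<^sub>F w in at z. F w ^ 3 + G w ^ 3 = 1" and F0z: "\<forall>\<^sub>F w in at z. F w \<noteq> 0"
    and G0z: "\<forall>\<^sub>F w in at z. G w \<noteq> 0"
    using eq F0 G0 by (auto simp: eventually_cosparse_UNIV_iff)
  have mero: "F meromorphic_on UNIV" "G meromorphic_on UNIV"
    using F G by (auto simp: nicely_meromorphic_on_def)
  have "\<forall>\<^sub>\<approx>w. F analytic_on {w}" "\<forall>\<^sub>\<approx>w. G analytic_on {w}" 
    "\<forall>\<^sub>\<approx>w. \<forall>\<^sub>F v in nhds w. F v ^ 3 + G v ^ 3 = 1"
    using mero eq by (auto intro: meromorphic_on_imp_analytic_cosparse cosparse_UNIV_eventually_nhds)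
  hence an: "\<forall>\<^sub>F w in at z. F analytic_on {w}" "\<forall>\<^sub>F w in at z. G analytic_on {w}"
    "\<forall>\<^sub>F w in at z. \<forall>\<^sub>F v in nhds w. F v ^ 3 + G v ^ 3 = 1"
    by (auto simp: eventually_cosparse_UNIV_iff)
  show ?thesis
  proof (cases "is_pole F z")
    case False
    hence Fan: "F analytic_on {z}" using F nicely_meromorphic_on_imp_analytic_at by blast
    hence "\<not> is_pole G z" using fermat_finite[OF _ _ eqz] analytic_at_imp_isCont by blast
    hence Gan: "G analytic_on {z}" using G nicely_meromorphic_on_imp_analytic_at by blast
    show ?thesis
    proof (cases "G z = 0")
      case False
      have "(\<lambda>w. deriv F w / G w ^ 2) analytic_on {z}"
        using False by (intro analytic_intros Fan Gan) auto
      thus ?thesis by (metis analytic_at_imp_isCont isCont_def)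
    next
      case True
      have "((\<lambda>w. F w ^ 3 + G w ^ 3) \<longlongrightarrow> F z ^ 3 + G z ^ 3) (at z)"
        by (intro isContD analytic_at_imp_isCont analytic_intros Fan Gan)
      moreover have "((\<lambda>w. F w ^ 3 + G w ^ 3) \<longlongrightarrow> 1) (at z)"
        by (rule tendsto_eventually) (rule eqz)
      ultimately have "F z ^ 3 + G z ^ 3 = 1" by (rule LIM_unique)
      hence "F z \<noteq> 0" using True by auto
      hence "(\<lambda>w. - deriv G w / F w ^ 2) analytic_on {z}"
        by (intro analytic_intros Fan Gan) auto
      hence "((\<lambda>w. - deriv G w / F w ^ 2) \<longlongrightarrow> - deriv G z / F z ^ 2) (at z)"
        by (intro isContD analytic_at_imp_isCont)
      moreover have "\<forall>\<^sub>F w in at z. - deriv G w / F w ^ 2 = deriv F w / G w ^ 2"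
        using an F0z G0z
      proof eventually_elim
        case (elim w)
        from fermat_differential[OF elim(1-3)] elim(4,5) show ?case
          by (simp add: field_simps)
      qed
      ultimately have "((\<lambda>w. deriv F w / G w ^ 2) \<longlongrightarrow> - deriv G z / F z ^ 2) (at z)"
        by (rule Lim_transform_eventually)
      thus ?thesis by blast
    qed
  next
    case pole: True
    define b where "b w = G w / F w" for w
    have inv: "((\<lambda>w. inverse (F w)) \<longlongrightarrow> 0) (at z)"
      using pole unfolding is_pole_def by (rule filterlim_compose[OF tendsto_inverse_0])
    have "((\<lambda>w. inverse (F w) ^ 3 - 1) \<longlongrightarrow> 0 ^ 3 - 1) (at z)"
      by (intro tendsto_intros inv)
    moreover have "\<forall>\<^sub>F w in at z. inverse (F w) ^ 3 - 1 = b w ^ 3"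
      using eqz F0z
    proof eventually_elim
      case (elim w)
      have "b w ^ 3 = G w ^ 3 / F w ^ 3" by (simp add: b_def power_divide)
      also have "G w ^ 3 = 1 - F w ^ 3" using elim(1) by (simp add: algebra_simps)
      finally show ?case using elim(2) by (simp add: divide_simps)
    qed
    ultimately have b3: "((\<lambda>w. b w ^ 3) \<longlongrightarrow> - 1) (at z)"
      using Lim_transform_eventually by fastforce
    have "b meromorphic_on {z}"
      unfolding b_def by (intro meromorphic_intros meromorphic_on_subset[OF mero(1)] meromorphic_on_subset[OF mero(2)]) auto
    hence "not_essential b z" by (simp add: meromorphic_at_iff)
    moreover have "\<not> is_pole b z"
    proof
      assume "is_pole b z"
      hence "is_pole (\<lambda>w. b w ^ 3) z" using is_pole_power[of b z 3] by simp
      with b3 show False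
        unfolding is_pole_def using not_tendsto_and_filterlim_at_infinity[OF at_neq_bot] by blast
    qed
    ultimately obtain b0 where b0: "(b \<longlongrightarrow> b0) (at z)"
      by (auto simp: not_essential_def)
    have "b0 ^ 3 = - 1"
      using tendsto_power[OF b0, of 3] b3 LIM_unique by blast
    hence b0_nz: "b0 \<noteq> 0" by auto
    define a where "a = remove_sings (\<lambda>w. inverse (F w))"
    have iso: "isolated_singularity_at (\<lambda>w. inverse (F w)) z"
      using meromorphic_on_inverse[OF mero(1)] by (simp add: meromorphic_on_altdef)
    have a_an: "a analytic_on {z}"
      unfolding a_def by (rule remove_sings_analytic_at[OF iso inv])
    have "deriv a \<midarrow>z\<rightarrow> deriv a z"
      by (intro isContD analytic_at_imp_isCont analytic_intros a_an)
    hence "((\<lambda>w. - deriv a w / b w ^ 2) \<longlongrightarrow> - deriv a z / b0 ^ 2) (at z)"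
      using b0 b0_nz by (intro tendsto_intros) auto
    moreover have "\<forall>\<^sub>F w in at z. \<forall>\<^sub>F v in nhds w. a v = inverse (F v)"
      unfolding a_def
      by (intro eventually_at_imp_eventually_at_nhds eventually_remove_sings_eq_at iso)
    hence "\<forall>\<^sub>F w in at z. - deriv a w / b w ^ 2 = deriv F w / G w ^ 2"
      using an(1) F0z G0z
    proof eventually_elim
      case (elim w)
      have "(F has_field_derivative deriv F w) (at w)"
        using elim by (auto simp: analytic_on_imp_differentiable_at DERIV_deriv_iff_field_differentiable)
      hence "((\<lambda>v. inverse (F v)) has_field_derivative - (deriv F w / F w ^ 2)) (at w)"
        using elim by (auto intro!: derivative_eq_intros simp: power2_eq_square field_simps)
      hence "deriv (\<lambda>v. inverse (F v)) w = - (deriv F w / F w ^ 2)"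
        by (rule DERIV_imp_deriv)
      moreover have "deriv a w = deriv (\<lambda>v. inverse (F v)) w"
        using elim by (intro deriv_cong_ev) auto
      ultimately show ?case using elim by (simp add: b_def field_simps)
    qed
    ultimately have "((\<lambda>w. deriv F w / G w ^ 2) \<longlongrightarrow> - deriv a z / b0 ^ 2) (at z)"
      by (rule Lim_transform_eventually)
    thus ?thesis by blast
  qed
qed

context wp_cubic
begin

lemma curve_coordinates:
  fixes p q :: complex
  assumes "p ^ 3 + q ^ 3 = 1"
  shows "p + q \<noteq> 0" "(sqrt3 * (p - q) / (p + q)) ^ 2 = 4 * (1 / (p + q)) ^ 3 - 1"
proof -
  have "p + q \<noteq> 0"
  proof
    assume "p + q = 0"
    hence "p = - q" by (simp add: add_eq_0_iff)
    thus False using assms by simp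
  qed
  obtain w where "w \<notin> Poles" "U w = p" "V w = q"
    "wp w = 1 / (p + q)" "deriv wp w = sqrt3 * (p - q) / (p + q)"
    using fermat_surj[OF assms] .
  thus "p + q \<noteq> 0" "(sqrt3 * (p - q) / (p + q)) ^ 2 = 4 * (1 / (p + q)) ^ 3 - 1"
    using ode[of w] \<open>p + q \<noteq> 0\<close> by (auto simp: notin_Poles_iff)
qed

lemma UV_from_coordinates:
  assumes "wp w = 1 / (p + q)" "deriv wp w = sqrt3 * (p - q) / (p + q)" "p + q \<noteq> 0"
  shows "U w = p" "V w = q"
proof -
  have y: "deriv wp w / sqrt3 = (p - q) / (p + q)"
    unfolding assms by (rule mult_divide_cancel) simp
  show "U w = p" "V w = q"
    unfolding U_def V_def y assms(1) using assms(3) by (simp_all add: divide_simps)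
qed

lemma UV_compose_meromorphic:
  assumes "h holomorphic_on UNIV"
  shows "(\<lambda>z. U (h z)) meromorphic_on UNIV" "(\<lambda>z. V (h z)) meromorphic_on UNIV"
  using meromorphic_on_compose[OF U_meromorphic, of h UNIV] 
    meromorphic_on_compose[OF V_meromorphic, of h UNIV] assms
  by (auto simp: analytic_on_open)

text \<open>
  The lift is the primitive of the pulled back differential that is correct at one point \<open>z0\<close>. There \<open>F\<close> and \<open>G\<close>
  have to be finite, and \<open>F z0 \<noteq> G z0\<close> makes \<open>\<wp>\<close> locally invertible; near \<open>z0\<close> the claim is \<open>local_lift\<close>, and
  it spreads by the identity theorem.
\<close>
theorem fermat_lift:
  assumes F: "F meromorphic_on UNIV" and G: "G meromorphic_on UNIV"
    and eq: "\<forall>\<^sub>\<approx>z. F z ^ 3 + G z ^ 3 = 1" and nonconst: "\<nexists>c. \<forall>\<^sub>\<approx>z. F z = c"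
  obtains h where "h holomorphic_on UNIV" "\<not> h constant_on UNIV"
    "\<forall>\<^sub>\<approx>z. h z \<notin> Poles \<and> F z = U (h z) \<and> G z = V (h z)"
proof -
  define F1 where "F1 = remove_sings F"
  define G1 where "G1 = remove_sings G"
  have nice: "F1 nicely_meromorphic_on UNIV" "G1 nicely_meromorphic_on UNIV"
    using F G by (simp_all add: F1_def G1_def remove_sings_nicely_meromorphic)
  hence mero: "F1 meromorphic_on UNIV" "G1 meromorphic_on UNIV"
    by (auto simp: nicely_meromorphic_on_def)
  have FF1: "\<forall>\<^sub>\<approx>z. F1 z = F z" "\<forall>\<^sub>\<approx>z. G1 z = G z"
    using F G by (simp_all add: F1_def G1_def eventually_remove_sings_eq)
  have eq1: "\<forall>\<^sub>\<approx>z. F1 z ^ 3 + G1 z ^ 3 = 1"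
    using FF1 eq by eventually_elim auto
  have nonconst1: "\<nexists>c. \<forall>\<^sub>\<approx>z. F1 z = c"
  proof
    assume "\<exists>c. \<forall>\<^sub>\<approx>z. F1 z = c"
    then obtain c where "\<forall>\<^sub>\<approx>z. F1 z = c" by blast
    hence "\<forall>\<^sub>\<approx>z. F z = c" using FF1(1) by eventually_elim auto
    thus False using nonconst by blast
  qed
  have pw: "\<not> (\<forall>\<^sub>\<approx>z. F1 z ^ 3 = c)" for c
    using meromorphic_power_constant[OF mero(1), of 3 c] nonconst1 by auto
  have F0: "\<forall>\<^sub>\<approx>z. F1 z \<noteq> 0"
    using meromorphic_imp_constant_or_avoid[OF mero(1), of 0] nonconst1 by auto
  have G0: "\<forall>\<^sub>\<approx>z. G1 z \<noteq> 0"
  proof -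
    have "\<not> (\<forall>\<^sub>\<approx>z. G1 z = 0)"
    proof
      assume "\<forall>\<^sub>\<approx>z. G1 z = 0"
      hence "\<forall>\<^sub>\<approx>z. F1 z ^ 3 = 1" using eq1 by eventually_elim auto
      thus False using pw by blast
    qed
    thus ?thesis using meromorphic_imp_constant_or_avoid[OF mero(2), of 0] by auto
  qed
  have FG: "\<forall>\<^sub>\<approx>z. F1 z - G1 z \<noteq> 0"
  proof -
    have "\<not> (\<forall>\<^sub>\<approx>z. F1 z - G1 z = 0)"
    proof
      assume "\<forall>\<^sub>\<approx>z. F1 z - G1 z = 0"
      hence "\<forall>\<^sub>\<approx>z. F1 z ^ 3 = 1 / 2" using eq1 by eventually_elim (auto simp: field_simps)
      thus False using pw by blast
    qed
    moreover have "(\<lambda>z. F1 z - G1 z) meromorphic_on UNIV"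
      by (intro meromorphic_intros mero)
    ultimately show ?thesis using meromorphic_imp_constant_or_avoid[of "\<lambda>z. F1 z - G1 z" UNIV 0] by auto
  qed
  define d0 where "d0 = (\<lambda>z. deriv F1 z / G1 z ^ 2)"
  define d where "d = remove_sings d0"
  have d0_mero: "d0 meromorphic_on UNIV"
    unfolding d0_def by (intro meromorphic_intros mero)
  have "d analytic_on {z}" for z
  proof -
    obtain c where c: "(d0 \<longlongrightarrow> c) (at z)"
      using fermat_differential_limit[OF nice eq1 F0 G0, of z] unfolding d0_def by blast
    show ?thesis unfolding d_def
      by (rule remove_sings_analytic_at[OF _ c])
         (use d0_mero in \<open>simp add: meromorphic_on_altdef\<close>)
  qed
  hence d_hol: "d holomorphic_on UNIV"
    by (meson analytic_imp_holomorphic analytic_on_analytic_at)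
  have "(\<lambda>z. d z / sqrt3) holomorphic_on UNIV"
    by (intro holomorphic_intros d_hol) auto
  then obtain H where H: "\<And>z. (H has_field_derivative d z / sqrt3) (at z)"
    using holomorphic_convex_primitive'[OF convex_UNIV open_UNIV] by (metis UNIV_I)
  have "\<forall>\<^sub>\<approx>z. F1 analytic_on {z}" "\<forall>\<^sub>\<approx>z. G1 analytic_on {z}"
    "\<forall>\<^sub>\<approx>z. \<forall>\<^sub>F w in nhds z. F1 w ^ 3 + G1 w ^ 3 = 1"
    using mero eq1 by (auto intro: meromorphic_on_imp_analytic_cosparse cosparse_UNIV_eventually_nhds)
  hence "\<forall>\<^sub>\<approx>z. F1 analytic_on {z} \<and> G1 analytic_on {z} \<and>
    (\<forall>\<^sub>F w in nhds z. F1 w ^ 3 + G1 w ^ 3 = 1) \<and> G1 z \<noteq> 0 \<and> F1 z - G1 z \<noteq> 0"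
    using G0 FG by eventually_elim auto
  then obtain z0 where z0: "F1 analytic_on {z0}" "G1 analytic_on {z0}"
    "\<forall>\<^sub>F w in nhds z0. F1 w ^ 3 + G1 w ^ 3 = 1" "G1 z0 \<noteq> 0" "F1 z0 - G1 z0 \<noteq> 0"
    using eventually_happens[of _ "cosparse (UNIV :: complex set)"] by auto
  have eqz0: "F1 z0 ^ 3 + G1 z0 ^ 3 = 1"
    using eventually_nhds_x_imp_x[OF z0(3)] .
  note sum0 = curve_coordinates(1)[OF eqz0]
  obtain w0 where w0: "w0 \<notin> Poles" "U w0 = F1 z0" "V w0 = G1 z0"
    "wp w0 = 1 / (F1 z0 + G1 z0)" "deriv wp w0 = sqrt3 * (F1 z0 - G1 z0) / (F1 z0 + G1 z0)"
    using fermat_surj[OF eqz0] .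
  define h where "h z = H z - H z0 + w0" for z
  have h_der: "(h has_field_derivative d z / sqrt3) (at z)" for z
    unfolding h_def using H[of z] by (auto intro!: derivative_eq_intros)
  have h_hol: "h holomorphic_on UNIV"
    using h_der by (auto simp: holomorphic_on_open)
  have "\<forall>\<^sub>F z in nhds z0. wp (h z) = 1 / (F1 z + G1 z) \<and>
      deriv wp (h z) = sqrt3 * (F1 z - G1 z) / (F1 z + G1 z)"
  proof (rule local_lift)
    show "(\<lambda>z. 1 / (F1 z + G1 z)) analytic_on {z0}"
      using sum0 z0 by (intro analytic_intros) auto
    show "h analytic_on {z0}" using h_hol by (auto simp: analytic_at)
    show "isCont (\<lambda>z. sqrt3 * (F1 z - G1 z) / (F1 z + G1 z)) z0"
      using sum0 z0 by (intro analytic_at_imp_isCont analytic_intros) auto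
    show "\<forall>\<^sub>F z in nhds z0. (sqrt3 * (F1 z - G1 z) / (F1 z + G1 z)) ^ 2 = 4 * (1 / (F1 z + G1 z)) ^ 3 - 1"
      using z0(3) by eventually_elim (rule curve_coordinates)
    have "\<forall>\<^sub>F z in nhds z0. G1 z \<noteq> 0"
      using analytic_at_imp_isCont[OF z0(2)] z0(4)
      by (simp add: isCont_def tendsto_imp_eventually_ne eventually_nhds_conv_at)
    moreover have "\<forall>\<^sub>F z in nhds z0. d z = d0 z"
    proof -
      have "d0 analytic_on {z0}"
        unfolding d0_def using z0 by (intro analytic_intros) auto
      thus ?thesis unfolding d_def by (rule eventually_remove_sings_eq_nhds)
    qed
    moreover have "\<forall>\<^sub>F z in nhds z0. \<forall>\<^sub>F w in nhds z. F1 w ^ 3 + G1 w ^ 3 = 1"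
      unfolding eventually_eventually by (rule z0(3))
    ultimately show "\<forall>\<^sub>F z in nhds z0. deriv h z * (sqrt3 * (F1 z - G1 z) / (F1 z + G1 z)) =
        deriv (\<lambda>z. 1 / (F1 z + G1 z)) z"
      using z0(3) eventually_analytic_nhds[OF z0(1)] eventually_analytic_nhds[OF z0(2)]
    proof eventually_elim
      case (elim z)
      have sum: "F1 z + G1 z \<noteq> 0" using curve_coordinates(1)[OF elim(4)] .
      have der: "(F1 has_field_derivative deriv F1 z) (at z)" "(G1 has_field_derivative deriv G1 z) (at z)"
        using elim by (auto simp: analytic_on_imp_differentiable_at DERIV_deriv_iff_field_differentiable)
      have "((\<lambda>z. 1 / (F1 z + G1 z)) has_field_derivative
          - (deriv F1 z + deriv G1 z) / (F1 z + G1 z) ^ 2) (at z)"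
        using der sum by (auto intro!: derivative_eq_intros simp: power2_eq_square)
      hence X': "deriv (\<lambda>z. 1 / (F1 z + G1 z)) z = - (deriv F1 z + deriv G1 z) / (F1 z + G1 z) ^ 2"
        by (rule DERIV_imp_deriv)
      have G': "deriv G1 z = - (F1 z ^ 2 * deriv F1 z) / G1 z ^ 2"
        using fermat_differential[OF elim(5,6,3)] elim(1) by (simp add: field_simps)
      have sum': "deriv F1 z + deriv G1 z = - (deriv F1 z * (F1 z - G1 z) * (F1 z + G1 z) / G1 z ^ 2)"
        unfolding G' using elim(1) by (simp add: field_simps power2_eq_square)
      have h': "deriv h z = deriv F1 z / G1 z ^ 2 / sqrt3"
        using DERIV_imp_deriv[OF h_der[of z]] elim(2) by (simp add: d0_def)
      have *: "a / r / s * (s * m / t) = - (- (a * m * t / r)) / t ^ 2"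
        if "s \<noteq> 0" "t \<noteq> 0" for a r s m t :: complex
        using that by (simp add: power2_eq_square)
      show ?case unfolding X' sum' h' by (rule *) (use sum in auto)
    qed
  qed (use z0 sum0 w0 in \<open>auto simp: h_def notin_Poles_iff\<close>)
  hence "\<forall>\<^sub>F z in nhds z0. U (h z) = F1 z \<and> V (h z) = G1 z"
    using z0(3) by eventually_elim (use UV_from_coordinates curve_coordinates(1) in auto)
  hence "\<forall>\<^sub>F z in at z0. U (h z) = F1 z" "\<forall>\<^sub>F z in at z0. V (h z) = G1 z"
    by (auto simp: eventually_nhds_conv_at elim: eventually_mono)
  hence UV: "\<forall>\<^sub>\<approx>z. U (h z) = F1 z" "\<forall>\<^sub>\<approx>z. V (h z) = G1 z"
    using UV_compose_meromorphic[OF h_hol] mero by (auto intro!: meromorphic_eq_cosparse)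
  have h_nonconst: "\<not> h constant_on UNIV"
  proof
    assume "h constant_on UNIV"
    then obtain c where "\<And>z. h z = c" by (auto simp: constant_on_def)
    hence "\<forall>\<^sub>\<approx>z. F1 z = U c" using UV(1) by (auto elim: eventually_mono)
    thus False using nonconst1 by blast
  qed
  have "\<forall>\<^sub>\<approx>z. h z \<notin> Poles \<and> F z = U (h z) \<and> G z = V (h z)"
    using cosparse_compose_entire[OF h_hol h_nonconst cosparse_not_Poles] UV FF1
    by eventually_elim auto
  with h_hol h_nonconst show ?thesis by (rule that)
qed

end

section \<open>Symmetries of the Fermat cubic\<close>

lemma not_constant_on_linear:
  fixes a b :: complex
  assumes "a \<noteq> 0" shows "\<not> (\<lambda>z. a * z + b) constant_on UNIV"
proof
  assume "(\<lambda>z. a * z + b) constant_on UNIV"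
  then obtain c where c: "\<And>z. a * z + b = c" by (auto simp: constant_on_def)
  from c[of 0] c[of 1] assms(1) show False by simp
qed

lemma cosparse_linear:
  assumes "a \<noteq> 0" "\<forall>\<^sub>\<approx>z::complex. P z"
  shows "\<forall>\<^sub>\<approx>z. P (a * z + b)"
  by (rule cosparse_compose_entire[OF _ not_constant_on_linear assms(2)])
     (use assms in \<open>auto intro!: holomorphic_intros\<close>)

lemma cosparse_shift: "\<forall>\<^sub>\<approx>z::complex. P z \<Longrightarrow> \<forall>\<^sub>\<approx>z. P (z + c)"
  using cosparse_linear[of 1 P c] by simp

lemma not_constant_on_id: "\<not> (\<lambda>z::complex. z) constant_on UNIV"
  using not_constant_on_linear[of 1 0] by simp

lemma has_field_derivative_eventually_eq:
  assumes "(f has_field_derivative d) (at z)" "\<forall>\<^sub>F w in nhds z. f w = g w"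
  shows "(g has_field_derivative d) (at z)"
  using assms(1) DERIV_cong_ev[OF refl assms(2) refl] by simp

lemma entire_eq_if_cosparse:
  assumes "f holomorphic_on UNIV" "g holomorphic_on UNIV" "\<forall>\<^sub>\<approx>z. f z = g z"
  shows "f z = g (z::complex)"
proof -
  have "f \<midarrow>z\<rightarrow> f z" "g \<midarrow>z\<rightarrow> g z"
    using entire_isCont assms(1,2) by (auto simp: isCont_def)
  moreover have "\<forall>\<^sub>F w in at z. f w = g w"
    using assms(3) by (simp add: eventually_cosparse_UNIV_iff)
  ultimately have "f \<midarrow>z\<rightarrow> g z" by (simp add: filterlim_cong)
  thus ?thesis using \<open>f \<midarrow>z\<rightarrow> f z\<close> LIM_unique by blast
qed

lemma entire_has_derivative:
  "h holomorphic_on UNIV \<Longrightarrow> (h has_field_derivative deriv h z) (at z)"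
  by (simp add: holomorphic_derivI)

context wp_cubic
begin

lemma wp_pole_iff: "is_pole wp z \<longleftrightarrow> z \<in> L"
  using wp_pole[of z] wp_analytic[of z] analytic_at_imp_no_pole by (auto simp: is_pole_def)

text \<open>
  By \<open>local_lift\<close> the functions \<open>\<wp>(a + t)\<close> and \<open>\<wp>(b + t)\<close> agree near \<open>t = 0\<close>, hence everywhere; the second one has a
  pole at \<open>t = - b\<close>.
\<close>
lemma rigidity:
  assumes "a \<notin> L" "b \<notin> L" "wp a = wp b" "deriv wp a = deriv wp b" "deriv wp b \<noteq> 0"
  shows "a - b \<in> L"
proof -
  have shift: "(\<lambda>t. b + t) analytic_on {0}" by (intro analytic_intros)
  have an: "(\<lambda>t. wp (b + t)) analytic_on {0}" "(\<lambda>t. deriv wp (b + t)) analytic_on {0}"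
    using analytic_on_compose[OF shift, of wp] analytic_on_compose[OF shift, of "deriv wp"]
      wp_analytic[OF assms(2)] deriv_wp_analytic[OF assms(2)] by (simp_all add: o_def)
  have "isCont (\<lambda>t. b + t) 0" by (intro continuous_intros)
  hence ev: "\<forall>\<^sub>F t in nhds 0. b + t \<in> - L"
    using topological_tendstoD[of "\<lambda>t. b + t" "b" "at 0" "- L"] open_compl_lattice assms(2)
    by (auto simp: isCont_def eventually_nhds_conv_at)
  have "\<forall>\<^sub>F t in nhds 0. wp (a + t) = wp (b + t) \<and> deriv wp (a + t) = deriv wp (b + t)"
  proof (rule local_lift[OF an(1)])
    show "\<forall>\<^sub>F t in nhds 0. deriv wp (b + t) ^ 2 = 4 * wp (b + t) ^ 3 - 1"
      using ev by eventually_elim (auto simp: ode)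
    show "\<forall>\<^sub>F t in nhds 0. deriv (\<lambda>t. a + t) t * deriv wp (b + t) = deriv (\<lambda>t. wp (b + t)) t"
      using ev
    proof eventually_elim
      case (elim t)
      have "((\<lambda>t. wp (b + t)) has_field_derivative deriv wp (b + t) * 1) (at t)"
        by (rule DERIV_chain2[OF wp_has_derivative_series(1)])
           (use elim in \<open>auto intro!: derivative_eq_intros\<close>)
      from DERIV_imp_deriv[OF this] show ?case by simp
    qed
  qed (use assms an(2) in \<open>auto intro!: analytic_intros analytic_at_imp_isCont\<close>)
  hence eq: "\<forall>\<^sub>F t in at 0. wp (a + t) = wp (b + t)"
    by (auto simp: eventually_nhds_conv_at elim: eventually_mono)
  have mero: "(\<lambda>t. wp (x + t)) meromorphic_on UNIV" for x
    by (rule meromorphic_on_compose[OF wp_meromorphic]) (auto intro!: analytic_intros)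
  have "\<forall>\<^sub>\<approx>t. wp (a + t) = wp (b + t)"
    by (rule meromorphic_eq_cosparse[OF mero mero eq])
  hence "\<forall>\<^sub>F t in at (- b). wp (a + t) = wp (b + t)"
    by (simp add: eventually_cosparse_UNIV_iff)
  hence "is_pole (\<lambda>t. wp (a + t)) (- b) \<longleftrightarrow> is_pole (\<lambda>t. wp (b + t)) (- b)"
    by (rule is_pole_cong[OF _ refl])
  hence "is_pole wp (a - b) \<longleftrightarrow> is_pole wp 0"
    using is_pole_shift_iff[of wp a "- b"] is_pole_shift_iff[of wp b "- b"] 
    by (simp add: o_def)
  thus ?thesis by (simp add: wp_pole_iff)
qed

lemma is_pole_U_iff: "is_pole U z \<longleftrightarrow> z \<in> Poles"
  using U_pole[of z] U_analytic[of z] analytic_at_imp_no_pole by (auto simp: is_pole_def)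

lemma U_cosparse_neq: "\<forall>\<^sub>\<approx>w. U w \<noteq> c"
proof -
  have "\<not> (\<forall>\<^sub>\<approx>w. U w = c)"
  proof
    assume "\<forall>\<^sub>\<approx>w. U w = c"
    hence "\<forall>\<^sub>F w in at 0. U w = c" by (simp add: eventually_cosparse_UNIV_iff)
    hence "is_pole U 0 \<longleftrightarrow> is_pole (\<lambda>_::complex. c) 0" by (rule is_pole_cong[OF _ refl])
    thus False by (simp add: is_pole_U_iff lattice_subset_Poles)
  qed
  thus ?thesis using meromorphic_imp_constant_or_avoid[OF U_meromorphic, of c] by auto
qed

lemma V_cosparse_neq: "\<forall>\<^sub>\<approx>w. V w \<noteq> c"
proof -
  have "\<forall>\<^sub>\<approx>w. U (- 1 * w + 0) \<noteq> c"
    by (rule cosparse_linear[OF _ U_cosparse_neq]) simp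
  moreover have "\<forall>\<^sub>\<approx>w. w \<notin> L"
    using eventually_not_lattice by (simp add: eventually_cosparse_UNIV_iff)
  ultimately show ?thesis by eventually_elim (auto simp: U_uminus)
qed

text \<open>
  The pulled back differentials satisfy \<open>\<eta>'\<^sup>2 k' = \<eta> h'\<close>, and \<open>\<eta>'\<^sup>-\<^sup>2 = \<eta>'\<close>.
\<close>
lemma lifts_affine:
  assumes h: "h holomorphic_on UNIV" "\<not> h constant_on UNIV" and k: "k holomorphic_on UNIV"
    and \<eta>: "\<eta> ^ 3 = 1" "\<eta>' ^ 3 = 1"
    and eq: "\<forall>\<^sub>\<approx>z. h z \<notin> Poles \<and> k z \<notin> Poles \<and> U (k z) = \<eta> * U (h z) \<and> V (k z) = \<eta>' * V (h z)"
  obtains B where "\<And>z. k z = \<eta> * \<eta>' * h z + B"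
proof -
  have "\<forall>\<^sub>\<approx>z. deriv k z = \<eta> * \<eta>' * deriv h z"
    using cosparse_UNIV_eventually_nhds[OF eq] cosparse_compose_entire[OF h V_cosparse_neq[of 0]]
  proof eventually_elim
    case (elim z)
    have at: "h z \<notin> Poles" "k z \<notin> Poles" "V (k z) = \<eta>' * V (h z)"
      using eventually_nhds_x_imp_x[OF elim(1)] by auto
    have "\<forall>\<^sub>F w in nhds z. U (k w) = \<eta> * U (h w)"
      using elim(1) by eventually_elim auto
    moreover have "((\<lambda>w. U (k w)) has_field_derivative sqrt3 * V (k z) ^ 2 * deriv k z) (at z)"
      by (intro DERIV_chain2[OF U_has_derivative] entire_has_derivative at k)
    ultimately have "((\<lambda>w. \<eta> * U (h w)) has_field_derivative sqrt3 * V (k z) ^ 2 * deriv k z) (at z)"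
      by (rule has_field_derivative_eventually_eq[rotated])
    moreover have "((\<lambda>w. \<eta> * U (h w)) has_field_derivative \<eta> * (sqrt3 * V (h z) ^ 2 * deriv h z)) (at z)"
      by (intro DERIV_cmult DERIV_chain2[OF U_has_derivative] entire_has_derivative at h)
    ultimately have "sqrt3 * V (k z) ^ 2 * deriv k z = \<eta> * (sqrt3 * V (h z) ^ 2 * deriv h z)"
      by (rule DERIV_unique)
    hence "(sqrt3 * V (h z) ^ 2) * (\<eta>' ^ 2 * deriv k z) = (sqrt3 * V (h z) ^ 2) * (\<eta> * deriv h z)"
      unfolding at(3) by (simp add: power_mult_distrib mult_ac)
    hence *: "\<eta>' ^ 2 * deriv k z = \<eta> * deriv h z"
      by (rule mult_left_cancel[THEN iffD1, rotated]) (use elim(2) in auto)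
    have "deriv k z = \<eta>' ^ 3 * deriv k z" using \<eta> by simp
    also have "\<dots> = \<eta>' * (\<eta>' ^ 2 * deriv k z)" by (simp add: power2_eq_square power3_eq_cube)
    also have "\<dots> = \<eta> * \<eta>' * deriv h z" unfolding * by simp
    finally show ?case .
  qed
  hence dk: "deriv k z = \<eta> * \<eta>' * deriv h z" for z
    by (intro entire_eq_if_cosparse[of "deriv k" "\<lambda>z. \<eta> * \<eta>' * deriv h z"] holomorphic_intros holomorphic_deriv h k) auto
  have "(\<lambda>z. k z - \<eta> * \<eta>' * h z) constant_on UNIV"
  proof (rule has_field_derivative_0_imp_constant_on)
    show "((\<lambda>z. k z - \<eta> * \<eta>' * h z) has_field_derivative 0) (at z)" for z
      using DERIV_diff[OF entire_has_derivative[OF k] DERIV_cmult[OF entire_has_derivative[OF h(1)], of "\<eta> * \<eta>'"], of z]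
      by (simp add: dk)
  qed auto
  then obtain B where B: "\<And>z. k z - \<eta> * \<eta>' * h z = B" by (auto simp: constant_on_def)
  show ?thesis
    by (rule that[of B]) (use B in \<open>simp add: algebra_simps\<close>)
qed

lemma lifts_pole:
  assumes h: "h holomorphic_on UNIV" "\<not> h constant_on UNIV" and k: "k holomorphic_on UNIV"
    and \<eta>: "(\<eta> \<longlongrightarrow> c) (at z)" "c \<noteq> 0"
    and eq: "\<forall>\<^sub>F w in at z. U (k w) = \<eta> w * U (h w)" and z: "h z \<in> Poles"
  shows "k z \<in> Poles"
proof (rule ccontr)
  assume "k z \<notin> Poles"
  hence "isCont U (k z)" by (intro analytic_at_imp_isCont U_analytic)
  hence "isCont (\<lambda>w. U (k w)) z" by (rule isCont_o2[OF entire_isCont[OF k]])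
  hence "((\<lambda>w. U (k w)) \<longlongrightarrow> U (k z)) (at z)" by (simp add: isCont_def)
  moreover have "filterlim (\<lambda>w. \<eta> w * U (h w)) at_infinity (at z)"
    by (intro tendsto_mult_filterlim_at_infinity[OF \<eta>]
              filterlim_compose[OF U_pole[OF z] entire_filterlim_at[OF h]])
  hence "filterlim (\<lambda>w. U (k w)) at_infinity (at z)"
    using eq by (simp add: filterlim_cong)
  ultimately show False using not_tendsto_and_filterlim_at_infinity[OF at_neq_bot] by blast
qed

text \<open>
  The identity is a lift of \<open>(U, V)\<close>, so \<open>lifts_affine\<close> shows that the lift of \<open>(\<eta> U, \<eta>' V)\<close> is affine. Its value at
  the origin is a pole because \<open>U\<close> has one there.
\<close>
lemma fermat_symmetry:
  assumes \<eta>: "\<eta> ^ 3 = 1" "\<eta>' ^ 3 = 1"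
  obtains B where "B \<in> Poles"
    "\<forall>\<^sub>\<approx>w. \<eta> * \<eta>' * w + B \<notin> Poles \<and> U (\<eta> * \<eta>' * w + B) = \<eta> * U w \<and> V (\<eta> * \<eta>' * w + B) = \<eta>' * V w"
proof -
  have nz: "\<eta> \<noteq> 0" "\<eta>' \<noteq> 0" using \<eta> by auto
  have id: "(\<lambda>z. z) holomorphic_on UNIV" "\<not> (\<lambda>z::complex. z) constant_on UNIV"
    using not_constant_on_id by (auto intro!: holomorphic_intros)
  obtain k where k: "k holomorphic_on UNIV" "\<not> k constant_on UNIV"
    "\<forall>\<^sub>\<approx>w. k w \<notin> Poles \<and> \<eta> * U w = U (k w) \<and> \<eta>' * V w = V (k w)"
  proof (rule fermat_lift[of "\<lambda>w. \<eta> * U w" "\<lambda>w. \<eta>' * V w"])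
    show "(\<lambda>w. \<eta> * U w) meromorphic_on UNIV" "(\<lambda>w. \<eta>' * V w) meromorphic_on UNIV"
      by (intro meromorphic_intros U_meromorphic V_meromorphic)+
    show "\<forall>\<^sub>\<approx>w. (\<eta> * U w) ^ 3 + (\<eta>' * V w) ^ 3 = 1"
      using cosparse_not_Poles by eventually_elim (simp add: power_mult_distrib \<eta> fermat)
    show "\<nexists>c. \<forall>\<^sub>\<approx>w. \<eta> * U w = c"
    proof
      assume "\<exists>c. \<forall>\<^sub>\<approx>w. \<eta> * U w = c"
      then obtain c where "\<forall>\<^sub>\<approx>w. \<eta> * U w = c" by blast
      hence "\<forall>\<^sub>\<approx>w::complex. False"
        using U_cosparse_neq[of "c / \<eta>"] by eventually_elim (use nz in auto)
      thus False by simp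
    qed
  qed
  have eq: "\<forall>\<^sub>\<approx>w. w \<notin> Poles \<and> k w \<notin> Poles \<and> U (k w) = \<eta> * U w \<and> V (k w) = \<eta>' * V w"
    using k(3) cosparse_not_Poles by eventually_elim auto
  obtain B where B: "\<And>z. k z = \<eta> * \<eta>' * z + B"
    using lifts_affine[OF id k(1) \<eta> eq] by blast
  have "\<forall>\<^sub>F w in at 0. U (k w) = \<eta> * U w"
    using eq unfolding eventually_cosparse_UNIV_iff by (auto elim: eventually_mono)
  hence "k 0 \<in> Poles"
    by (rule lifts_pole[OF id k(1) tendsto_const nz(1)]) (simp add: lattice_subset_Poles)
  hence "B \<in> Poles" using B[of 0] by simp
  moreover have "\<forall>\<^sub>\<approx>w. \<eta> * \<eta>' * w + B \<notin> Poles \<and> U (\<eta> * \<eta>' * w + B) = \<eta> * U w \<and> V (\<eta> * \<eta>' * w + B) = \<eta>' * V w"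
    using eq by eventually_elim (simp add: B)
  ultimately show ?thesis by (rule that)
qed

text \<open>
  The symmetry with \<open>\<eta> = \<eta>' = \<epsilon>\<^sup>2\<close> multiplies \<open>\<wp> = 1 / (U + V)\<close> by \<open>\<epsilon>\<close>, so its lift \<open>w \<mapsto> \<epsilon> w + B\<close> preserves the
  poles of \<open>\<wp>\<close>; these are the lattice points.
\<close>
lemma hexagonal:
  assumes \<epsilon>: "\<epsilon> ^ 3 = 1"
  shows "\<tau> \<in> L \<Longrightarrow> \<epsilon> * \<tau> \<in> L"
    and "\<forall>\<^sub>\<approx>w. U (\<epsilon> * w) = \<epsilon> ^ 2 * U w \<and> V (\<epsilon> * w) = \<epsilon> ^ 2 * V w"
proof -
  have nz: "\<epsilon> \<noteq> 0" using \<epsilon> by auto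
  have "(\<epsilon> ^ 2) ^ 3 = (\<epsilon> ^ 3) ^ 2" by (simp flip: power_mult)
  hence e2: "(\<epsilon> ^ 2) ^ 3 = 1" by (simp add: \<epsilon>)
  have "\<epsilon> ^ 2 * \<epsilon> ^ 2 = \<epsilon> ^ 3 * \<epsilon>" by (simp add: power2_eq_square power3_eq_cube)
  hence ee: "\<epsilon> ^ 2 * \<epsilon> ^ 2 = \<epsilon>" by (simp add: \<epsilon>)
  obtain B where B: "B \<in> Poles"
    "\<forall>\<^sub>\<approx>w. \<epsilon> * w + B \<notin> Poles \<and> U (\<epsilon> * w + B) = \<epsilon> ^ 2 * U w \<and> V (\<epsilon> * w + B) = \<epsilon> ^ 2 * V w"
    using fermat_symmetry[OF e2 e2] unfolding ee by blast
  have wp: "\<forall>\<^sub>\<approx>w. wp (\<epsilon> * w + B) = \<epsilon> * wp w"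
    using B(2) cosparse_not_Poles
  proof eventually_elim
    case (elim w)
    have "1 / wp (\<epsilon> * w + B) = \<epsilon> ^ 2 * (U w + V w)"
      using elim U_plus_V[of "\<epsilon> * w + B"] by (simp add: distrib_left)
    hence "1 / wp (\<epsilon> * w + B) = \<epsilon> ^ 2 * (1 / wp w)"
      using elim U_plus_V[of w] by simp
    hence "wp w = \<epsilon> ^ 2 * wp (\<epsilon> * w + B)" using elim by (simp add: notin_Poles_iff field_simps)
    hence "\<epsilon> * wp w = \<epsilon> ^ 3 * wp (\<epsilon> * w + B)" by (simp add: power2_eq_square power3_eq_cube)
    thus ?case by (simp add: \<epsilon>)
  qed
  have lat: "\<epsilon> * \<tau> + B \<in> L" if "\<tau> \<in> L" for \<tau>
  proof (rule ccontr)
    assume notin: "\<epsilon> * \<tau> + B \<notin> L"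
    have "isCont wp (\<epsilon> * \<tau> + B)" by (intro analytic_at_imp_isCont wp_analytic notin)
    moreover have "isCont (\<lambda>w. \<epsilon> * w + B) \<tau>" by (intro continuous_intros)
    ultimately have "isCont (\<lambda>w. wp (\<epsilon> * w + B)) \<tau>" by (rule isCont_o2[rotated])
    hence "((\<lambda>w. wp (\<epsilon> * w + B)) \<longlongrightarrow> wp (\<epsilon> * \<tau> + B)) (at \<tau>)" by (simp add: isCont_def)
    moreover have "filterlim (\<lambda>w. \<epsilon> * wp w) at_infinity (at \<tau>)"
      by (intro tendsto_mult_filterlim_at_infinity[OF tendsto_const nz] wp_pole that)
    moreover have "\<forall>\<^sub>F w in at \<tau>. wp (\<epsilon> * w + B) = \<epsilon> * wp w"
      using wp by (simp add: eventually_cosparse_UNIV_iff)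
    ultimately have "((\<lambda>w. wp (\<epsilon> * w + B)) \<longlongrightarrow> wp (\<epsilon> * \<tau> + B)) (at \<tau>)"
      and "filterlim (\<lambda>w. wp (\<epsilon> * w + B)) at_infinity (at \<tau>)"
      by (simp_all add: filterlim_cong)
    thus False using not_tendsto_and_filterlim_at_infinity[OF at_neq_bot] by blast
  qed
  from lat[of 0] have BL: "B \<in> L" by simp
  show "\<epsilon> * \<tau> \<in> L" if "\<tau> \<in> L"
    using lat[OF that] BL lattice_shift_iff(1) by blast
  show "\<forall>\<^sub>\<approx>w. U (\<epsilon> * w) = \<epsilon> ^ 2 * U w \<and> V (\<epsilon> * w) = \<epsilon> ^ 2 * V w"
    using B(2)
  proof eventually_elim
    case (elim w)
    hence "\<epsilon> * w + B \<notin> L" using lattice_subset_Poles by blast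
    hence "\<epsilon> * w \<notin> L" using BL lattice_shift_iff(1) by blast
    thus ?case using elim U_periodic[OF _ BL] V_periodic[OF _ BL] by auto
  qed
qed

end

locale wp_cubic_zeros = wp_cubic +
  fixes \<theta>\<^sub>1 \<theta>\<^sub>2 :: complex
  assumes theta1: "\<theta>\<^sub>1 \<notin> L" "wp \<theta>\<^sub>1 = 0" "deriv wp \<theta>\<^sub>1 = - \<i>"
    and theta2: "\<theta>\<^sub>2 \<notin> L" "wp \<theta>\<^sub>2 = 0" "deriv wp \<theta>\<^sub>2 = \<i>"
begin

text \<open>At a zero of \<open>\<wp>\<close> the derivative is \<open>\<plusminus>\<i>\<close>, so \<open>rigidity\<close> identifies the zero with \<open>\<theta>\<^sub>1\<close> or \<open>\<theta>\<^sub>2\<close>.\<close>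
lemma Poles_cases:
  assumes "w \<in> Poles"
  obtains "w \<in> L" | "w - \<theta>\<^sub>1 \<in> L" | "w - \<theta>\<^sub>2 \<in> L"
proof (cases "w \<in> L")
  case False
  hence w: "wp w = 0" using assms by (auto simp: Poles_def)
  have "deriv wp w ^ 2 = \<i> ^ 2" using ode[OF False] w by simp
  hence "deriv wp w = \<i> \<or> deriv wp w = - \<i>" unfolding power2_eq_iff .
  thus ?thesis
  proof
    assume "deriv wp w = \<i>"
    hence "w - \<theta>\<^sub>2 \<in> L" using False w theta2 by (intro rigidity) auto
    thus ?thesis by (rule that)
  next
    assume "deriv wp w = - \<i>"
    hence "w - \<theta>\<^sub>1 \<in> L" using False w theta1 by (intro rigidity) auto
    thus ?thesis by (rule that)
  qed
qed (use that in auto)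

lemma U_translate_cong:
  assumes "a - b \<in> L" "\<forall>\<^sub>\<approx>w. U (w + a) = \<eta> * U w"
  shows "\<forall>\<^sub>\<approx>w. U (w + b) = \<eta> * U w"
  using assms(2) cosparse_shift[OF cosparse_not_Poles, of b]
proof eventually_elim
  case (elim w)
  hence "U (w + b + (a - b)) = U (w + b)"
    using assms(1) lattice_subset_Poles by (intro U_periodic) auto
  thus ?case using elim by simp
qed

text \<open>
  The symmetries \<open>(u, v) \<mapsto> (\<eta> u, \<eta>\<^sup>2 v)\<close> lift to translations by poles \<open>B\<close>. The two primitive cube roots of unity \<open>\<eta>\<close>
  need two distinct nonzero classes of poles, and there are only the classes of \<open>\<theta>\<^sub>1\<close> and \<open>\<theta>\<^sub>2\<close>.
\<close>
lemma U_translate_theta: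
  assumes "\<theta> = \<theta>\<^sub>1 \<or> \<theta> = \<theta>\<^sub>2"
  shows "\<exists>\<eta>. \<eta> ^ 3 = 1 \<and> (\<forall>\<^sub>\<approx>w. U (w + \<theta>) = \<eta> * U w)"
proof -
  \<comment> \<open>A primitive cube root of unity.\<close>
  define \<omega> where "\<omega> = Complex (- 1 / 2) (sqrt 3 / 2)"
  have w2: "\<omega> ^ 2 = Complex (- 1 / 2) (- sqrt 3 / 2)"
    by (simp add: \<omega>_def power2_eq_square complex_eq_iff)
  have w3: "\<omega> ^ 3 = 1"
  proof -
    have "\<omega> ^ 3 = \<omega> * \<omega> ^ 2" by (simp add: power2_eq_square power3_eq_cube)
    also have "\<dots> = 1" unfolding w2 by (simp add: \<omega>_def complex_eq_iff)
    finally show ?thesis .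
  qed
  have "(\<omega> ^ 2) ^ 3 = (\<omega> ^ 3) ^ 2" by (simp flip: power_mult)
  hence w23: "(\<omega> ^ 2) ^ 3 = 1" by (simp add: w3)
  have w4: "\<omega> ^ 2 * \<omega> = 1" "\<omega> * \<omega> ^ 2 = 1" using w3 by (simp_all add: power2_eq_square power3_eq_cube mult.assoc)
  have ne: "\<omega> \<noteq> 1" "\<omega> ^ 2 \<noteq> 1" "\<omega> \<noteq> \<omega> ^ 2" unfolding w2 by (auto simp: \<omega>_def complex_eq_iff)
  obtain B1 where B1: "B1 \<in> Poles" "\<forall>\<^sub>\<approx>w. U (w + B1) = \<omega> * U w"
  proof (rule fermat_symmetry[OF w3 w23])
    fix B assume B: "B \<in> Poles" "\<forall>\<^sub>\<approx>w. \<omega> * \<omega> ^ 2 * w + B \<notin> Poles \<and>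
      U (\<omega> * \<omega> ^ 2 * w + B) = \<omega> * U w \<and> V (\<omega> * \<omega> ^ 2 * w + B) = \<omega> ^ 2 * V w"
    from B(2) have "\<forall>\<^sub>\<approx>w. U (w + B) = \<omega> * U w"
      unfolding w4 by eventually_elim simp
    with B(1) show thesis by (rule that)
  qed
  obtain B2 where B2: "B2 \<in> Poles" "\<forall>\<^sub>\<approx>w. U (w + B2) = \<omega> ^ 2 * U w"
  proof (rule fermat_symmetry[OF w23 w3])
    fix B assume B: "B \<in> Poles" "\<forall>\<^sub>\<approx>w. \<omega> ^ 2 * \<omega> * w + B \<notin> Poles \<and>
      U (\<omega> ^ 2 * \<omega> * w + B) = \<omega> ^ 2 * U w \<and> V (\<omega> ^ 2 * \<omega> * w + B) = \<omega> * V w"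
    from B(2) have "\<forall>\<^sub>\<approx>w. U (w + B) = \<omega> ^ 2 * U w"
      unfolding w4 by eventually_elim simp
    with B(1) show thesis by (rule that)
  qed
  have uniq: "\<eta> = \<eta>'" if "\<forall>\<^sub>\<approx>w. U (w + b) = \<eta> * U w" "\<forall>\<^sub>\<approx>w. U (w + b) = \<eta>' * U w" for b \<eta> \<eta>'
  proof -
    have "\<forall>\<^sub>\<approx>w::complex. \<eta> = \<eta>'"
      using that U_cosparse_neq[of 0] by eventually_elim auto
    thus ?thesis by simp
  qed
  have notL: "b \<notin> L" if "\<forall>\<^sub>\<approx>w. U (w + b) = \<eta> * U w" "\<eta> \<noteq> 1" for b \<eta>
  proof
    assume "b \<in> L"
    hence "\<forall>\<^sub>\<approx>w. U (w + 0) = \<eta> * U w"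
      by (intro U_translate_cong[OF _ that(1)]) auto
    moreover have "\<forall>\<^sub>\<approx>w. U (w + 0) = 1 * U w" by simp
    ultimately show False using uniq that(2) by blast
  qed
  have cls: "b - \<theta>\<^sub>1 \<in> L \<or> b - \<theta>\<^sub>2 \<in> L" if "b \<in> Poles" "b \<notin> L" for b
    using that Poles_cases by blast
  have c1: "B1 - \<theta>\<^sub>1 \<in> L \<or> B1 - \<theta>\<^sub>2 \<in> L" using cls B1 notL ne(1) by blast
  have c2: "B2 - \<theta>\<^sub>1 \<in> L \<or> B2 - \<theta>\<^sub>2 \<in> L" using cls B2 notL ne(2) by blast
  have distinct: "\<not> (B1 - t \<in> L \<and> B2 - t \<in> L)" for t
    using U_translate_cong[OF _ B1(2), of t] U_translate_cong[OF _ B2(2), of t] uniq ne(3) by blast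
  have "B1 - \<theta> \<in> L \<or> B2 - \<theta> \<in> L" using c1 c2 distinct[of \<theta>\<^sub>1] distinct[of \<theta>\<^sub>2] assms by blast
  thus ?thesis
    using U_translate_cong[OF _ B1(2), of \<theta>] U_translate_cong[OF _ B2(2), of \<theta>] w3 w23 by blast
qed

lemma U_translate_cubed:
  assumes "\<theta> = 0 \<or> \<theta> = \<theta>\<^sub>1 \<or> \<theta> = \<theta>\<^sub>2" "\<tau> \<in> L"
  shows "\<forall>\<^sub>\<approx>w. U (w + (\<theta> + \<tau>)) ^ 3 = U w ^ 3"
proof -
  have "\<exists>\<eta>. \<eta> ^ 3 = 1 \<and> (\<forall>\<^sub>\<approx>w. U (w + \<theta>) = \<eta> * U w)"
    using U_translate_theta[of \<theta>] assms(1) by (cases "\<theta> = 0") (auto intro!: exI[of _ 1])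
  then obtain \<eta> where \<eta>: "\<eta> ^ 3 = 1" "\<forall>\<^sub>\<approx>w. U (w + \<theta>) = \<eta> * U w" by blast
  have "\<forall>\<^sub>\<approx>w. U (w + (\<theta> + \<tau>)) = \<eta> * U w"
    by (rule U_translate_cong[OF _ \<eta>(2)]) (use assms(2) in auto)
  thus ?thesis by eventually_elim (simp add: power_mult_distrib \<eta>(1))
qed

text \<open>
  With \<open>\<epsilon> = - A\<close>, multiplication by \<open>A\<close> turns \<open>U\<close> into \<open>\<epsilon>\<^sup>2 V\<close>, and translation by \<open>\<theta> + \<tau>\<close> does not change \<open>U\<^sup>3\<close>.
\<close>
lemma fermat_affine:
  assumes A: "A ^ 3 = - 1" and "\<theta> = 0 \<or> \<theta> = \<theta>\<^sub>1 \<or> \<theta> = \<theta>\<^sub>2" "\<tau> \<in> L"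
  shows "\<forall>\<^sub>\<approx>w. U w ^ 3 + U (A * w + (\<theta> + \<tau>)) ^ 3 = 1"
proof -
  have nz: "A \<noteq> 0" using A by auto
  define \<epsilon> where "\<epsilon> = - A"
  have \<epsilon>: "\<epsilon> ^ 3 = 1" using A by (simp add: \<epsilon>_def)
  have "(\<epsilon> ^ 2) ^ 3 = (\<epsilon> ^ 3) ^ 2" by (simp flip: power_mult)
  hence \<epsilon>6: "(\<epsilon> ^ 2) ^ 3 = 1" by (simp add: \<epsilon>)
  have e0: "\<epsilon> \<noteq> 0" using nz by (simp add: \<epsilon>_def)
  show ?thesis
    using cosparse_linear[OF nz U_translate_cubed[OF assms(2,3)], of 0] hexagonal(2)[OF \<epsilon>] cosparse_not_Poles
      cosparse_linear[OF e0 cosparse_not_Poles, of 0]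
  proof eventually_elim
    case (elim w)
    have "\<epsilon> * w \<notin> L" using elim(4) nz lattice_subset_Poles by (auto simp: \<epsilon>_def)
    hence "U (A * w) = V (\<epsilon> * w)" using U_uminus[of "\<epsilon> * w"] by (simp add: \<epsilon>_def)
    hence "U (A * w) ^ 3 = V w ^ 3" using elim(2) \<epsilon>6 by (simp add: power_mult_distrib)
    thus ?case using elim fermat[of w] by (simp add: add.assoc)
  qed
qed

end

section \<open>Lifts with zero-free quotient\<close>

lemma poly_degree_0_const: "degree p = 0 \<Longrightarrow> poly p z = poly p w"
  by (erule degree_eq_zeroE) simp

lemma complex_poly_root:
  fixes p :: "complex poly"
  assumes "degree p > 0" obtains z where "poly p z = 0"
proof -
  have "\<exists>i\<in>{1..degree p}. coeff p i \<noteq> 0"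
    using assms by (intro bexI[of _ "degree p"]) auto
  then obtain z where "(\<Sum>i\<le>degree p. coeff p i * z ^ i) = 0"
    using fundamental_theorem_of_algebra[of "coeff p" "degree p"] by blast
  thus ?thesis using that by (simp add: poly_altdef)
qed

text \<open>The property is clear for linear factors and passes to products.\<close>
lemma poly_slowly_varying:
  fixes p :: "complex poly" and R :: real
  assumes "e > 0"
  obtains K where "\<And>z w. K \<le> norm z \<Longrightarrow> norm (w - z) \<le> R \<Longrightarrow> norm (poly p w - poly p z) \<le> e * norm (poly p z)"
  using assms
proof (induction "degree p" arbitrary: p e thesis)
  case 0
  show ?case
  proof (rule 0(2)[of 0])
    fix z w :: complex show "norm (poly p w - poly p z) \<le> e * norm (poly p z)"
      using poly_degree_0_const[of p w z] 0(1,3) by simp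
  qed
next
  case (Suc n)
  have "degree p > 0" using Suc(2) by simp
  then obtain r where "poly p r = 0" by (rule complex_poly_root)
  then obtain q where q: "p = [:- r, 1:] * q" by (auto simp: poly_eq_0_iff_dvd)
  have "q \<noteq> 0" using Suc(2) q by auto
  hence deg: "n = degree q" using Suc(2) unfolding q by (subst (asm) degree_mult_eq) auto
  \<comment> \<open>Relative errors \<open>e'\<close> of both factors give at most \<open>e' (1 + e') + e' \<le> 3 e'\<close> for the product.\<close>
  define e' where "e' = min 1 (e / 3)"
  have e': "e' > 0" "e' \<le> 1" "3 * e' \<le> e" using Suc(4) by (auto simp: e'_def)
  obtain K where K: "\<And>z w. K \<le> norm z \<Longrightarrow> norm (w - z) \<le> R \<Longrightarrow> norm (poly q w - poly q z) \<le> e' * norm (poly q z)"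
    using Suc(1)[OF deg _ e'(1)] by blast
  show ?case
  proof (rule Suc(3)[of "max K (norm r + R / e')"])
    fix z w :: complex assume z: "max K (norm r + R / e') \<le> norm z" and w: "norm (w - z) \<le> R"
    have 1: "norm (poly q w - poly q z) \<le> e' * norm (poly q z)" using K z w by auto
    have "R / e' \<le> norm (z - r)" using z norm_triangle_ineq2[of z r] by auto
    hence 2: "norm (w - z) \<le> e' * norm (z - r)" using w e'(1) by (simp add: field_simps)
    have 3: "norm (w - r) \<le> 2 * norm (z - r)"
    proof -
      have "norm (w - r) \<le> norm (w - z) + norm (z - r)" using norm_triangle_ineq[of "w - z" "z - r"] by simp
      also have "\<dots> \<le> 1 * norm (z - r) + norm (z - r)"
        using 2 e'(2) by (meson add_right_mono mult_right_mono norm_ge_zero order_trans)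
      finally show ?thesis by simp
    qed
    have "poly p w - poly p z = (w - r) * (poly q w - poly q z) + (w - z) * poly q z"
      unfolding q by (simp add: algebra_simps)
    also have "norm \<dots> \<le> norm (w - r) * norm (poly q w - poly q z) + norm (w - z) * norm (poly q z)"
      by (rule order_trans[OF norm_triangle_ineq]) (simp add: norm_mult)
    also have "\<dots> \<le> (2 * norm (z - r)) * (e' * norm (poly q z)) + (e' * norm (z - r)) * norm (poly q z)"
      using 1 2 3 e' by (intro add_mono mult_mono) auto
    also have "\<dots> = 3 * e' * norm ((z - r) * poly q z)" by (simp add: norm_mult)
    also have "(z - r) * poly q z = poly p z"
      unfolding q by (simp add: algebra_simps)
    also have "3 * e' * norm (poly p z) \<le> e * norm (poly p z)" using e' by (intro mult_right_mono) auto
    finally show "norm (poly p w - poly p z) \<le> e * norm (poly p z)" .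
  qed
qed

lemma poly_norm_lower_bound:
  fixes p :: "complex poly"
  assumes "p \<noteq> 0"
  obtains K c where "c > 0" "\<And>z. K \<le> norm z \<Longrightarrow> c \<le> norm (poly p z)"
proof (cases "degree p = 0")
  case True
  then obtain a where "p = [:a:]" using degree_eq_zeroE by blast
  thus ?thesis using assms that[of "norm a" 0] by auto
next
  case False
  hence "filterlim (poly p) at_infinity at_infinity" by (intro filterlim_poly_at_infinity) auto
  hence "\<forall>\<^sub>F z in at_infinity. 1 \<le> norm (poly p z)"
    unfolding filterlim_at_infinity[OF order_refl] by simp
  then obtain K where "\<And>z. K \<le> norm z \<Longrightarrow> 1 \<le> norm (poly p z)"
    by (auto simp: eventually_at_infinity)
  thus ?thesis using that[of 1 K] by auto
qed

lemma poly_norm_upper_bound: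
  fixes p :: "complex poly"
  obtains C where "C > 0" "\<And>z. norm (poly p z) \<le> C * (1 + norm z) ^ degree p"
proof -
  have "\<exists>C>0. \<forall>z. norm (poly p z) \<le> C * (1 + norm z) ^ degree p"
  proof (induction p)
    case 0 thus ?case by (auto intro: exI[of _ 1])
  next
    case (pCons a p)
    then obtain C where C: "C > 0" "\<And>z. norm (poly p z) \<le> C * (1 + norm z) ^ degree p" by blast
    show ?case
    proof (cases "p = 0")
      case True
      thus ?thesis by (auto intro!: exI[of _ "norm a + 1"] simp: add_nonneg_pos)
    next
      case False
      have "norm (poly (pCons a p) z) \<le> (norm a + C) * (1 + norm z) ^ degree (pCons a p)" for z
      proof -
        have "norm (poly (pCons a p) z) \<le> norm a + norm z * norm (poly p z)"
          by (simp flip: norm_mult) (rule norm_triangle_ineq)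
        also have "\<dots> \<le> norm a * (1 + norm z) ^ Suc (degree p) + (1 + norm z) * (C * (1 + norm z) ^ degree p)"
        proof (intro add_mono mult_mono C)
          have "1 \<le> (1 + norm z) ^ Suc (degree p)" by (rule one_le_power) simp
          thus "norm a \<le> norm a * (1 + norm z) ^ Suc (degree p)"
            by (simp add: mult_le_cancel_left1 del: power_Suc)
        qed auto
        also have "\<dots> = (norm a + C) * (1 + norm z) ^ degree (pCons a p)"
          using False by (simp add: algebra_simps)
        finally show ?thesis .
      qed
      thus ?thesis using C(1) by (intro exI[of _ "norm a + C"]) (auto simp: add_nonneg_pos)
    qed
  qed
  thus ?thesis using that by blast
qed

text \<open>
  Following Bloch, take \<open>z\<close> to be a maximum of \<open>\<phi>(z) (2 r - |z|)\<close> on the disc of radius \<open>2 r\<close>, and let \<open>d\<close> be half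
  the distance of \<open>z\<close> from its boundary.
\<close>
lemma select_base_point:
  fixes \<phi> :: "complex \<Rightarrow> real"
  assumes cont: "continuous_on UNIV \<phi>" and r: "r > 0" and x: "norm x \<le> r" "\<phi> x > 0"
  obtains z d where "0 < d" "d \<le> r" "\<And>w. w \<in> ball z d \<Longrightarrow> norm w \<le> 2 * r"
    "\<And>w. w \<in> ball z d \<Longrightarrow> \<phi> w \<le> 2 * \<phi> z" "r * \<phi> x \<le> 2 * (\<phi> z * d)"
proof -
  have "\<exists>z\<in>cball 0 (2 * r). \<forall>w\<in>cball 0 (2 * r). \<phi> w * (2 * r - norm w) \<le> \<phi> z * (2 * r - norm z)"
    using r by (intro continuous_attains_sup continuous_intros continuous_on_subset[OF cont]) auto
  then obtain z where z: "norm z \<le> 2 * r"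
    "\<And>w. norm w \<le> 2 * r \<Longrightarrow> \<phi> w * (2 * r - norm w) \<le> \<phi> z * (2 * r - norm z)" by auto
  define d where "d = (2 * r - norm z) / 2"
  have "r * \<phi> x \<le> \<phi> x * (2 * r - norm x)" using x by (simp add: mult.commute)
  also have "\<dots> \<le> \<phi> z * (2 * r - norm z)" using x r by (intro z(2)) auto
  finally have main: "r * \<phi> x \<le> 2 * (\<phi> z * d)" by (simp add: d_def)
  have "\<phi> z * d > 0" using main mult_pos_pos[OF r x(2)] by linarith
  moreover have "d \<ge> 0" using z(1) by (simp add: d_def)
  ultimately have d: "d > 0" "\<phi> z > 0" by (auto simp: zero_less_mult_iff)
  have ball: "d \<le> 2 * r - norm w" if "w \<in> ball z d" for w
    using that norm_triangle_ineq2[of w z] by (auto simp: d_def dist_norm norm_minus_commute)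
  show ?thesis
  proof (rule that[OF d(1)])
    show "d \<le> r" by (simp add: d_def)
    show "norm w \<le> 2 * r" if "w \<in> ball z d" for w using ball[OF that] d(1) by linarith
    show "\<phi> w \<le> 2 * \<phi> z" if "w \<in> ball z d" for w
    proof (cases "\<phi> w \<ge> 0")
      case True
      have "\<phi> w * d \<le> \<phi> w * (2 * r - norm w)" using ball[OF that] True by (intro mult_left_mono)
      also have "\<dots> \<le> \<phi> z * (2 * r - norm z)" using ball[OF that] d(1) by (intro z(2)) auto
      also have "\<dots> = 2 * \<phi> z * d" by (simp add: d_def)
      finally show ?thesis using d(1) by simp
    qed (use d in auto)
  qed (rule main)
qed

lemma norm_cube_eq_1:
  assumes "x ^ 3 = (1::complex)" shows "norm x = 1"
proof (rule power_eq_imp_eq_base)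
  show "norm x ^ 3 = 1 ^ 3" using assms by (simp flip: norm_power)
qed auto

context wp_cubic
begin

text \<open>
  The zero-free factor is written as \<open>exp \<circ> t\<close>, and both functions are compared by means of \<open>U\<close>, so that \<open>h1\<close> and \<open>h2\<close>
  can exchange their roles.
\<close>
definition proportional :: "(complex \<Rightarrow> complex) \<Rightarrow> (complex \<Rightarrow> complex) \<Rightarrow> (complex \<Rightarrow> complex) \<Rightarrow> bool" where
  "proportional h1 h2 t \<longleftrightarrow>
     h1 holomorphic_on UNIV \<and> \<not> h1 constant_on UNIV \<and>
     h2 holomorphic_on UNIV \<and> \<not> h2 constant_on UNIV \<and> t holomorphic_on UNIV \<and>
     (\<forall>\<^sub>\<approx>z. U (h1 z) = exp (t z) * U (h2 z))"

lemma proportional_sym: "proportional h1 h2 t \<Longrightarrow> proportional h2 h1 (\<lambda>z. - t z)"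
  unfolding proportional_def
  by (auto intro!: holomorphic_intros elim!: eventually_mono simp: exp_minus field_simps)

text \<open>A pole of \<open>U \<circ> h2\<close> would be a pole of \<open>U \<circ> h1\<close>, as \<open>exp t\<close> has no zeros.\<close>
lemma proportional_finite:
  assumes "proportional h1 h2 t" "h1 z \<notin> Poles"
  shows "h2 z \<notin> Poles" "\<forall>\<^sub>F w in nhds z. U (h1 w) = exp (t w) * U (h2 w)"
proof -
  have h: "h1 holomorphic_on UNIV" "\<not> h1 constant_on UNIV" "h2 holomorphic_on UNIV" "\<not> h2 constant_on UNIV"
    "t holomorphic_on UNIV" and eq: "\<forall>\<^sub>\<approx>z. U (h1 z) = exp (t z) * U (h2 z)"
    using assms(1) by (auto simp: proportional_def)
  have eqz: "\<forall>\<^sub>F w in at z. U (h1 w) = exp (t w) * U (h2 w)"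
    using eq by (simp add: eventually_cosparse_UNIV_iff)
  have "((\<lambda>w. exp (t w)) \<longlongrightarrow> exp (t z)) (at z)"
    using entire_isCont[OF h(5), of z] by (auto simp: isCont_def intro!: tendsto_intros)
  from lifts_pole[OF h(3,4,1) this _ eqz] assms(2) show *: "h2 z \<notin> Poles" by auto
  have "isCont U (h1 z)" "isCont U (h2 z)" 
    using assms(2) * by (auto intro!: analytic_at_imp_isCont U_analytic)
  hence "isCont (\<lambda>w. U (h1 w)) z" "isCont (\<lambda>w. U (h2 w)) z"
    using isCont_o2[OF entire_isCont[OF h(1)]] isCont_o2[OF entire_isCont[OF h(3)]] by auto
  hence l1: "((\<lambda>w. U (h1 w)) \<longlongrightarrow> U (h1 z)) (at z)"
    and l2: "((\<lambda>w. exp (t w) * U (h2 w)) \<longlongrightarrow> exp (t z) * U (h2 z)) (at z)"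
    using entire_isCont[OF h(5), of z] by (auto simp: isCont_def intro!: tendsto_intros)
  from Lim_transform_eventually[OF l1 eqz] have "U (h1 z) = exp (t z) * U (h2 z)" using l2 LIM_unique by blast
  thus "\<forall>\<^sub>F w in nhds z. U (h1 w) = exp (t w) * U (h2 w)"
    using eqz by (simp add: eventually_nhds_conv_at)
qed

lemma proportional_deriv:
  assumes "proportional h1 h2 t" "h1 z \<notin> Poles"
  shows "sqrt3 * V (h1 z) ^ 2 * deriv h1 z =
    exp (t z) * (deriv t z * U (h2 z) + sqrt3 * V (h2 z) ^ 2 * deriv h2 z)"
proof -
  have h: "h1 holomorphic_on UNIV" "h2 holomorphic_on UNIV" "t holomorphic_on UNIV"
    using assms(1) by (auto simp: proportional_def)
  note fin = proportional_finite[OF assms]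
  have "((\<lambda>w. U (h1 w)) has_field_derivative sqrt3 * V (h1 z) ^ 2 * deriv h1 z) (at z)"
    by (intro DERIV_chain2[OF U_has_derivative] entire_has_derivative h assms(2))
  hence d1: "((\<lambda>w. exp (t w) * U (h2 w)) has_field_derivative sqrt3 * V (h1 z) ^ 2 * deriv h1 z) (at z)"
    by (rule has_field_derivative_eventually_eq[OF _ fin(2)])
  have "((\<lambda>w. U (h2 w)) has_field_derivative sqrt3 * V (h2 z) ^ 2 * deriv h2 z) (at z)"
    by (intro DERIV_chain2[OF U_has_derivative] entire_has_derivative h fin(1))
  moreover have "((\<lambda>w. exp (t w)) has_field_derivative exp (t z) * deriv t z) (at z)"
    by (intro DERIV_chain2[OF DERIV_exp] entire_has_derivative h)
  ultimately have "((\<lambda>w. exp (t w) * U (h2 w)) has_field_derivative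
      exp (t z) * deriv t z * U (h2 z) + sqrt3 * V (h2 z) ^ 2 * deriv h2 z * exp (t z)) (at z)"
    by (intro DERIV_mult)
  from DERIV_unique[OF d1 this] show ?thesis by (simp add: algebra_simps)
qed

text \<open>At a common zero of \<open>U \<circ> h1\<close> and \<open>U \<circ> h2\<close> both values of \<open>V\<close> are cube roots of unity.\<close>
lemma proportional_at_zero:
  assumes "proportional h1 h2 t" "h1 z \<notin> Poles" "U (h1 z) = 0"
  shows "norm (deriv h1 z) = norm (exp (t z)) * norm (deriv h2 z)"
proof -
  note fin = proportional_finite[OF assms(1,2)]
  have "U (h2 z) = 0" using eventually_nhds_x_imp_x[OF fin(2)] assms(3) by simp
  moreover from this have "V (h1 z) ^ 3 = 1" "V (h2 z) ^ 3 = 1"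
    using fermat[OF assms(2)] fermat[OF fin(1)] assms(3) by simp_all
  hence "norm (V (h1 z)) = 1" "norm (V (h2 z)) = 1"
    by (blast intro: norm_cube_eq_1)+
  ultimately have "sqrt 3 * norm (deriv h1 z) = norm (exp (t z)) * (sqrt 3 * norm (deriv h2 z))"
    using arg_cong[OF proportional_deriv[OF assms(1,2)], of norm] by (simp add: norm_mult norm_power)
  thus ?thesis by simp
qed

text \<open>
  Where \<open>V \<circ> h1\<close> vanishes, so does the derivative of \<open>U \<circ> h1\<close>; hence \<open>U \<circ> h2\<close> has logarithmic derivative \<open>- t'\<close> and
  \<open>(U \<circ> h2)\<^sup>3 = exp (- 3 t)\<close>. The cube of \<open>t' U = - sqrt 3 V\<^sup>2 h2'\<close> contains only \<open>U\<^sup>3\<close> and \<open>V\<^sup>3 = 1 - U\<^sup>3\<close>.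
\<close>
lemma proportional_at_one:
  assumes "proportional h1 h2 t" "h1 z \<notin> Poles" "V (h1 z) = 0"
  shows "norm (deriv t z) ^ 3 * norm (exp (- t z)) ^ 3 =
    sqrt 3 ^ 3 * norm (deriv h2 z) ^ 3 * norm (1 - exp (- 3 * t z)) ^ 2"
proof -
  note fin = proportional_finite[OF assms(1,2)]
  have u1: "U (h1 z) ^ 3 = 1" using fermat[OF assms(2)] assms(3) by simp
  have "U (h1 z) = exp (t z) * U (h2 z)" using eventually_nhds_x_imp_x[OF fin(2)] .
  hence u2: "U (h2 z) = exp (- t z) * U (h1 z)" by (simp add: exp_minus field_simps)
  have "exp (- t z) ^ 3 = exp (- 3 * t z)"
    by (simp flip: exp_of_nat_mult)
  hence u23: "U (h2 z) ^ 3 = exp (- 3 * t z)" by (simp add: u2 power_mult_distrib u1)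
  have "deriv t z * U (h2 z) + sqrt3 * V (h2 z) ^ 2 * deriv h2 z = 0"
    using proportional_deriv[OF assms(1,2)] assms(3) by simp
  hence "deriv t z * U (h2 z) = - (sqrt3 * V (h2 z) ^ 2 * deriv h2 z)"
    by (simp add: eq_neg_iff_add_eq_0)
  from arg_cong[OF this, of norm]
  have "norm (deriv t z) * norm (U (h2 z)) = sqrt 3 * norm (V (h2 z)) ^ 2 * norm (deriv h2 z)"
    by (simp add: norm_mult norm_power)
  hence "(norm (deriv t z) * norm (U (h2 z))) ^ 3 = (sqrt 3 * norm (V (h2 z)) ^ 2 * norm (deriv h2 z)) ^ 3"
    by simp
  moreover have "(norm (V (h2 z)) ^ 2) ^ 3 = (norm (V (h2 z)) ^ 3) ^ 2"
    unfolding power_mult[symmetric] by simp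
  ultimately have "norm (deriv t z) ^ 3 * norm (U (h2 z)) ^ 3 = sqrt 3 ^ 3 * norm (deriv h2 z) ^ 3 * (norm (V (h2 z)) ^ 3) ^ 2"
    unfolding power_mult_distrib by simp
  moreover have "norm (U (h2 z)) = norm (exp (- t z))"
    using norm_cube_eq_1[OF u1] by (simp add: u2 norm_mult)
  moreover have "norm (V (h2 z)) ^ 3 = norm (1 - exp (- 3 * t z))"
    using V_power[OF fin(1)] u23 by (metis norm_power)
  ultimately show ?thesis by simp
qed

text \<open>
  At a common pole the derivatives of \<open>1 / U \<circ> h1\<close> and \<open>1 / U \<circ> h2\<close> are compared instead; there \<open>(V / U)\<^sup>3\<close>
  tends to \<open>- 1\<close>.
\<close>
lemma proportional_at_pole:
  assumes "proportional h1 h2 t" "h1 z \<in> Poles"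
  shows "norm (deriv h1 z) = norm (exp (- t z)) * norm (deriv h2 z)"
proof -
  have h: "h1 holomorphic_on UNIV" "\<not> h1 constant_on UNIV" "h2 holomorphic_on UNIV" "\<not> h2 constant_on UNIV"
    "t holomorphic_on UNIV"
    using assms(1) by (auto simp: proportional_def)
  have h2: "h2 z \<in> Poles"
    using proportional_finite[OF proportional_sym[OF assms(1)], of z] assms(2) by auto
  \<comment> \<open>The modulus of the derivative of \<open>1 / U \<circ> k\<close>, written so that its limit at a pole is visible.\<close>
  define D where "D k w = norm (deriv k w) * (sqrt 3 * (root 3 (norm (inverse (U (k w)) ^ 3 - 1))) ^ 2)" for k w
  have lim: "(D k \<longlongrightarrow> sqrt 3 * norm (deriv k z)) (at z)" 
    and inv: "((\<lambda>w. inverse (U (k w))) \<longlongrightarrow> 0) (at z)"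
    if k: "k holomorphic_on UNIV" "\<not> k constant_on UNIV" "k z \<in> Poles" for k
  proof -
    have "filterlim (\<lambda>w. U (k w)) at_infinity (at z)"
      by (rule filterlim_compose[OF U_pole[OF k(3)] entire_filterlim_at[OF k(1,2)]])
    thus inv: "((\<lambda>w. inverse (U (k w))) \<longlongrightarrow> 0) (at z)"
      by (rule filterlim_compose[OF tendsto_inverse_0])
    have "(deriv k \<longlongrightarrow> deriv k z) (at z)"
      using entire_isCont[OF holomorphic_deriv[OF k(1) open_UNIV], of z] by (simp add: isCont_def)
    hence "(D k \<longlongrightarrow> norm (deriv k z) * (sqrt 3 * (root 3 (norm (0 ^ 3 - 1 :: complex))) ^ 2)) (at z)"
      unfolding D_def by (intro tendsto_intros inv)
    thus "(D k \<longlongrightarrow> sqrt 3 * norm (deriv k z)) (at z)" by (simp add: mult.commute)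
  qed
  have Deq: "D k w = norm (sqrt3 * V (k w) ^ 2 * deriv k w / U (k w) ^ 2)"
    if "k w \<notin> Poles" "U (k w) \<noteq> 0" for k w
  proof -
    have "inverse (U (k w)) ^ 3 - 1 = (V (k w) / U (k w)) ^ 3"
      using V_power[OF that(1)] that(2) by (simp add: power_divide divide_simps)
    hence "root 3 (norm (inverse (U (k w)) ^ 3 - 1)) = norm (V (k w) / U (k w))"
      by (simp add: norm_power real_root_power_cancel)
    thus ?thesis by (simp add: D_def norm_mult norm_divide norm_power power_divide)
  qed
  define s where "s w = exp (- t w) * deriv t w * inverse (U (h2 w))" for w
  have "(s \<longlongrightarrow> exp (- t z) * deriv t z * 0) (at z)"
    unfolding s_def
    using entire_isCont[OF h(5), of z] entire_isCont[OF holomorphic_deriv[OF h(5) open_UNIV], of z]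
    by (intro tendsto_intros inv h h2) (auto simp: isCont_def)
  hence "((\<lambda>w. norm (s w)) \<longlongrightarrow> 0) (at z)" by (simp add: tendsto_norm_zero)
  moreover have "\<forall>\<^sub>F w in at z. norm (D h1 w - norm (exp (- t w)) * D h2 w) \<le> norm (s w)"
  proof -
    have "\<forall>\<^sub>F w in at z. h1 w \<notin> Poles" "\<forall>\<^sub>F w in at z. U (h1 w) \<noteq> 0" "\<forall>\<^sub>F w in at z. U (h2 w) \<noteq> 0"
      using cosparse_compose_entire[OF h(1,2) cosparse_not_Poles] cosparse_compose_entire[OF h(1,2) U_cosparse_neq]
        cosparse_compose_entire[OF h(3,4) U_cosparse_neq] unfolding eventually_cosparse_UNIV_iff by blast+
    thus ?thesis
    proof eventually_elim
      case (elim w)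
      note fin = proportional_finite[OF assms(1) elim(1)]
      have u: "U (h1 w) = exp (t w) * U (h2 w)" using eventually_nhds_x_imp_x[OF fin(2)] .
      have "sqrt3 * V (h1 w) ^ 2 * deriv h1 w / U (h1 w) ^ 2 =
          exp (t w) * (deriv t w * U (h2 w) + sqrt3 * V (h2 w) ^ 2 * deriv h2 w) / (exp (t w) * U (h2 w)) ^ 2"
        unfolding proportional_deriv[OF assms(1) elim(1)] u ..
      also have "\<dots> = s w + exp (- t w) * (sqrt3 * V (h2 w) ^ 2 * deriv h2 w / U (h2 w) ^ 2)"
        using elim(3) by (simp add: s_def exp_minus field_simps power2_eq_square)
      finally have eq: "sqrt3 * V (h1 w) ^ 2 * deriv h1 w / U (h1 w) ^ 2 =
          s w + exp (- t w) * (sqrt3 * V (h2 w) ^ 2 * deriv h2 w / U (h2 w) ^ 2)" .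
      define y where "y = exp (- t w) * (sqrt3 * V (h2 w) ^ 2 * deriv h2 w / U (h2 w) ^ 2)"
      have "D h1 w = norm (s w + y)"
        unfolding Deq[of h1 w, OF elim(1,2)] eq y_def ..
      moreover have "norm (exp (- t w)) * D h2 w = norm y"
        unfolding Deq[of h2 w, OF fin(1) elim(3)] y_def by (rule norm_mult[symmetric])
      moreover have "\<bar>norm (s w + y) - norm y\<bar> \<le> norm (s w)"
        using norm_triangle_ineq3[of "s w + y" y] by simp
      ultimately show ?case by simp
    qed
  qed
  ultimately have "((\<lambda>w. D h1 w - norm (exp (- t w)) * D h2 w) \<longlongrightarrow> 0) (at z)"
    by (rule Lim_null_comparison[rotated])
  moreover have "((\<lambda>w. D h1 w - norm (exp (- t w)) * D h2 w) \<longlongrightarrow>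
      sqrt 3 * norm (deriv h1 z) - norm (exp (- t z)) * (sqrt 3 * norm (deriv h2 z))) (at z)"
    using entire_isCont[OF h(5), of z]
    by (intro tendsto_intros lim h h2 assms(2)) (auto simp: isCont_def)
  ultimately have "sqrt 3 * norm (deriv h1 z) - norm (exp (- t z)) * (sqrt 3 * norm (deriv h2 z)) = 0"
    using LIM_unique by blast
  thus ?thesis by simp
qed

end

section \<open>Nearly linear discs\<close>

text \<open>Cauchy's estimate on circles of radius \<open>d / 4\<close> bounds the second derivative on the smaller disc.\<close>
lemma deriv_variation:
  assumes h: "h holomorphic_on UNIV" and bound: "\<And>w. w \<in> ball z d \<Longrightarrow> norm (deriv h w) \<le> B"
    and "d > 0" "s \<le> d / 2" and xy: "x \<in> ball z s" "y \<in> ball z s"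
  shows "norm (deriv h x - deriv h y) \<le> 8 * B / d * s"
proof -
  have B: "B \<ge> 0" using bound[of z] \<open>d > 0\<close> by (auto intro: order_trans[OF norm_ge_zero])
  have dh: "deriv h holomorphic_on S" for S
    using holomorphic_on_subset[OF holomorphic_deriv[OF h open_UNIV]] by blast
  have d2: "norm (deriv (deriv h) w) \<le> 4 * B / d" if "w \<in> ball z s" for w
  proof -
    have "norm ((deriv ^^ 1) (deriv h) w) \<le> fact 1 * B / (d / 4) ^ 1"
    proof (rule Cauchy_inequality)
      show "continuous_on (cball w (d / 4)) (deriv h)"
        by (intro holomorphic_on_imp_continuous_on dh)
      show "norm (deriv h v) \<le> B" if v: "norm (w - v) = d / 4" for v
      proof (rule bound)
        have "dist z v \<le> dist z w + dist w v" by (rule dist_triangle)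
        also have "\<dots> < d / 2 + d / 4"
          using \<open>w \<in> ball z s\<close> assms(4) v by (auto simp: dist_norm)
        finally show "v \<in> ball z d" using \<open>d > 0\<close> by simp
      qed
    qed (use dh \<open>d > 0\<close> in auto)
    thus ?thesis by (simp add: mult.commute)
  qed
  have "norm (deriv h x - deriv h y) \<le> 4 * B / d * norm (x - y)"
  proof (rule field_differentiable_bound[of "ball z s"])
    show "(deriv h has_field_derivative deriv (deriv h) w) (at w within ball z s)" for w
      using entire_has_derivative[OF dh] has_field_derivative_at_within by blast
  qed (use d2 xy in auto)
  also have "\<dots> \<le> 4 * B / d * (2 * s)"
  proof (intro mult_left_mono)
    have "norm (x - y) \<le> dist z x + dist z y"
      unfolding dist_norm[symmetric] by (rule dist_triangle3)
    thus "norm (x - y) \<le> 2 * s" using xy by auto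
  qed (use B \<open>d > 0\<close> in auto)
  finally show ?thesis by simp
qed

context wp_cubic
begin

text \<open>
  A disc of radius \<open>target_radius\<close> contains, from each class modulo the lattice, two points that differ by \<open>\<omega>\<^sub>1\<close>;
  \<open>bloch_radius\<close> is the corresponding radius in the source when the derivative at the centre is \<open>1\<close>.
\<close>
definition target_radius :: real where
  "target_radius = 2 * (norm \<omega>\<^sub>1 + norm \<omega>\<^sub>2) + 1"

definition bloch_radius :: real where
  "bloch_radius = target_radius / (3 - 2 * sqrt 2)"

lemma bloch_constant_pos: "3 - 2 * sqrt 2 > (0::real)"
proof -
  have "sqrt 2 < 3 / 2" by (rule real_less_lsqrt) (auto simp: power2_eq_square)
  thus ?thesis by simp
qed

lemma target_radius_pos: "target_radius > 0"
  by (simp add: target_radius_def add_nonneg_pos)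

lemma bloch_radius_pos: "bloch_radius > 0"
  using bloch_constant_pos target_radius_pos by (simp add: bloch_radius_def)

lemma target_class:
  obtains \<tau> where "\<tau> \<in> L" "x + \<tau> \<in> ball w target_radius" "x + \<tau> + \<omega>\<^sub>1 \<in> ball w target_radius"
proof -
  obtain \<tau> where \<tau>: "\<tau> \<in> L" "norm (w - x - \<tau>) \<le> norm \<omega>\<^sub>1 + norm \<omega>\<^sub>2"
    by (rule exists_lattice_near[of "w - x"])
  have "dist w (x + \<tau>) \<le> norm \<omega>\<^sub>1 + norm \<omega>\<^sub>2" using \<tau>(2) by (simp add: dist_norm algebra_simps)
  moreover have "dist w (x + \<tau> + \<omega>\<^sub>1) \<le> dist w (x + \<tau>) + norm \<omega>\<^sub>1"
    by (metis add_diff_cancel_left' dist_norm dist_triangle norm_minus_commute)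
  moreover have "norm \<omega>\<^sub>1 \<ge> 0" "norm \<omega>\<^sub>2 \<ge> 0" by auto
  ultimately have "x + \<tau> \<in> ball w target_radius" "x + \<tau> + \<omega>\<^sub>1 \<in> ball w target_radius"
    unfolding target_radius_def mem_ball by (smt (verit))+
  with \<tau>(1) show ?thesis by (rule that)
qed

text \<open>Bloch's lemma in the form in which \<open>nearly_linear\<close> and \<open>proportional_polynomial\<close> use it.\<close>
lemma hits_ball:
  assumes h: "h holomorphic_on UNIV" and s: "s > 0"
    and bound: "\<And>w. w \<in> ball z s \<Longrightarrow> norm (deriv h w) \<le> 2 * norm (deriv h z)"
    and big: "bloch_radius \<le> s * norm (deriv h z)"
    and y: "y \<in> ball (h z) target_radius"
  obtains w where "w \<in> ball z s" "h w = y"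
proof -
  have "ball (h z) ((3 - 2 * sqrt 2) * s * norm (deriv h z)) \<subseteq> h ` ball z s"
    using h s bound by (intro Bloch_lemma) (auto intro: holomorphic_on_subset)
  moreover have "target_radius = (3 - 2 * sqrt 2) * bloch_radius"
    using bloch_constant_pos by (simp add: bloch_radius_def)
  hence "target_radius \<le> (3 - 2 * sqrt 2) * s * norm (deriv h z)"
    using mult_left_mono[OF big, of "3 - 2 * sqrt 2"] bloch_constant_pos by (simp add: mult.assoc)
  ultimately have "y \<in> h ` ball z s" using y by auto
  thus ?thesis using that by blast
qed

text \<open>
  On the small disc of radius \<open>bloch_radius / m\<close> the derivatives vary by at most \<open>m / 32\<close> and \<open>|exp t|\<close> by a factor of at
  most \<open>2\<close>. A zero of \<open>U \<circ> h1\<close> bounds \<open>|exp t|\<close> from below, because \<open>|h2'|\<close> is at most \<open>2 m\<close>, and a pole bounds it from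
  above. Then the zero also shows that \<open>|h2'|\<close> is comparable with \<open>m\<close>, and \<open>proportional_at_one\<close> applies at the
  zeros of \<open>V \<circ> h1\<close>, two of which, \<open>z1\<close> and \<open>z2\<close>, have \<open>h1\<close>-values that differ by the period \<open>\<omega>\<^sub>1\<close>.
\<close>
lemma nearly_linear:
  assumes hyp: "proportional h1 h2 t" and m: "m = norm (deriv h1 z)" "m > 0" and d: "d > 0"
    and bound: "\<And>w. w \<in> ball z d \<Longrightarrow> norm (deriv h1 w) \<le> 2 * m"
      "\<And>w. w \<in> ball z d \<Longrightarrow> norm (deriv h2 w) \<le> 2 * m"
      "\<And>w. w \<in> ball z d \<Longrightarrow> norm (deriv t w) \<le> \<epsilon> * m"
    and big: "512 * bloch_radius \<le> m * d" and \<epsilon>: "4 * bloch_radius * \<epsilon> \<le> 1"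
  obtains z1 z2 where "z1 \<in> ball z (bloch_radius / m)" "z2 \<in> ball z (bloch_radius / m)"
    "norm \<omega>\<^sub>1 \<le> 2 * m * norm (z1 - z2)"
    "\<And>w. w \<in> {z1, z2} \<Longrightarrow> norm (1 - exp (- 3 * t w)) ^ 2 \<le> 2 ^ 24 * (norm (deriv t w) / m) ^ 3"
    "\<And>w. w \<in> {z1, z2} \<Longrightarrow> 1 / 8 \<le> norm (exp (- t w))"
proof -
  define s where "s = bloch_radius / m"
  have s: "s > 0" "s * m = bloch_radius" using m bloch_radius_pos by (auto simp: s_def)
  have "512 * s * m \<le> d * m" using big s(2) by (simp add: mult_ac)
  hence sd: "512 * s \<le> d" using m(2) by simp
  have ball_sub: "w \<in> ball z d" if "w \<in> ball z s" for w using that sd s(1) by auto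
  have h: "h1 holomorphic_on UNIV" "h2 holomorphic_on UNIV" "t holomorphic_on UNIV"
    using hyp by (auto simp: proportional_def)
  have var: "norm (deriv k x - deriv k y) \<le> m / 32" if "k = h1 \<or> k = h2" "x \<in> ball z s" "y \<in> ball z s" for k x y
  proof -
    have "norm (deriv k x - deriv k y) \<le> 8 * (2 * m) / d * s"
      using that h bound(1,2) d sd s by (intro deriv_variation[of k z d "2 * m" s]) auto
    also have "\<dots> = m / 32 * (512 * s / d)" by simp
    also have "\<dots> \<le> m / 32 * 1" using sd d m by (intro mult_left_mono) auto
    finally show ?thesis by simp
  qed
  have low1: "m / 2 \<le> norm (deriv h1 x)" if "x \<in> ball z s" for x
  proof -
    have "m \<le> norm (deriv h1 x) + norm (deriv h1 x - deriv h1 z)"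
      unfolding m(1) using norm_triangle_sub[of "deriv h1 z" "deriv h1 x"] by (simp add: norm_minus_commute)
    thus ?thesis using var[of h1 x z] that s(1) m(2) by auto
  qed
  have tvar: "norm (t x - t y) \<le> 1 / 2" if "x \<in> ball z s" "y \<in> ball z s" for x y
  proof -
    have "norm (t x - t y) \<le> \<epsilon> * m * norm (x - y)"
    proof (rule field_differentiable_bound[of "ball z s"])
      show "(t has_field_derivative deriv t w) (at w within ball z s)" for w
        using entire_has_derivative[OF h(3)] has_field_derivative_at_within by blast
    qed (use that ball_sub bound(3) in auto)
    also have "\<dots> \<le> \<epsilon> * m * (2 * s)"
    proof (intro mult_left_mono)
      have "norm (x - y) \<le> dist z x + dist z y"
        unfolding dist_norm[symmetric] by (rule dist_triangle3)
      thus "norm (x - y) \<le> 2 * s" using that by auto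
      show "0 \<le> \<epsilon> * m" using bound(3)[of z] d by (auto intro: order_trans[OF norm_ge_zero])
    qed
    also have "\<dots> = 2 * bloch_radius * \<epsilon>" using s(2) by (simp add: mult_ac)
    finally show ?thesis using \<epsilon> by linarith
  qed
  have evar: "norm (exp (\<sigma> * t x)) \<le> 2 * norm (exp (\<sigma> * t y))"
    if "x \<in> ball z s" "y \<in> ball z s" "\<sigma> = 1 \<or> \<sigma> = - 1" for x y \<sigma>
  proof -
    define u where "u = \<sigma> * (t x - t y)"
    have "Re u \<le> norm u" by (rule complex_Re_le_cmod)
    also have "\<dots> \<le> 1 / 2" using tvar[OF that(1,2)] that(3) by (auto simp: u_def norm_minus_commute)
    finally have "norm (exp u) \<le> exp (1 / 2)" by simp
    also have "exp (1 / 2) \<le> (2::real)"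
      using exp_bound_half[of "1 / 2 :: real"] by simp
    finally have "norm (exp u) * norm (exp (\<sigma> * t y)) \<le> 2 * norm (exp (\<sigma> * t y))"
      by (intro mult_right_mono) auto
    moreover have "exp u * exp (\<sigma> * t y) = exp (\<sigma> * t x)"
      by (simp add: u_def algebra_simps flip: exp_add)
    ultimately show ?thesis by (metis norm_mult)
  qed
  have hit: "\<exists>w\<in>ball z s. h1 w = y" if "y \<in> ball (h1 z) target_radius" for y
  proof -
    have "norm (deriv h1 w) \<le> 2 * norm (deriv h1 z)" if "w \<in> ball z s" for w
      using bound(1)[OF ball_sub[OF that]] by (simp add: m(1))
    moreover have "bloch_radius \<le> s * norm (deriv h1 z)" using s(2) by (simp add: m(1))
    ultimately show ?thesis using hits_ball[OF h(1) s(1) _ _ that] by metis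
  qed
  obtain a where a: "a \<notin> Poles" "U a = 0" "V a = 1" using fermat_surj[of 0 1] by auto
  obtain b where b: "b \<notin> Poles" "U b = 1" "V b = 0" using fermat_surj[of 1 0] by auto
  obtain \<tau>a where \<tau>a: "\<tau>a \<in> L" "a + \<tau>a \<in> ball (h1 z) target_radius" by (rule target_class)
  obtain \<tau>p where \<tau>p: "\<tau>p \<in> L" "0 + \<tau>p \<in> ball (h1 z) target_radius" by (rule target_class)
  obtain \<tau>b where \<tau>b: "\<tau>b \<in> L" "b + \<tau>b \<in> ball (h1 z) target_radius" "b + \<tau>b + \<omega>\<^sub>1 \<in> ball (h1 z) target_radius"
    by (rule target_class)
  obtain za where za: "za \<in> ball z s" "h1 za = a + \<tau>a" using hit[OF \<tau>a(2)] by blast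
  obtain zp where zp: "zp \<in> ball z s" "h1 zp = \<tau>p" using hit[OF \<tau>p(2)] by auto
  obtain z1 where z1: "z1 \<in> ball z s" "h1 z1 = b + \<tau>b" using hit[OF \<tau>b(2)] by blast
  obtain z2 where z2: "z2 \<in> ball z s" "h1 z2 = b + \<tau>b + \<omega>\<^sub>1" using hit[OF \<tau>b(3)] by blast
  have notL: "a \<notin> L" "b \<notin> L" using a b lattice_subset_Poles by auto
  have ea: "norm (deriv h1 za) = norm (exp (t za)) * norm (deriv h2 za)"
    by (rule proportional_at_zero[OF hyp]) (use za a notL \<tau>a Poles_shift U_periodic in auto)
  have ep: "norm (deriv h1 zp) = norm (exp (- t zp)) * norm (deriv h2 zp)"
    by (rule proportional_at_pole[OF hyp]) (use zp \<tau>p lattice_subset_Poles in auto)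
  have "m / 2 \<le> norm (exp (t za)) * (2 * m)"
    using low1[OF za(1)] ea bound(2)[OF ball_sub[OF za(1)]]
    by (metis mult_left_mono norm_ge_zero order_trans)
  hence "1 / 4 \<le> norm (exp (t za))" using m(2) by (simp add: field_simps)
  hence lowt: "1 / 8 \<le> norm (exp (t w))" if "w \<in> ball z s" for w
    using evar[of za w 1] that za(1) by simp
  have "m / 2 \<le> norm (exp (- t zp)) * (2 * m)"
    using low1[OF zp(1)] ep bound(2)[OF ball_sub[OF zp(1)]]
    by (metis mult_left_mono norm_ge_zero order_trans)
  hence "1 / 4 \<le> norm (exp (- t zp))" using m(2) by (simp add: field_simps)
  hence lowt': "1 / 8 \<le> norm (exp (- t w))" if "w \<in> ball z s" for w
    using evar[of zp w "-1"] that zp(1) by simp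
  have upt: "norm (exp (t w)) \<le> 8" "norm (exp (- t w)) \<le> 8" if "w \<in> ball z s" for w
  proof -
    have "norm (exp (t w)) * norm (exp (- t w)) = 1"
      by (simp flip: norm_mult exp_add)
    thus "norm (exp (t w)) \<le> 8" "norm (exp (- t w)) \<le> 8"
      using mult_left_mono[OF lowt'[OF that], of "norm (exp (t w))"]
        mult_right_mono[OF lowt[OF that], of "norm (exp (- t w))"] by auto
  qed
  have low2: "m / 32 \<le> norm (deriv h2 x)" if "x \<in> ball z s" for x
  proof -
    have "m / 2 \<le> norm (exp (t za)) * norm (deriv h2 za)" using low1[OF za(1)] ea by simp
    also have "\<dots> \<le> 8 * norm (deriv h2 za)" using upt(1)[OF za(1)] by (intro mult_right_mono) auto
    finally have "m / 16 \<le> norm (deriv h2 za)" by simp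
    moreover have "norm (deriv h2 za) \<le> norm (deriv h2 x) + norm (deriv h2 x - deriv h2 za)"
      using norm_triangle_sub[of "deriv h2 za" "deriv h2 x"] by (simp add: norm_minus_commute)
    ultimately show ?thesis using var[of h2 x za] that za(1) by auto
  qed
  have close: "norm (1 - exp (- 3 * t w)) ^ 2 \<le> 2 ^ 24 * (norm (deriv t w) / m) ^ 3"
    if w: "w \<in> ball z s" "h1 w \<notin> Poles" "V (h1 w) = 0" for w
  proof -
    define e where "e = norm (1 - exp (- 3 * t w)) ^ 2"
    have e: "e \<ge> 0" by (simp add: e_def)
    have "1 * (m / 32) ^ 3 * e \<le> sqrt 3 ^ 3 * norm (deriv h2 w) ^ 3 * e"
      using low2[OF w(1)] m(2) e by (intro mult_mono power_mono one_le_power) auto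
    also have "\<dots> = norm (deriv t w) ^ 3 * norm (exp (- t w)) ^ 3"
      unfolding e_def by (rule proportional_at_one[OF hyp w(2,3), symmetric])
    also have "\<dots> \<le> norm (deriv t w) ^ 3 * 8 ^ 3"
      using upt(2)[OF w(1)] by (intro mult_left_mono power_mono) auto
    finally have "e * m ^ 3 \<le> 2 ^ 24 * norm (deriv t w) ^ 3"
      by (simp add: power_divide mult.commute)
    thus ?thesis using m(2) by (simp add: e_def power_divide field_simps)
  qed
  show ?thesis
  proof (rule that[of z1 z2])
    show "z1 \<in> ball z (bloch_radius / m)" "z2 \<in> ball z (bloch_radius / m)"
      using z1 z2 by (auto simp: s_def)
    have "norm (h1 z1 - h1 z2) \<le> 2 * m * norm (z1 - z2)"
    proof (rule field_differentiable_bound[of "ball z s"])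
      show "(h1 has_field_derivative deriv h1 w) (at w within ball z s)" for w
        using entire_has_derivative[OF h(1)] has_field_derivative_at_within by blast
    qed (use z1 z2 ball_sub bound(1) in auto)
    thus "norm \<omega>\<^sub>1 \<le> 2 * m * norm (z1 - z2)" by (simp add: z1 z2)
    have b': "b + \<tau>b \<notin> Poles" "V (b + \<tau>b) = 0" "b + \<tau>b + \<omega>\<^sub>1 \<notin> Poles" "V (b + \<tau>b + \<omega>\<^sub>1) = 0"
      using b notL \<tau>b(1) V_periodic[of "b + \<tau>b" "\<omega>\<^sub>1"] by (auto simp: Poles_shift V_periodic lattice_shift_iff)
    show "norm (1 - exp (- 3 * t w)) ^ 2 \<le> 2 ^ 24 * (norm (deriv t w) / m) ^ 3" if "w \<in> {z1, z2}" for w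
      using that close[of z1] close[of z2] z1 z2 b' by auto
    show "1 / 8 \<le> norm (exp (- t w))" if "w \<in> {z1, z2}" for w
      using that lowt' z1 z2 by auto
  qed
qed

end

section \<open>The zero-free factor of a shift\<close>

lemma entire_polynomial_growth:
  fixes f :: "complex \<Rightarrow> complex"
  assumes f: "f holomorphic_on UNIV" and bound: "\<And>z. A \<le> norm z \<Longrightarrow> norm (f z) \<le> B * norm z ^ n"
  obtains q :: "complex poly" where "\<And>z. f z = poly q z"
proof (rule that)
  fix z
  show "f z = poly (\<Sum>k\<le>n. monom ((deriv ^^ k) f 0 / fact k) k) z"
    using Liouville_polynomial[OF f bound, where \<xi> = z] by (simp add: poly_sum poly_monom)
qed

lemma entire_nonconstant_deriv:
  assumes "h holomorphic_on UNIV" "\<not> h constant_on UNIV"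
  obtains x where "deriv h x \<noteq> 0"
proof (rule ccontr)
  assume "\<not> thesis"
  hence "deriv h x = 0" for x using that by blast
  hence "(h has_field_derivative 0) (at x)" for x
    using entire_has_derivative[OF assms(1), of x] by simp
  hence "h constant_on UNIV"
    by (intro has_field_derivative_0_imp_constant_on) auto
  thus False using assms(2) by blast
qed

context wp_cubic
begin

text \<open>
  Maximising over both derivatives at once keeps the smaller one under control. Whichever of \<open>h1\<close> and \<open>h2\<close> wins takes the
  first role in \<open>nearly_linear\<close>; if it is \<open>h2\<close>, then \<open>- t\<close> replaces \<open>t\<close>, whence the sign \<open>\<sigma>\<close>.
\<close>
lemma proportional_close_to_one:
  fixes h1 h2 t :: "complex \<Rightarrow> complex"
  defines "\<phi> \<equiv> \<lambda>z. max (norm (deriv h1 z)) (norm (deriv h2 z))"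
  assumes hyp: "proportional h1 h2 t" and r: "r > 0" and x: "norm x \<le> r" "\<phi> x > 0"
    and big: "1024 * bloch_radius \<le> r * \<phi> x"
    and tb: "\<And>w. norm w \<le> 2 * r \<Longrightarrow> norm (deriv t w) \<le> \<epsilon> * (\<phi> x / 2)"
    and \<epsilon>: "0 \<le> \<epsilon>" "4 * bloch_radius * \<epsilon> \<le> 1"
  obtains z z1 z2 m \<sigma> where "m = \<phi> z" "\<phi> x \<le> 2 * m" "\<sigma> = 1 \<or> \<sigma> = (- 1 :: complex)"
    "z1 \<in> ball z (bloch_radius / m)" "z2 \<in> ball z (bloch_radius / m)"
    "norm \<omega>\<^sub>1 \<le> 2 * m * norm (z1 - z2)"
    "\<And>w. w \<in> {z1, z2} \<Longrightarrow> norm (1 - exp (- 3 * (\<sigma> * t w))) ^ 2 \<le> 2 ^ 24 * (norm (deriv t w) / m) ^ 3"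
    "\<And>w. w \<in> {z1, z2} \<Longrightarrow> 1 / 8 \<le> norm (exp (- (\<sigma> * t w)))"
    "\<And>w. w \<in> {z1, z2} \<Longrightarrow> norm (deriv t w) \<le> \<epsilon> * m"
proof -
  have h: "h1 holomorphic_on UNIV" "h2 holomorphic_on UNIV" "t holomorphic_on UNIV"
    using hyp by (auto simp: proportional_def)
  have cont: "continuous_on UNIV \<phi>"
    unfolding \<phi>_def using h
    by (intro continuous_intros holomorphic_on_imp_continuous_on holomorphic_deriv) auto
  obtain z d where zd: "0 < d" "d \<le> r" "\<And>w. w \<in> ball z d \<Longrightarrow> norm w \<le> 2 * r"
    "\<And>w. w \<in> ball z d \<Longrightarrow> \<phi> w \<le> 2 * \<phi> z" "r * \<phi> x \<le> 2 * (\<phi> z * d)"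
    by (rule select_base_point[of \<phi> r x, OF cont r x]) (rule that)
  define m where "m = \<phi> z"
  have "0 < r * \<phi> x" using r x by simp
  hence "0 < m * d" using zd(5) by (simp add: m_def)
  hence m: "m > 0" using zd(1) by (simp add: zero_less_mult_iff)
  have "r * \<phi> x \<le> r * (2 * m)"
  proof -
    have "2 * (\<phi> z * d) \<le> 2 * (m * r)" using zd(2) m by (auto simp: m_def)
    thus ?thesis using zd(5) by (simp add: mult_ac)
  qed
  hence xm: "\<phi> x \<le> 2 * m" using r by simp
  have md: "512 * bloch_radius \<le> m * d" using big zd(5) by (simp add: m_def)
  have tb': "norm (deriv t w) \<le> \<epsilon> * m" if "w \<in> ball z d" for w
    using tb[OF zd(3)[OF that]] mult_left_mono[OF _ \<epsilon>(1), of "\<phi> x / 2" m] xm by linarith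
  have "bloch_radius / m \<le> d"
  proof -
    have "bloch_radius \<le> 512 * bloch_radius" using bloch_radius_pos by simp
    also note md
    finally show ?thesis using m by (simp add: field_simps)
  qed
  hence sub: "w \<in> ball z d" if "w \<in> ball z (bloch_radius / m)" for w using that by auto
  have hb: "norm (deriv h1 w) \<le> 2 * m" "norm (deriv h2 w) \<le> 2 * m" if "w \<in> ball z d" for w
    using zd(4)[OF that] by (auto simp: \<phi>_def m_def)
  have "m = norm (deriv h1 z) \<or> m = norm (deriv h2 z)"
    unfolding m_def \<phi>_def by linarith
  then consider "m = norm (deriv h1 z)" | "m = norm (deriv h2 z)" by blast
  thus ?thesis
  proof cases
    case 1
    obtain z1 z2 where z12: "z1 \<in> ball z (bloch_radius / m)" "z2 \<in> ball z (bloch_radius / m)"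
      "norm \<omega>\<^sub>1 \<le> 2 * m * norm (z1 - z2)"
      "\<And>w. w \<in> {z1, z2} \<Longrightarrow> norm (1 - exp (- 3 * t w)) ^ 2 \<le> 2 ^ 24 * (norm (deriv t w) / m) ^ 3"
      "\<And>w. w \<in> {z1, z2} \<Longrightarrow> 1 / 8 \<le> norm (exp (- t w))"
      using nearly_linear[OF hyp 1 m zd(1) hb tb' md \<epsilon>(2)] by blast
    show ?thesis
      by (rule that[of m z 1 z1 z2]) (use z12 xm sub tb' in \<open>auto simp: m_def\<close>)
  next
    case 2
    have dt: "deriv (\<lambda>w. - t w) w = - deriv t w" for w
      using DERIV_imp_deriv[OF DERIV_minus[OF entire_has_derivative[OF h(3), of w]]] .
    obtain z1 z2 where z12: "z1 \<in> ball z (bloch_radius / m)" "z2 \<in> ball z (bloch_radius / m)"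
      "norm \<omega>\<^sub>1 \<le> 2 * m * norm (z1 - z2)"
      "\<And>w. w \<in> {z1, z2} \<Longrightarrow> norm (1 - exp (- 3 * (- t w))) ^ 2 \<le> 2 ^ 24 * (norm (deriv (\<lambda>w. - t w) w) / m) ^ 3"
      "\<And>w. w \<in> {z1, z2} \<Longrightarrow> 1 / 8 \<le> norm (exp (- (- t w)))"
      using nearly_linear[OF proportional_sym[OF hyp] 2 m zd(1) hb(2,1) _ md \<epsilon>(2)] tb'
      unfolding dt norm_minus_cancel by blast
    show ?thesis
      by (rule that[of m z "- 1" z1 z2]) (use z12 xm sub tb' in \<open>auto simp: m_def dt\<close>)
  qed
qed

lemma proportional_constant:
  assumes hyp: "proportional h1 h2 (\<lambda>_. \<tau>)"
  shows "exp (3 * \<tau>) = 1"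
proof -
  define \<phi> where "\<phi> = (\<lambda>z. max (norm (deriv h1 z)) (norm (deriv h2 z)))"
  obtain x where "deriv h1 x \<noteq> 0"
    using entire_nonconstant_deriv[of h1] hyp by (auto simp: proportional_def)
  hence x: "\<phi> x > 0" by (auto simp: \<phi>_def less_max_iff_disj)
  define r where "r = max (norm x) (1024 * bloch_radius / \<phi> x)"
  have r1: "1024 * bloch_radius / \<phi> x \<le> r" and r2: "norm x \<le> r" by (simp_all add: r_def)
  have "1024 * bloch_radius / \<phi> x > 0" using x bloch_radius_pos by simp
  hence r3: "r > 0" using r1 by linarith
  have "1024 * bloch_radius \<le> r * \<phi> x" using r1 x by (simp only: pos_divide_le_eq)
  note r = r3 this r2
  show ?thesis
  proof (rule proportional_close_to_one[OF hyp r(1) r(3) x[unfolded \<phi>_def] r(2)[unfolded \<phi>_def], where \<epsilon> = 0])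
    fix z1 z2 :: complex and m :: real and \<sigma> :: complex
    assume \<sigma>: "\<sigma> = 1 \<or> \<sigma> = - 1" and close: "\<And>w. w \<in> {z1, z2} \<Longrightarrow>
      norm (1 - exp (- 3 * (\<sigma> * \<tau>))) ^ 2 \<le> 2 ^ 24 * (norm (deriv (\<lambda>_. \<tau>) w) / m) ^ 3"
    from close[of z1] have "exp (- 3 * (\<sigma> * \<tau>)) = 1" by simp
    with \<sigma> show "exp (3 * \<tau>) = 1" by (auto simp: exp_minus)
  qed auto
qed

text \<open>
  With \<open>y = |t'| / m\<close>, which can be made small, \<open>proportional_close_to_one\<close> yields two points at which \<open>exp (\<plusminus> 3 t)\<close>
  is at distance \<open>O(y\<^sup>3\<^sup>/\<^sup>2)\<close> from \<open>1\<close>. Since these points are at least a multiple of \<open>1 / m\<close> apart and \<open>t'\<close> varies slowly,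
  the two values differ by at least a multiple of \<open>y\<close>, which is impossible for small \<open>y\<close>.
\<close>
lemma proportional_fast_growth:
  fixes p tp :: "complex poly"
  defines "p \<equiv> pderiv tp"
  assumes hyp: "proportional h1 h2 (poly tp)" and p: "p \<noteq> 0"
    and growth: "\<And>K. \<exists>r\<ge>K. \<exists>x. norm x \<le> r \<and>
      K * (1 + 2 * r) ^ degree p \<le> max (norm (deriv h1 x)) (norm (deriv h2 x))"
  shows False
proof -
  define \<phi> where "\<phi> = (\<lambda>z. max (norm (deriv h1 z)) (norm (deriv h2 z)))"
  have h: "h1 holomorphic_on UNIV" "h2 holomorphic_on UNIV"
    using hyp by (auto simp: proportional_def)
  have dt: "deriv (poly tp) w = poly p w" for w
    unfolding p_def by (rule DERIV_imp_deriv[OF poly_DERIV])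
  define b where "b = bloch_radius"
  have b: "b > 0" using bloch_radius_pos by (simp add: b_def)
  \<comment> \<open>The first bound keeps the variation of \<open>t\<close> small; the second one is what the final comparison contradicts.\<close>
  define \<epsilon> where "\<epsilon> = min (1 / (20 * b)) (norm \<omega>\<^sub>1 ^ 2 / 2 ^ 53)"
  have \<epsilon>: "\<epsilon> > 0" "20 * b * \<epsilon> \<le> 1" "\<epsilon> \<le> norm \<omega>\<^sub>1 ^ 2 / 2 ^ 53"
  proof -
    show "\<epsilon> > 0" using b omega1_nonzero by (auto simp: \<epsilon>_def)
    have "\<epsilon> \<le> 1 / (20 * b)" by (simp add: \<epsilon>_def)
    thus "20 * b * \<epsilon> \<le> 1" using b by (simp add: field_simps)
  qed (simp add: \<epsilon>_def)
  obtain C where C: "C > 0" "\<And>z. norm (poly p z) \<le> C * (1 + norm z) ^ degree p"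
    by (rule poly_norm_upper_bound[of p]) (rule that)
  obtain K0 where K0: "\<And>z w. K0 \<le> norm z \<Longrightarrow> norm (w - z) \<le> 1 \<Longrightarrow> norm (poly p w - poly p z) \<le> 1 / 2 * norm (poly p z)"
    using poly_slowly_varying[of "1 / 2" 1 p] by auto
  obtain K0' c0 where K0': "c0 > 0" "\<And>z. K0' \<le> norm z \<Longrightarrow> c0 \<le> norm (poly p z)"
    using poly_norm_lower_bound[OF p] by metis
  define K1 where "K1 = max K0 K0'"
  have "compact (\<phi> ` cball 0 (K1 + 1))"
    unfolding \<phi>_def using h
    by (intro compact_continuous_image continuous_intros holomorphic_on_imp_continuous_on
          holomorphic_on_subset[OF holomorphic_deriv]) auto
  then obtain B0 where bdd: "\<forall>y\<in>\<phi> ` cball 0 (K1 + 1). norm y \<le> B0"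
    using compact_imp_bounded bounded_iff by blast
  have B0: "\<phi> z \<le> B0" if "norm z \<le> K1 + 1" for z
  proof -
    have "\<phi> z \<in> \<phi> ` cball 0 (K1 + 1)" using that by (intro imageI) simp
    with bdd have "norm (\<phi> z) \<le> B0" by (rule bspec)
    thus ?thesis unfolding real_norm_def by linarith
  qed
  \<comment> \<open>In this order: \<open>r \<ge> 1\<close>; smallness of \<open>t'\<close>; room for a nearly linear disc; a base point outside the disc of
    radius \<open>K1 + 1\<close>, where \<open>\<phi>\<close> is bounded by \<open>B0\<close>.\<close>
  define K where "K = max 1 (max (2 * C / \<epsilon>) (max (1024 * b) (2 * \<bar>B0\<bar> + 2)))"
  have K: "K \<ge> 1" "2 * C / \<epsilon> \<le> K" "1024 * b \<le> K" "2 * \<bar>B0\<bar> + 2 \<le> K" by (auto simp: K_def)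
  obtain r x where rx: "K \<le> r" "norm x \<le> r" "K * (1 + 2 * r) ^ degree p \<le> \<phi> x"
    using growth[of K] by (auto simp: \<phi>_def)
  have r: "r \<ge> 1" using rx K by linarith
  have pw: "1 \<le> (1 + 2 * r) ^ degree p" using r by (intro one_le_power) auto
  have "K * 1 \<le> K * (1 + 2 * r) ^ degree p" using pw K by (intro mult_left_mono) auto
  hence Kx: "K \<le> \<phi> x" using rx(3) by linarith
  have "1 * K \<le> r * \<phi> x" using r Kx K by (intro mult_mono) auto
  hence big: "1024 * bloch_radius \<le> r * \<phi> x" using K(3) by (simp add: b_def)
  have tb: "norm (deriv (poly tp) w) \<le> \<epsilon> * (\<phi> x / 2)" if "norm w \<le> 2 * r" for w
  proof -
    have "norm (deriv (poly tp) w) \<le> C * (1 + norm w) ^ degree p" unfolding dt by (rule C)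
    also have "\<dots> \<le> C * (1 + 2 * r) ^ degree p"
      using that C by (intro mult_left_mono power_mono) auto
    also have "\<dots> = \<epsilon> / 2 * (2 * C / \<epsilon> * (1 + 2 * r) ^ degree p)" using \<epsilon>(1) by simp
    also have "\<dots> \<le> \<epsilon> / 2 * \<phi> x"
    proof (intro mult_left_mono)
      have "2 * C / \<epsilon> * (1 + 2 * r) ^ degree p \<le> K * (1 + 2 * r) ^ degree p"
        using K(2) pw by (intro mult_right_mono) auto
      thus "2 * C / \<epsilon> * (1 + 2 * r) ^ degree p \<le> \<phi> x" using rx(3) by linarith
    qed (use \<epsilon>(1) in auto)
    finally show ?thesis by simp
  qed
  have r0: "r > 0" and x0: "\<phi> x > 0" and e0: "0 \<le> \<epsilon>" using r Kx K(1) \<epsilon>(1) by auto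
  have "4 * bloch_radius * \<epsilon> \<le> 20 * b * \<epsilon>" using b \<epsilon>(1) by (auto simp: b_def)
  hence e4: "4 * bloch_radius * \<epsilon> \<le> 1" using \<epsilon>(2) by linarith
  obtain z z1 z2 m \<sigma> where z0: "m = max (norm (deriv h1 z)) (norm (deriv h2 z))"
    "max (norm (deriv h1 x)) (norm (deriv h2 x)) \<le> 2 * m" "\<sigma> = 1 \<or> \<sigma> = (- 1 :: complex)"
    "z1 \<in> ball z (bloch_radius / m)" "z2 \<in> ball z (bloch_radius / m)"
    "norm \<omega>\<^sub>1 \<le> 2 * m * norm (z1 - z2)"
    "\<And>w. w \<in> {z1, z2} \<Longrightarrow> norm (1 - exp (- 3 * (\<sigma> * poly tp w))) ^ 2 \<le> 2 ^ 24 * (norm (deriv (poly tp) w) / m) ^ 3"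
    "\<And>w. w \<in> {z1, z2} \<Longrightarrow> 1 / 8 \<le> norm (exp (- (\<sigma> * poly tp w)))"
    "\<And>w. w \<in> {z1, z2} \<Longrightarrow> norm (deriv (poly tp) w) \<le> \<epsilon> * m"
    by (rule proportional_close_to_one[OF hyp r0 rx(2) x0[unfolded \<phi>_def] big[unfolded \<phi>_def] tb[unfolded \<phi>_def] e0 e4])
       (assumption, rule that)
  have z: "m = \<phi> z" "\<phi> x \<le> 2 * m" "\<sigma> = 1 \<or> \<sigma> = - 1"
    "z1 \<in> ball z (b / m)" "z2 \<in> ball z (b / m)" "norm \<omega>\<^sub>1 \<le> 2 * m * norm (z1 - z2)"
    using z0(1-6) by (simp_all only: \<phi>_def b_def)
  note z = z z0(7-9)[unfolded dt]
  have "K \<le> 2 * m" using Kx z(2) by linarith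
  hence "m \<ge> 512 * b" "m \<ge> B0 + 1" using K(3,4) by linarith+
  hence m: "m > 0" "2 * b \<le> m" "m > B0" using b by linarith+
  have bm: "b / m \<le> 1 / 2" using m(1,2) by (simp add: pos_divide_le_eq)
  have "\<not> norm z \<le> K1 + 1" using B0[of z] m(3) z(1) by linarith
  moreover have "norm z \<le> norm z1 + dist z z1" using norm_triangle_sub[of z z1] by (simp add: dist_norm)
  moreover have "dist z z1 < b / m" using z(4) by simp
  ultimately have nz1: "norm z1 \<ge> K1" using bm by linarith
  define y where "y = norm (poly p z1) / m"
  have py: "norm (poly p z1) = y * m" using m(1) by (simp add: y_def)
  have "norm (poly p z1) > 0" using K0' nz1 by (force simp: K1_def)
  hence y: "y > 0" using m(1) by (simp add: y_def)
  have "norm (poly p z1) \<le> \<epsilon> * m" by (rule z(9)) simp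
  hence ye: "y \<le> \<epsilon>" using m(1) by (simp only: y_def pos_divide_le_eq)
  note yle = order_trans[OF ye \<epsilon>(3)] ye
  have near: "norm (w - z1) \<le> 1" if "w \<in> ball z (b / m)" for w
  proof -
    have "norm (w - z1) \<le> dist z w + dist z z1" unfolding dist_norm[symmetric] by (rule dist_triangle3)
    moreover have "dist z w < b / m" "dist z z1 < b / m" using that z(4) by simp_all
    ultimately show ?thesis using bm by linarith
  qed
  have slow: "norm (poly p w - poly p z1) \<le> 1 / 2 * (y * m)" if "w \<in> ball z (b / m)" for w
    using K0[OF _ near[OF that]] nz1 py by (auto simp: K1_def)
  have y2: "norm (poly p z2) \<le> 2 * (y * m)"
    using slow[OF z(5)] norm_triangle_sub[of "poly p z2" "poly p z1"] py mult_pos_pos[OF y m(1)]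
    by linarith
  define u where "u = poly tp z1 - poly tp z2"
  define \<delta> where "\<delta> = norm (z1 - z2)"
  have "norm ((poly tp z1 - poly p z1 * z1) - (poly tp z2 - poly p z1 * z2)) \<le> 1 / 2 * (y * m) * norm (z1 - z2)"
  proof (rule field_differentiable_bound[of "ball z (b / m)" "\<lambda>w. poly tp w - poly p z1 * w" "\<lambda>w. poly p w - poly p z1"])
    show "((\<lambda>w. poly tp w - poly p z1 * w) has_field_derivative poly p w - poly p z1) (at w within ball z (b / m))" for w
      unfolding p_def by (auto intro!: derivative_eq_intros has_field_derivative_at_within[OF poly_DERIV])
  qed (use slow z in auto)
  also have "(poly tp z1 - poly p z1 * z1) - (poly tp z2 - poly p z1 * z2) = u - poly p z1 * (z1 - z2)"
    by (simp add: u_def algebra_simps)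
  finally have diff: "norm (u - poly p z1 * (z1 - z2)) \<le> 1 / 2 * (y * m * \<delta>)" by (simp add: \<delta>_def)
  have main: "norm (poly p z1 * (z1 - z2)) = y * m * \<delta>" by (simp add: norm_mult py \<delta>_def)
  have u_low: "1 / 2 * (y * m * \<delta>) \<le> norm u"
    using diff main norm_triangle_sub[of "poly p z1 * (z1 - z2)" u] by (simp add: norm_minus_commute)
  have u_up: "norm u \<le> 3 / 2 * (y * m * \<delta>)"
    using diff main norm_triangle_sub[of u "poly p z1 * (z1 - z2)"] by simp
  have "\<delta> \<le> dist z z1 + dist z z2" unfolding \<delta>_def dist_norm[symmetric] by (rule dist_triangle3)
  moreover have "dist z z1 < b / m" "dist z z2 < b / m" using z(4,5) by simp_all
  ultimately have "\<delta> \<le> 2 * (b / m)" by linarith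
  hence "m * \<delta> \<le> m * (2 * (b / m))" using m(1) by (intro mult_left_mono) auto
  also have "\<dots> = 2 * b" using m(1) by simp
  finally have "m * \<delta> \<le> 2 * b" .
  hence "y * (m * \<delta>) \<le> \<epsilon> * (2 * b)"
    by (rule mult_mono[OF ye]) (use \<epsilon>(1) m(1) in \<open>auto simp: \<delta>_def\<close>)
  hence "3 * norm u \<le> 1 / 2"
    using u_up \<epsilon>(2) by (simp add: mult_ac)
  moreover have nu: "norm (- (3 * \<sigma>) * u) = 3 * norm u" using z(3) by (auto simp: norm_mult)
  ultimately have "norm (- (3 * \<sigma>) * u) \<le> 1 / 2" by simp
  hence "1 / 2 * norm (- (3 * \<sigma>) * u) \<le> norm (exp (- (3 * \<sigma>) * u) - 1)" by (rule norm_exp_bounds(1))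
  hence e1: "3 / 4 * (y * m * \<delta>) \<le> norm (exp (- (3 * \<sigma>) * u) - 1)"
    using u_low unfolding nu by linarith
  define E where "E w = exp (- 3 * (\<sigma> * poly tp w))" for w
  have "E z1 - E z2 = E z2 * (exp (- (3 * \<sigma>) * u) - 1)"
    by (simp add: E_def u_def algebra_simps flip: exp_add)
  hence nE: "norm (E z1 - E z2) = norm (E z2) * norm (exp (- (3 * \<sigma>) * u) - 1)" by (simp add: norm_mult)
  have "(1 / 8) ^ 3 \<le> norm (exp (- (\<sigma> * poly tp z2))) ^ 3" using z(8)[of z2] by (intro power_mono) auto
  also have "\<dots> = norm (E z2)" by (simp add: E_def flip: norm_power exp_of_nat_mult)
  finally have "1 / 512 \<le> norm (E z2)" by (simp add: power_divide)
  hence "1 / 512 * (3 / 4 * (y * m * \<delta>)) \<le> norm (E z1 - E z2)"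
    unfolding nE using e1 y m(1) by (intro mult_mono) (auto simp: \<delta>_def)
  moreover have "y * (norm \<omega>\<^sub>1 / 2) \<le> y * (m * \<delta>)"
    using z(6) y by (intro mult_left_mono) (auto simp: \<delta>_def)
  ultimately have low: "3 / 4096 * (y * norm \<omega>\<^sub>1) \<le> norm (E z1 - E z2)" by (simp add: mult.assoc)
  have c1: "norm (1 - E z1) ^ 2 \<le> 2 ^ 24 * y ^ 3"
    using z(7)[of z1] by (simp add: E_def y_def)
  have "norm (poly p z2) / m \<le> 2 * y" using y2 m(1) by (simp add: field_simps)
  hence "(norm (poly p z2) / m) ^ 3 \<le> (2 * y) ^ 3" using m(1) by (intro power_mono) auto
  hence c2: "norm (1 - E z2) ^ 2 \<le> 2 ^ 27 * y ^ 3"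
    using z(7)[of z2] by (simp add: E_def power_mult_distrib)
  have "norm (E z1 - E z2) \<le> norm (1 - E z1) + norm (1 - E z2)"
    using norm_triangle_ineq4[of "1 - E z2" "1 - E z1"] by simp
  hence "norm (E z1 - E z2) ^ 2 \<le> (norm (1 - E z1) + norm (1 - E z2)) ^ 2" by (intro power_mono) auto
  also have "\<dots> \<le> 2 * norm (1 - E z1) ^ 2 + 2 * norm (1 - E z2) ^ 2"
    using sum_squares_bound[of "norm (1 - E z1)" "norm (1 - E z2)"] by (simp add: power2_sum)
  also have "\<dots> \<le> 2 ^ 29 * y ^ 3" 
  proof -
    have "2 * a + 2 * a' \<le> 2 ^ 29 * Y" if "a \<le> 2 ^ 24 * Y" "a' \<le> 2 ^ 27 * Y" "0 \<le> Y" for a a' Y :: real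
      using that by simp
    from this[OF c1 c2] y show ?thesis by simp
  qed
  finally have up: "norm (E z1 - E z2) ^ 2 \<le> 2 ^ 29 * y ^ 3" .
  have "(3 / 4096 * (y * norm \<omega>\<^sub>1)) ^ 2 \<le> norm (E z1 - E z2) ^ 2"
    using low y by (intro power_mono) auto
  also note up
  finally have "y ^ 2 * (9 * norm \<omega>\<^sub>1 ^ 2) \<le> y ^ 2 * (2 ^ 53 * y)"
    by (simp add: power_mult_distrib power_divide power2_eq_square power3_eq_cube mult_ac)
  hence "9 * norm \<omega>\<^sub>1 ^ 2 \<le> 2 ^ 53 * y" using y by simp
  also have "\<dots> \<le> norm \<omega>\<^sub>1 ^ 2" using yle(1) by simp
  finally show False using omega1_nonzero by simp
qed

text \<open>
  As \<open>H'\<close> is asymptotically constant on discs of a fixed radius, the zeros of \<open>U(H(z + c))\<close> are relatively dense far out.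
  There \<open>|exp t|\<close> is the quotient of \<open>|H'(z + c)|\<close> and \<open>|H'(z)|\<close>, hence bounded. A nonconstant \<open>t\<close> takes large positive
  values, and it is nearly constant between such a point and the next zero.
\<close>
lemma proportional_polynomial:
  fixes q tp :: "complex poly"
  assumes hyp: "proportional (\<lambda>z. H (z + c)) (\<lambda>z. - H z) (poly tp)" and H: "H holomorphic_on UNIV" "\<not> H constant_on UNIV"
    and q: "\<And>z. deriv H z = poly q z"
  shows "degree tp = 0"
proof (rule ccontr)
  assume deg: "degree tp \<noteq> 0"
  obtain x where "deriv H x \<noteq> 0" using entire_nonconstant_deriv[OF H] .
  hence q0: "q \<noteq> 0" using q by auto
  obtain Kl c0 where c0: "c0 > 0" "\<And>z. Kl \<le> norm z \<Longrightarrow> c0 \<le> norm (poly q z)"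
    using poly_norm_lower_bound[OF q0] by metis
  define R where "R = bloch_radius / c0"
  have R: "R > 0" using c0(1) bloch_radius_pos by (simp add: R_def)
  obtain K1 where K1: "\<And>z w. K1 \<le> norm z \<Longrightarrow> norm (w - z) \<le> norm c \<Longrightarrow> norm (poly q w - poly q z) \<le> 1 / 2 * norm (poly q z)"
    using poly_slowly_varying[of "1 / 2" "norm c" q] by auto
  obtain K2 where K2: "\<And>z w. K2 \<le> norm z \<Longrightarrow> norm (w - z) \<le> R \<Longrightarrow> norm (poly q w - poly q z) \<le> 1 * norm (poly q z)"
    using poly_slowly_varying[of 1 R q] by auto
  obtain K3 where K3: "\<And>z w. K3 \<le> norm z \<Longrightarrow> norm (w - z) \<le> R \<Longrightarrow> norm (poly tp w - poly tp z) \<le> 1 / 2 * norm (poly tp z)"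
    using poly_slowly_varying[of "1 / 2" R tp] by auto
  define K where "K = max (max Kl K1) (max K2 K3) + R + norm c"
  have KK: "Kl + R + norm c \<le> K" "K1 + R + norm c \<le> K" "K2 + R + norm c \<le> K" "K3 + R + norm c \<le> K"
    by (simp_all add: K_def)
  have c0le: "0 \<le> norm c" by simp
  have "compact ((\<lambda>z. norm (poly tp z)) ` cball 0 K)"
    by (intro compact_continuous_image continuous_intros) auto
  then obtain B where bdd: "\<forall>y\<in>(\<lambda>z. norm (poly tp z)) ` cball 0 K. norm y \<le> B"
    using compact_imp_bounded bounded_iff by blast
  have B: "norm (poly tp z) \<le> B" if "norm z \<le> K" for z
  proof -
    have "norm (poly tp z) \<in> (\<lambda>z. norm (poly tp z)) ` cball 0 K" using that by (intro imageI) simp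
    with bdd have "norm (norm (poly tp z)) \<le> B" by (rule bspec)
    thus ?thesis by simp
  qed
  \<comment> \<open>A value that \<open>t\<close> takes only far out, and so large that \<open>X / 2\<close> exceeds the bound for \<open>Re t\<close> at a zero.\<close>
  define X where "X = max B 3 + 1"
  have "degree (tp + [:- of_real X:]) > 0"
    using deg degree_add_eq_left[of "[:- of_real X:]" tp] by simp
  then obtain z where "poly (tp + [:- of_real X:]) z = 0" by (rule complex_poly_root)
  hence z: "poly tp z = of_real X" by simp
  have X: "X > B" "X \<ge> 4" by (auto simp: X_def)
  have "\<not> norm z \<le> K" using B[of z] X unfolding z norm_of_real by linarith
  hence nz: "norm z > K" by simp
  have hol: "(\<lambda>z. H (z + c)) holomorphic_on UNIV"
    using hyp by (simp add: proportional_def)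
  have d1: "deriv (\<lambda>z. H (z + c)) w = poly q (w + c)" for w
  proof -
    have "((\<lambda>z. H (z + c)) has_field_derivative deriv H (w + c) * 1) (at w)"
      by (rule DERIV_chain2[OF entire_has_derivative[OF H(1)]]) (auto intro!: derivative_eq_intros)
    from DERIV_imp_deriv[OF this] show ?thesis by (simp add: q)
  qed
  have d2: "deriv (\<lambda>z. - H z) w = - poly q w" for w
    using DERIV_imp_deriv[OF DERIV_minus[OF entire_has_derivative[OF H(1), of w]]] by (simp add: q)
  obtain a where a: "a \<notin> Poles" "U a = 0" using fermat_surj[of 0 1] by auto
  obtain \<tau> where \<tau>: "\<tau> \<in> L" "a + \<tau> \<in> ball (H (z + c)) target_radius" by (rule target_class)
  have nzc: "norm (z + c) \<ge> norm z - norm c" using norm_diff_ineq[of z c] by simp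
  obtain w where w: "w \<in> ball z R" "H (w + c) = a + \<tau>"
  proof (rule hits_ball[OF hol R])
    show "norm (deriv (\<lambda>z. H (z + c)) w) \<le> 2 * norm (deriv (\<lambda>z. H (z + c)) z)" if "w \<in> ball z R" for w
    proof -
      have "norm (poly q (w + c) - poly q (z + c)) \<le> 1 * norm (poly q (z + c))"
      proof (rule K2)
        show "K2 \<le> norm (z + c)" using nz nzc R KK(3) by linarith
        show "norm (w + c - (z + c)) \<le> R" using that by (simp add: dist_norm norm_minus_commute)
      qed
      thus ?thesis unfolding d1 using norm_triangle_sub[of "poly q (w + c)" "poly q (z + c)"] by simp
    qed
    have "c0 \<le> norm (poly q (z + c))" by (rule c0(2)) (use nz nzc R KK(1) in linarith)
    thus "bloch_radius \<le> R * norm (deriv (\<lambda>z. H (z + c)) z)"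
      unfolding d1 R_def using c0(1) bloch_radius_pos by (simp add: field_simps)
  qed (use \<tau> in auto)
  have notP: "H (w + c) \<notin> Poles" "U (H (w + c)) = 0"
  proof -
    have "a \<notin> L" using a(1) lattice_subset_Poles by blast
    thus "H (w + c) \<notin> Poles" "U (H (w + c)) = 0"
      unfolding w(2) using a \<tau>(1) by (simp_all add: Poles_shift U_periodic)
  qed
  have rel: "norm (poly q (w + c)) = norm (exp (poly tp w)) * norm (poly q w)"
    using proportional_at_zero[OF hyp notP] by (simp add: d1 d2)
  have "dist z w < R" using w(1) by simp
  hence nw: "norm w \<ge> norm z - R" using norm_triangle_ineq2[of z w] unfolding dist_norm by linarith
  have "norm (poly q (w + c) - poly q w) \<le> 1 / 2 * norm (poly q w)"
  proof (rule K1)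
    show "K1 \<le> norm w" using nz nw KK(2) c0le by linarith
  qed simp
  hence "norm (exp (poly tp w)) * norm (poly q w) \<le> 3 / 2 * norm (poly q w)"
    using norm_triangle_sub[of "poly q (w + c)" "poly q w"] rel by simp
  moreover have "norm (poly q w) > 0"
  proof -
    have "c0 \<le> norm (poly q w)" by (rule c0(2)) (use nz nw KK(1) c0le in linarith)
    thus ?thesis using c0(1) by linarith
  qed
  ultimately have "norm (exp (poly tp w)) \<le> 3 / 2" by simp
  hence "exp (Re (poly tp w)) \<le> 3 / 2" by simp
  hence "1 + Re (poly tp w) \<le> 3 / 2" using exp_ge_add_one_self[of "Re (poly tp w)"] by linarith
  moreover have "norm (poly tp w - poly tp z) \<le> 1 / 2 * norm (poly tp z)"
  proof (rule K3)
    show "K3 \<le> norm z" using nz R KK(4) c0le by linarith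
    show "norm (w - z) \<le> R" using w(1) by (simp add: dist_norm norm_minus_commute)
  qed
  hence "norm (of_real X - poly tp w) \<le> X / 2" using z X by (simp add: norm_minus_commute)
  hence "X - Re (poly tp w) \<le> X / 2"
    using complex_Re_le_cmod[of "of_real X - poly tp w"] by simp
  ultimately show False using X(2) by linarith
qed

text \<open>
  If \<open>t'\<close> is not zero and \<open>H'\<close> does not outgrow it, then \<open>H'\<close> is a polynomial by Liouville's theorem. So one of the two
  preceding lemmas excludes a nonconstant \<open>t\<close>, and \<open>proportional_constant\<close> evaluates a constant one.
\<close>
theorem shift_factor_trivial:
  fixes tp :: "complex poly"
  assumes H: "H holomorphic_on UNIV" "\<not> H constant_on UNIV"
    and hyp: "proportional (\<lambda>z. H (z + c)) (\<lambda>z. - H z) (poly tp)"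
  shows "degree tp = 0" "exp (3 * poly tp z) = 1"
proof -
  show deg: "degree tp = 0"
  proof (rule ccontr)
    assume deg: "degree tp \<noteq> 0"
    define p where "p = pderiv tp"
    have p: "p \<noteq> 0" using deg by (simp add: p_def pderiv_eq_0_iff)
    have "\<not> (\<forall>K. \<exists>r\<ge>K. \<exists>x. norm x \<le> r \<and> K * (1 + 2 * r) ^ degree p \<le>
        max (norm (deriv (\<lambda>z. H (z + c)) x)) (norm (deriv (\<lambda>z. - H z) x)))"
    proof
      assume "\<forall>K. \<exists>r\<ge>K. \<exists>x. norm x \<le> r \<and> K * (1 + 2 * r) ^ degree p \<le>
        max (norm (deriv (\<lambda>z. H (z + c)) x)) (norm (deriv (\<lambda>z. - H z) x))"
      thus False
        by (intro proportional_fast_growth[OF hyp p[unfolded p_def]]) (simp only: p_def)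
    qed
    then obtain K where K0: "\<not> (\<exists>r\<ge>K. \<exists>x. norm x \<le> r \<and> K * (1 + 2 * r) ^ degree p \<le>
        max (norm (deriv (\<lambda>z. H (z + c)) x)) (norm (deriv (\<lambda>z. - H z) x)))" by blast
    have K: "norm (deriv (\<lambda>z. - H z) x) < K * (1 + 2 * r) ^ degree p" if "r \<ge> K" "norm x \<le> r" for r x
    proof -
      have "\<not> K * (1 + 2 * r) ^ degree p \<le> max (norm (deriv (\<lambda>z. H (z + c)) x)) (norm (deriv (\<lambda>z. - H z) x))"
        using K0 that by blast
      thus ?thesis by linarith
    qed
    have d2: "deriv (\<lambda>z. - H z) w = - deriv H w" for w
      using DERIV_imp_deriv[OF DERIV_minus[OF entire_has_derivative[OF H(1), of w]]] .
    have bound: "norm (deriv H z) \<le> (\<bar>K\<bar> * 3 ^ degree p) * norm z ^ degree p" if z: "max 1 K \<le> norm z" for z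
    proof -
      have "norm (deriv (\<lambda>z. - H z) z) < K * (1 + 2 * norm z) ^ degree p"
        by (rule K) (use z in auto)
      hence "norm (deriv H z) \<le> K * (1 + 2 * norm z) ^ degree p"
        unfolding d2 by simp
      also have "\<dots> \<le> \<bar>K\<bar> * (3 * norm z) ^ degree p"
        using z by (intro mult_mono power_mono) auto
      finally show ?thesis by (simp add: power_mult_distrib)
    qed
    obtain q where q: "\<And>z. deriv H z = poly q z"
      by (rule entire_polynomial_growth[OF holomorphic_deriv[OF H(1) open_UNIV] bound])
         (assumption, rule that)
    have "degree tp = 0" by (rule proportional_polynomial[OF hyp H q])
    with deg show False by simp
  qed
  define \<tau> where "\<tau> = poly tp z"
  have "poly tp w = \<tau>" for w unfolding \<tau>_def by (rule poly_degree_0_const[OF deg])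
  hence "poly tp = (\<lambda>_. \<tau>)" by (rule ext)
  with hyp have "proportional (\<lambda>z. H (z + c)) (\<lambda>z. - H z) (\<lambda>_. \<tau>)" by simp
  thus "exp (3 * poly tp z) = 1" unfolding \<tau>_def[symmetric] by (rule proportional_constant)
qed

end

section \<open>Solutions of the equation\<close>

lemma exp_third_cubed: "exp (x / 3) ^ 3 = exp x" for x :: complex
  by (simp flip: exp_of_nat_mult)

lemma poly_entire: "poly p holomorphic_on S" for p :: "complex poly"
  unfolding holomorphic_on_def field_differentiable_def
  using poly_DERIV has_field_derivative_at_within by blast

lemma nicely_meromorphic_eq_entire:
  assumes f: "f nicely_meromorphic_on UNIV" and g: "g holomorphic_on UNIV" and eq: "\<forall>\<^sub>\<approx>z. f z = g z"
  shows "f z = g z"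
proof -
  have "\<forall>\<^sub>F w in at z. f w = g w"
    using eq by (simp add: eventually_cosparse_UNIV_iff)
  hence ev: "\<forall>\<^sub>F w in at z. g w = f w" by eventually_elim simp
  have "g \<midarrow>z\<rightarrow> g z" using entire_isCont[OF g] by (simp add: isCont_def)
  from Lim_transform_eventually[OF this ev] have lim: "f \<midarrow>z\<rightarrow> g z" .
  hence "\<not> is_pole f z"
    unfolding is_pole_def using not_tendsto_and_filterlim_at_infinity[OF at_neq_bot] by blast
  hence "f \<midarrow>z\<rightarrow> f z" using f by (auto simp: nicely_meromorphic_on_def)
  thus ?thesis using lim by (rule LIM_unique)
qed

text \<open>The derivative of \<open>P\<close> has the period \<open>c\<close>, and a periodic polynomial is constant.\<close>
lemma poly_shift_difference_constant:
  fixes P :: "complex poly"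
  assumes "c \<noteq> 0" and const: "pderiv (pcompose P [:c, 1:] - P) = 0"
  obtains \<alpha> \<beta> where "P = [:\<beta>, \<alpha>:]"
proof -
  define p where "p = pderiv P"
  have "pderiv (pcompose P [:c, 1:] - P) = pcompose p [:c, 1:] - p"
    by (simp add: pderiv_diff pderiv_pcompose p_def pderiv_pCons)
  hence "pcompose p [:c, 1:] = p" using const by simp
  hence per: "poly p (z + c) = poly p z" for z
    using poly_pcompose[of p "[:c, 1:]" z] by (simp add: add.commute)
  have "poly p (of_nat n * c) = poly p 0" for n
  proof (induction n)
    case (Suc n)
    thus ?case using per[of "of_nat n * c"] by (simp add: algebra_simps)
  qed simp
  hence "range (\<lambda>n::nat. of_nat n * c) \<subseteq> {z. poly (p - [:poly p 0:]) z = 0}" by auto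
  moreover have "infinite (range (\<lambda>n::nat. of_nat n * c))"
    using assms(1) by (intro range_inj_infinite) (auto simp: inj_on_def)
  ultimately have "p - [:poly p 0:] = 0"
    using poly_roots_finite finite_subset by blast
  hence p: "p = [:poly p 0:]" by simp
  hence "degree p = 0" by (metis degree_pCons_0)
  hence "degree P \<le> 1" by (simp add: p_def degree_pderiv)
  hence "P = [:coeff P 0, coeff P 1:]"
    by (intro poly_eqI) (auto simp: coeff_pCons coeff_eq_0 split: nat.splits)
  thus ?thesis by (rule that)
qed

lemma exp_poly_constant:
  assumes "\<And>z. exp (poly Q z) = (k :: complex)" shows "pderiv Q = 0"
proof (rule poly_eq_poly_eq_iff[THEN iffD1], rule ext)
  fix z
  have "((\<lambda>z. exp (poly Q z)) has_field_derivative exp (poly Q z) * poly (pderiv Q) z) (at z)"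
    by (intro DERIV_chain2[OF DERIV_exp] poly_DERIV)
  hence "((\<lambda>z. k) has_field_derivative exp (poly Q z) * poly (pderiv Q) z) (at z)"
    by (simp only: assms)
  from DERIV_unique[OF this DERIV_const] show "poly (pderiv Q) z = poly 0 z" by simp
qed

text \<open>
  Inserting \<open>f = d exp (P / 3)\<close> into the equation shows that \<open>exp (P(z + c) - P(z))\<close> is constant, so that \<open>P\<close> is linear.
\<close>
lemma exponential_solution:
  fixes f :: "complex \<Rightarrow> complex" and P :: "complex poly"
  assumes f: "f nicely_meromorphic_on UNIV" "\<not> f constant_on UNIV" and "c \<noteq> 0"
    and eq: "\<forall>\<^sub>\<approx>z. f z ^ 3 + f (z + c) ^ 3 = exp (poly P z)"
    and d: "\<forall>\<^sub>\<approx>z. f z * exp (- poly P z / 3) = d"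
  obtains \<alpha> \<beta> where "P = [:\<beta>, \<alpha>:]" "d \<noteq> 0" "d ^ 3 * (1 + exp (\<alpha> * c)) = 1"
    "\<And>z. f z = d * exp ((\<alpha> * z + \<beta>) / 3)"
proof -
  have "\<forall>\<^sub>\<approx>z. f z = d * exp (poly P z / 3)"
    using d by eventually_elim (auto simp: exp_minus field_simps)
  hence fz: "f z = d * exp (poly P z / 3)" for z
    by (intro nicely_meromorphic_eq_entire[OF f(1), where g = "\<lambda>z. d * exp (poly P z / 3)"] holomorphic_intros) auto
  have d0: "d \<noteq> 0"
  proof
    assume "d = 0"
    hence "f constant_on UNIV" using fz by (auto simp: constant_on_def)
    thus False using f(2) by blast
  qed
  have "d ^ 3 * exp (poly P z) + d ^ 3 * exp (poly P (z + c)) = exp (poly P z)" for z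
  proof (rule entire_eq_if_cosparse[where f = "\<lambda>z. d ^ 3 * exp (poly P z) + d ^ 3 * exp (poly P (z + c))"
        and g = "\<lambda>z. exp (poly P z)"])
    show "\<forall>\<^sub>\<approx>z. d ^ 3 * exp (poly P z) + d ^ 3 * exp (poly P (z + c)) = exp (poly P z)"
      using eq by eventually_elim (simp add: fz power_mult_distrib exp_third_cubed)
  qed (intro holomorphic_intros; simp)+
  hence rel: "d ^ 3 * (1 + exp (poly P (z + c) - poly P z)) = 1" for z
  proof -
    assume *: "\<And>z. d ^ 3 * exp (poly P z) + d ^ 3 * exp (poly P (z + c)) = exp (poly P z)"
    have "d ^ 3 * (1 + exp (poly P (z + c) - poly P z)) * exp (poly P z) =
        d ^ 3 * exp (poly P z) + d ^ 3 * exp (poly P (z + c))"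
      by (simp add: exp_diff field_simps)
    thus ?thesis unfolding * by simp
  qed
  have "exp (poly (pcompose P [:c, 1:] - P) z) = 1 / d ^ 3 - 1" for z
    using rel[of z] d0 by (simp add: poly_pcompose add.commute field_simps)
  hence "pderiv (pcompose P [:c, 1:] - P) = 0" by (rule exp_poly_constant)
  then obtain \<alpha> \<beta> where P: "P = [:\<beta>, \<alpha>:]" using poly_shift_difference_constant[OF \<open>c \<noteq> 0\<close>] by blast
  show ?thesis
  proof (rule that[OF P d0])
    show "d ^ 3 * (1 + exp (\<alpha> * c)) = 1" using rel[of 0] by (simp add: P mult.commute)
    show "f z = d * exp ((\<alpha> * z + \<beta>) / 3)" for z
      using fz[of z] by (simp add: P algebra_simps)
  qed
qed

context wp_cubic_zeros
begin

text \<open>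
  The lift \<open>h\<close> of \<open>(F, G)\<close> is compared with its shift by \<open>shift_factor_trivial\<close>, which makes \<open>exp t\<close> a cube root of unity
  \<open>\<eta>\<close>. Then \<open>V(h(z + c)) / V(- h(z))\<close> has a constant cube as well, so it is a constant \<open>\<eta>'\<close>, and \<open>lifts_affine\<close> gives the
  shift relation. Its constant term is located at a point where \<open>h\<close> meets the lattice.
\<close>
lemma elliptic_solution:
  fixes f :: "complex \<Rightarrow> complex" and P :: "complex poly"
  assumes f: "f meromorphic_on UNIV" and "c \<noteq> 0"
    and eq: "\<forall>\<^sub>\<approx>z. f z ^ 3 + f (z + c) ^ 3 = exp (poly P z)"
    and nonconst: "\<nexists>d. \<forall>\<^sub>\<approx>z. f z * exp (- poly P z / 3) = d"
  obtains \<alpha> \<beta> h A \<theta> \<tau> where "P = [:\<beta>, \<alpha>:]" "exp (\<alpha> * c) = 1"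
    "h holomorphic_on UNIV" "\<not> h constant_on UNIV" "A ^ 3 = - 1" "\<And>\<tau>. \<tau> \<in> L \<Longrightarrow> A * \<tau> \<in> L"
    "\<theta> = \<theta>\<^sub>1 \<or> \<theta> = \<theta>\<^sub>2 \<or> \<theta> = 0" "\<tau> \<in> L" "\<And>z. h (z + c) = A * h z + \<theta> + \<tau>"
    "\<forall>\<^sub>\<approx>z. f z = exp (poly P z / 3) * U (h z)"
proof -
  have shift_an: "(\<lambda>z. z + c) analytic_on UNIV" by (intro analytic_intros)
  have exp_mero: "(\<lambda>z. exp (- poly P z / 3)) meromorphic_on UNIV"
    by (intro analytic_on_imp_meromorphic_on, subst analytic_on_open)
       (auto intro!: holomorphic_intros poly_entire)
  have fc: "(\<lambda>z. f (z + c)) meromorphic_on UNIV"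
    by (rule meromorphic_on_compose[OF f shift_an]) simp
  obtain h where h: "h holomorphic_on UNIV" "\<not> h constant_on UNIV"
    and hFG: "\<forall>\<^sub>\<approx>z. h z \<notin> Poles \<and> f z * exp (- poly P z / 3) = U (h z) \<and>
      f (z + c) * exp (- poly P z / 3) = V (h z)"
  proof (rule fermat_lift[where F = "\<lambda>z. f z * exp (- poly P z / 3)" and G = "\<lambda>z. f (z + c) * exp (- poly P z / 3)"])
    show "(\<lambda>z. f z * exp (- poly P z / 3)) meromorphic_on UNIV"
      "(\<lambda>z. f (z + c) * exp (- poly P z / 3)) meromorphic_on UNIV"
      by (intro meromorphic_on_mult f fc exp_mero)+
    show "\<forall>\<^sub>\<approx>z. (f z * exp (- poly P z / 3)) ^ 3 + (f (z + c) * exp (- poly P z / 3)) ^ 3 = 1"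
      using eq
    proof eventually_elim
      case (elim z)
      have "(f z * exp (- poly P z / 3)) ^ 3 + (f (z + c) * exp (- poly P z / 3)) ^ 3 =
          (f z ^ 3 + f (z + c) ^ 3) * exp (- poly P z / 3) ^ 3"
        by (simp only: power_mult_distrib distrib_right)
      also have "\<dots> = exp (poly P z) * exp (- poly P z)" unfolding elim exp_third_cubed ..
      finally show ?case by (simp flip: exp_add)
    qed
  qed (rule nonconst, rule that)
  define tp where "tp = smult (1 / 3) (P - pcompose P [:c, 1:])"
  have tp: "poly tp z = (poly P z - poly P (z + c)) / 3" for z
    by (simp add: tp_def poly_pcompose add.commute)
  define k where "k z = h (z + c)" for z
  have k: "k holomorphic_on UNIV"
  proof -
    have "(\<lambda>z. z + c) holomorphic_on UNIV" by (intro holomorphic_intros)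
    from holomorphic_on_compose[OF this holomorphic_on_subset[OF h(1)]]
    show ?thesis by (simp add: k_def[abs_def] o_def)
  qed
  have k_nonconst: "\<not> k constant_on UNIV"
  proof
    assume "k constant_on UNIV"
    then obtain b where b: "\<And>z. h (z + c) = b" by (auto simp: constant_on_def k_def)
    have "h z = b" for z using b[of "z - c"] by simp
    thus False using h(2) by (auto simp: constant_on_def)
  qed
  have mh: "(\<lambda>z. - h z) holomorphic_on UNIV" by (intro holomorphic_intros h)
  have mh_nonconst: "\<not> (\<lambda>z. - h z) constant_on UNIV"
  proof
    assume "(\<lambda>z. - h z) constant_on UNIV"
    then obtain b where "\<And>z. - h z = b" by (auto simp: constant_on_def)
    hence "h z = - b" for z by (metis minus_minus)
    thus False using h(2) by (auto simp: constant_on_def)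
  qed
  have rel: "\<forall>\<^sub>\<approx>z. k z \<notin> Poles \<and> - h z \<notin> Poles \<and> U (k z) = exp (poly tp z) * U (- h z)"
    using hFG cosparse_shift[OF hFG, of c]
  proof eventually_elim
    case (elim z)
    have hz: "h z \<notin> L" using elim(1) lattice_subset_Poles by blast
    have "U (k z) = f (z + c) * exp (- poly P (z + c) / 3)" using elim(2) by (simp add: k_def)
    also have "exp (- poly P (z + c) / 3) = exp (poly tp z) * exp (- poly P z / 3)"
      by (simp add: tp diff_divide_distrib flip: exp_add)
    also have "f (z + c) * (exp (poly tp z) * exp (- poly P z / 3)) = exp (poly tp z) * V (h z)"
      using elim(1) by (simp add: mult_ac)
    also have "V (h z) = U (- h z)" using U_uminus[OF hz] by simp
    finally show ?case using elim by (simp add: k_def)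
  qed
  have prop': "proportional (\<lambda>z. h (z + c)) (\<lambda>z. - h z) (poly tp)"
    unfolding proportional_def
  proof (intro conjI poly_entire k[unfolded k_def] k_nonconst[unfolded k_def] mh mh_nonconst)
    show "\<forall>\<^sub>\<approx>z. U (h (z + c)) = exp (poly tp z) * U (- h z)"
      using rel unfolding k_def by eventually_elim blast
  qed
  note trivial = shift_factor_trivial[OF h prop']
  have "smult (- 3) tp = pcompose P [:c, 1:] - P" by (simp add: tp_def smult_diff_right)
  hence "pderiv (pcompose P [:c, 1:] - P) = smult (- 3) (pderiv tp)" by (metis pderiv_smult)
  moreover have "pderiv tp = 0" using trivial(1) by (simp add: pderiv_eq_0_iff)
  ultimately have "pderiv (pcompose P [:c, 1:] - P) = 0" by simp
  then obtain \<alpha> \<beta> where P: "P = [:\<beta>, \<alpha>:]" using poly_shift_difference_constant[OF \<open>c \<noteq> 0\<close>] by blast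
  have tp0: "poly tp z = - (\<alpha> * c) / 3" for z by (simp add: tp P algebra_simps)
  have "exp (- (\<alpha> * c)) = 1" using trivial(2)[of 0] by (simp add: tp0)
  hence \<alpha>: "exp (\<alpha> * c) = 1" by (simp add: exp_minus)
  define \<eta> where "\<eta> = exp (- (\<alpha> * c) / 3)"
  have \<eta>: "\<eta> ^ 3 = 1" unfolding \<eta>_def exp_third_cubed by fact
  have "\<forall>\<^sub>\<approx>z. (V (k z) / V (- h z)) ^ 3 = 1"
    using rel cosparse_compose_entire[OF mh mh_nonconst V_cosparse_neq[of 0]]
  proof eventually_elim
    case (elim z)
    have "V (k z) ^ 3 = V (- h z) ^ 3"
      using elim(1) \<eta> by (simp add: V_power power_mult_distrib tp0 \<eta>_def)
    thus ?case using elim(2) by (simp add: power_divide)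
  qed
  then obtain \<eta>' where \<eta>'_eq: "\<forall>\<^sub>\<approx>z. V (k z) / V (- h z) = \<eta>'"
    by (rule meromorphic_power_constant[rotated])
       (simp, rule that, assumption, intro meromorphic_intros UV_compose_meromorphic k mh)
  have "\<forall>\<^sub>\<approx>z::complex. \<eta>' ^ 3 = 1"
    using \<eta>'_eq \<open>\<forall>\<^sub>\<approx>z. (V (k z) / V (- h z)) ^ 3 = 1\<close> by eventually_elim auto
  hence \<eta>': "\<eta>' ^ 3 = 1" by simp
  have lifts: "\<forall>\<^sub>\<approx>z. - h z \<notin> Poles \<and> k z \<notin> Poles \<and> U (k z) = \<eta> * U (- h z) \<and> V (k z) = \<eta>' * V (- h z)"
    using rel \<eta>'_eq cosparse_compose_entire[OF mh mh_nonconst V_cosparse_neq[of 0]]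
    by eventually_elim (auto simp: tp0 \<eta>_def)
  obtain B where B: "\<And>z. k z = \<eta> * \<eta>' * - h z + B"
    by (rule lifts_affine[OF mh mh_nonconst k \<eta> \<eta>' lifts]) (rule that)
  define A where "A = - (\<eta> * \<eta>')"
  have kA: "k z = A * h z + B" for z by (simp add: B A_def)
  have A3: "A ^ 3 = - 1" using \<eta> \<eta>' by (simp add: A_def power_mult_distrib)
  have "(\<eta> * \<eta>') ^ 3 = 1" using \<eta> \<eta>' by (simp add: power_mult_distrib)
  from hexagonal(1)[OF this] have AL: "A * \<tau> \<in> L" if "\<tau> \<in> L" for \<tau>
    using that by (simp add: A_def)
  have "\<exists>z. h z \<in> L"
  proof (rule ccontr)
    assume no: "\<nexists>z. h z \<in> L"
    have "h z \<noteq> 0 \<and> h z \<noteq> \<omega>\<^sub>1" for z using no lattice_0 omega_in_lattice(1) by metis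
    hence "range h \<inter> {0, \<omega>\<^sub>1} = {}" by auto
    then obtain b where "h = (\<lambda>x. b)"
      using little_Picard[OF h(1) omega1_nonzero[symmetric]] by blast
    thus False using h(2) by (auto simp: constant_on_def)
  qed
  then obtain z0 where z0: "h z0 \<in> L" by blast
  have "k z0 \<in> Poles"
  proof (rule lifts_pole[OF mh mh_nonconst k tendsto_const])
    show "\<forall>\<^sub>F w in at z0. U (k w) = \<eta> * U (- h w)"
    proof -
      have "\<forall>\<^sub>\<approx>w. U (k w) = \<eta> * U (- h w)" using lifts by eventually_elim blast
      thus ?thesis by (simp add: eventually_cosparse_UNIV_iff)
    qed
  qed (use z0 lattice_subset_Poles in \<open>auto simp: \<eta>_def\<close>)
  hence "B + A * h z0 \<in> Poles" by (simp add: kA add.commute)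
  hence "B \<in> Poles" using AL[OF z0] Poles_shift by blast
  then obtain \<theta> where \<theta>: "\<theta> = \<theta>\<^sub>1 \<or> \<theta> = \<theta>\<^sub>2 \<or> \<theta> = 0" "B - \<theta> \<in> L"
    by (cases rule: Poles_cases) auto
  show ?thesis
  proof (rule that[OF P \<alpha> h A3 AL \<theta>])
    show "h (z + c) = A * h z + \<theta> + (B - \<theta>)" for z using kA[of z] by (simp add: k_def)
    show "\<forall>\<^sub>\<approx>z. f z = exp (poly P z / 3) * U (h z)"
      using hFG
    proof eventually_elim
      case (elim z)
      hence "exp (poly P z / 3) * U (h z) = exp (poly P z / 3) * (f z * exp (- poly P z / 3))" by simp
      also have "\<dots> = f z * (exp (poly P z / 3) * exp (- poly P z / 3))" by simp
      finally show ?case by (simp flip: exp_add)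
    qed
  qed
qed

lemma elliptic_solution_converse:
  fixes f :: "complex \<Rightarrow> complex"
  assumes h: "h holomorphic_on UNIV" "\<not> h constant_on UNIV" and A: "A ^ 3 = - 1"
    and \<alpha>: "exp (\<alpha> * c) = 1" and f: "\<forall>\<^sub>\<approx>z. f z = exp ((\<alpha> * z + \<beta>) / 3) * U (h z)"
    and \<theta>: "\<theta> = \<theta>\<^sub>1 \<or> \<theta> = \<theta>\<^sub>2 \<or> \<theta> = 0" "\<tau> \<in> L"
    and shift: "\<And>z. h (z + c) = A * h z + \<theta> + \<tau>"
  shows "\<forall>\<^sub>\<approx>z. f z ^ 3 + f (z + c) ^ 3 = exp (\<alpha> * z + \<beta>)"
proof -
  have "\<theta> = 0 \<or> \<theta> = \<theta>\<^sub>1 \<or> \<theta> = \<theta>\<^sub>2" using \<theta>(1) by blast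
  from f cosparse_shift[OF f, of c] cosparse_compose_entire[OF h fermat_affine[OF A this \<theta>(2)]]
  show ?thesis
  proof eventually_elim
    case (elim z)
    have f1: "f z ^ 3 = exp (\<alpha> * z + \<beta>) * U (h z) ^ 3"
      unfolding elim(1) power_mult_distrib exp_third_cubed ..
    have "\<alpha> * (z + c) + \<beta> = \<alpha> * c + (\<alpha> * z + \<beta>)" by (simp add: algebra_simps)
    hence "exp (\<alpha> * (z + c) + \<beta>) = exp (\<alpha> * z + \<beta>)" by (simp only: exp_add \<alpha> mult_1_left)
    hence f2: "f (z + c) ^ 3 = exp (\<alpha> * z + \<beta>) * U (h (z + c)) ^ 3"
      unfolding elim(2) power_mult_distrib exp_third_cubed by simp
    have "U (h z) ^ 3 + U (h (z + c)) ^ 3 = 1"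
      using elim(3) unfolding shift by (simp add: add.assoc)
    thus ?case unfolding f1 f2 by (simp flip: distrib_left)
  qed
qed

end

theorem theorem2:
  fixes c \<omega>\<^sub>1 \<omega>\<^sub>2 \<theta>\<^sub>1 \<theta>\<^sub>2 :: complex
    and f :: "complex \<Rightarrow> complex" and P :: "complex poly"
    and wp :: "complex \<Rightarrow> complex" and L D :: "complex set"
  defines "wp \<equiv> weierstrass_p \<omega>\<^sub>1 \<omega>\<^sub>2"
    and "L \<equiv> period_lattice \<omega>\<^sub>1 \<omega>\<^sub>2"
    and "D \<equiv> period_parallelogram \<omega>\<^sub>1 \<omega>\<^sub>2"
  assumes "Im (\<omega>\<^sub>1 / \<omega>\<^sub>2) \<noteq> 0"
    and "\<And>z. z \<notin> L \<Longrightarrow> deriv wp z ^ 2 = 4 * wp z ^ 3 - 1"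
    and "\<theta>\<^sub>1 \<in> D - L" and "wp \<theta>\<^sub>1 = 0" and "deriv wp \<theta>\<^sub>1 = - \<i>"
    and "\<theta>\<^sub>2 \<in> D - L" and "wp \<theta>\<^sub>2 = 0" and "deriv wp \<theta>\<^sub>2 = \<i>"
    and "c \<noteq> 0"
    and "f nicely_meromorphic_on UNIV" and "\<not> f constant_on UNIV"
  shows "(\<forall>\<^sub>\<approx>z. f z ^ 3 + f (z + c) ^ 3 = exp (poly P z)) \<longleftrightarrow>
    (\<exists>\<alpha> \<beta>. (\<forall>z. poly P z = \<alpha> * z + \<beta>) \<and>
      ((\<exists>d. d \<noteq> 0 \<and> d ^ 3 * (1 + exp (\<alpha> * c)) = 1 \<and>
            (\<forall>z. f z = d * exp ((\<alpha> * z + \<beta>) / 3))) \<or>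
       (exp (\<alpha> * c) = 1 \<and>
        (\<exists>h A. h holomorphic_on UNIV \<and> \<not> h constant_on UNIV \<and>
            A ^ 3 = -1 \<and> (\<forall>\<tau>\<in>L. A * \<tau> \<in> L) \<and>
            ((\<exists>\<tau>\<^sub>1\<in>L. \<forall>z. h (z + c) = A * h z + \<theta>\<^sub>1 + \<tau>\<^sub>1) \<or>
             (\<exists>\<tau>\<^sub>2\<in>L. \<forall>z. h (z + c) = A * h z + \<theta>\<^sub>2 + \<tau>\<^sub>2) \<or>
             (\<exists>\<tau>\<^sub>3\<in>L. \<forall>z. h (z + c) = A * h z + \<tau>\<^sub>3)) \<and>
            (\<forall>\<^sub>\<approx>z. f z = exp ((\<alpha> * z + \<beta>) / 3) *
               ((1 / 2 * (1 + deriv wp (h z) / of_real (sqrt 3))) / wp (h z)))))))"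
proof -
  interpret wp_cubic \<omega>\<^sub>1 \<omega>\<^sub>2
    by unfold_locales (use assms(4,5) in \<open>auto simp: wp_def L_def\<close>)
  interpret wp_cubic_zeros \<omega>\<^sub>1 \<omega>\<^sub>2 \<theta>\<^sub>1 \<theta>\<^sub>2
    by unfold_locales (use assms(6-11) in \<open>auto simp: wp_def L_def\<close>)
  have Ueq: "(1 / 2 * (1 + deriv wp w / of_real (sqrt 3))) / wp w = U w" for w
    by (simp add: U_def wp_def)
  have mero: "f meromorphic_on UNIV" using assms(13) by (simp add: nicely_meromorphic_on_def)
  show ?thesis
    unfolding Ueq
  proof (rule iffI, goal_cases)
    case eq: 1
    show ?case
    proof (cases "\<exists>d. \<forall>\<^sub>\<approx>z. f z * exp (- poly P z / 3) = d")
      case True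
      then obtain d where "\<forall>\<^sub>\<approx>z. f z * exp (- poly P z / 3) = d" by blast
      then obtain \<alpha> \<beta> where P: "P = [:\<beta>, \<alpha>:]" and d: "d \<noteq> 0" "d ^ 3 * (1 + exp (\<alpha> * c)) = 1"
        "\<And>z. f z = d * exp ((\<alpha> * z + \<beta>) / 3)"
        by (rule exponential_solution[OF assms(13,14,12) eq]) (rule that)
      have "poly P z = \<alpha> * z + \<beta>" for z by (simp add: P mult.commute)
      with d show ?thesis by blast
    next
      case False
      obtain \<alpha> \<beta> h A \<theta> \<tau> where *: "P = [:\<beta>, \<alpha>:]" "exp (\<alpha> * c) = 1"
        "h holomorphic_on UNIV" "\<not> h constant_on UNIV" "A ^ 3 = - 1" "\<And>\<tau>. \<tau> \<in> L \<Longrightarrow> A * \<tau> \<in> L"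
        "\<theta> = \<theta>\<^sub>1 \<or> \<theta> = \<theta>\<^sub>2 \<or> \<theta> = 0" "\<tau> \<in> L" "\<And>z. h (z + c) = A * h z + \<theta> + \<tau>"
        "\<forall>\<^sub>\<approx>z. f z = exp (poly P z / 3) * U (h z)"
        by (rule elliptic_solution[OF mero assms(12) eq False, folded L_def]) (rule that)
      have P: "poly P z = \<alpha> * z + \<beta>" for z by (simp add: *(1) mult.commute)
      have shift: "(\<exists>\<tau>\<^sub>1\<in>L. \<forall>z. h (z + c) = A * h z + \<theta>\<^sub>1 + \<tau>\<^sub>1) \<or>
             (\<exists>\<tau>\<^sub>2\<in>L. \<forall>z. h (z + c) = A * h z + \<theta>\<^sub>2 + \<tau>\<^sub>2) \<or>
             (\<exists>\<tau>\<^sub>3\<in>L. \<forall>z. h (z + c) = A * h z + \<tau>\<^sub>3)"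
        using *(7)
      proof (elim disjE)
        assume "\<theta> = \<theta>\<^sub>1" thus ?thesis using *(8,9) by blast
      next
        assume "\<theta> = \<theta>\<^sub>2" thus ?thesis using *(8,9) by blast
      next
        assume "\<theta> = 0"
        hence "\<forall>z. h (z + c) = A * h z + \<tau>" using *(9) by simp
        thus ?thesis using *(8) by blast
      qed
      have "\<forall>\<^sub>\<approx>z. f z = exp ((\<alpha> * z + \<beta>) / 3) * U (h z)" using *(10) by (simp only: P)
      with shift *(2-6) P show ?thesis by blast
    qed
  next
    case 2
    then show ?case
    proof (elim exE conjE disjE)
      fix \<alpha> \<beta> d assume P: "\<forall>z. poly P z = \<alpha> * z + \<beta>"
        and d: "d ^ 3 * (1 + exp (\<alpha> * c)) = 1" and fz: "\<forall>z. f z = d * exp ((\<alpha> * z + \<beta>) / 3)"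
      have "f z ^ 3 + f (z + c) ^ 3 = exp (\<alpha> * z + \<beta>)" for z
      proof -
        have "\<alpha> * (z + c) + \<beta> = \<alpha> * c + (\<alpha> * z + \<beta>)" by (simp add: algebra_simps)
        hence "f z ^ 3 + f (z + c) ^ 3 = d ^ 3 * exp (\<alpha> * z + \<beta>) + d ^ 3 * (exp (\<alpha> * c) * exp (\<alpha> * z + \<beta>))"
          unfolding fz[rule_format] power_mult_distrib exp_third_cubed by (simp only: exp_add)
        also have "\<dots> = d ^ 3 * (1 + exp (\<alpha> * c)) * exp (\<alpha> * z + \<beta>)" by (simp add: algebra_simps)
        finally show ?thesis unfolding d by simp
      qed
      thus ?thesis by (simp add: P)
    next
      fix \<alpha> \<beta> h and A :: complex
      assume P: "\<forall>z. poly P z = \<alpha> * z + \<beta>" and \<alpha>: "exp (\<alpha> * c) = 1" and h: "h holomorphic_on UNIV" "\<not> h constant_on UNIV"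
        and A: "A ^ 3 = - 1" and f: "\<forall>\<^sub>\<approx>z. f z = exp ((\<alpha> * z + \<beta>) / 3) * U (h z)"
      note converse = elliptic_solution_converse[OF h A \<alpha> f, folded L_def P[rule_format]]
      {
        assume "\<exists>\<tau>\<^sub>1\<in>L. \<forall>z. h (z + c) = A * h z + \<theta>\<^sub>1 + \<tau>\<^sub>1"
        thus ?thesis using converse[of \<theta>\<^sub>1] by blast
      next
        assume "\<exists>\<tau>\<^sub>2\<in>L. \<forall>z. h (z + c) = A * h z + \<theta>\<^sub>2 + \<tau>\<^sub>2"
        thus ?thesis using converse[of \<theta>\<^sub>2] by blast
      next
        assume "\<exists>\<tau>\<^sub>3\<in>L. \<forall>z. h (z + c) = A * h z + \<tau>\<^sub>3"
        then obtain \<tau> where "\<tau> \<in> L" "\<And>z. h (z + c) = A * h z + 0 + \<tau>" by auto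
        thus ?thesis using converse[of 0 \<tau>] by blast
      }
    qed
  qed
qed

end
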